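(* Let $X=V(f)\subseteq\mathbb{P}^n$ be a hypersurface of degree $d$ over $\mathbb{C}$, with $n,d\geq3$ and $(n,d)\neq(3,3)$. Assume that $X$ has at most isolated singularities and that there exists a hyperplane $H'=V(\ell)$ such that $H'\cap\operatorname{Sing}(X)=\emptyset$ and $W=X\cap H'$ is singular. Let $g\in R'=\mathbb{C}[y_1,\ldots,y_n]$ be an equation of $W$, where $y_1,\ldots,y_n$ are homogeneous coordinates on $H'\simeq\mathbb{P}^{n-1}$. Assume that: (1) $\dim\operatorname{Aut}_{\mathbb{P}^n}(X)=0$; (2) $r(g)=\operatorname{indeg}(\operatorname{Syz}(J_g))>1$; (3) $s(g)=\operatorname{indeg}(I_g)>1$. Then the hyperplane-section map $$\Phi(f):\mathbb{P}^{n*}\dashrightarrow\mathcal{M}(d,n-1)$$ is generically finite onto its image.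
   Context: $f\in\mathbb{C}[x_0,\ldots,x_n]$ is a homogeneous polynomial of degree $d$ defining $X$. $J_g=(g_1,\ldots,g_n)\subseteq R'$ with $g_i=\partial g/\partial y_i$; $I_g=J_g^{\rm sat}$ is the saturation of $J_g$ with respect to the irrelevant ideal $(y_1,\ldots,y_n)$; $\operatorname{Syz}(J_g)=\{(a_1,\ldots,a_n)\in (R')^n\mid\sum a_ig_i=0\}$, graded by the degree of the coefficients $a_i$. For a graded module (or ideal) $N$, $\operatorname{indeg}(N)$ is the smallest degree $k$ with $N_k\neq0$. $\operatorname{Aut}_{\mathbb{P}^n}(X)=\{\gamma\in PGL_{n+1}(\mathbb{C})\mid\gamma(X)=X\}$. $\mathcal{M}(d,n-1)$ is the coarse moduli space of smooth degree $d$ hypersurfaces in $\mathbb{P}^{n-1}$, i.e. the geometric (GIT) quotient by $PGL_n(\mathbb{C})$ of the open subset of $\mathbb{P}(\mathbb{C}[x_1,\ldots,x_n]_d)$ parametrizing smooth hypersurfaces. $U_f=\{H\in\mathbb{P}^{n*}\mid X\cap H\text{ is smooth}\}$ is nonempty and Zariski open, and $\Phi(f)$ is the rational map given on $U_f$ by $H\mapsto[X\cap H]$, where $X\cap H\subseteq H\simeq\mathbb{P}^{n-1}$. It is generically finite onto its image if the general fiber of $\mathbb{P}^{n*}\dashrightarrow\operatorname{Im}\Phi(f)$ is finite, equivalently $\dim\operatorname{Im}\Phi(f)=n$. *)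

theory Defs
  imports "HOL-Analysis.Analysis" "HOL-Library.Poly_Mapping" "HOL-Library.Extended_Nat"
begin

section \<open>Complex polynomials in variables indexed by a set\<close>

text \<open>
  A polynomial is a finitely supported function from monomials to coefficients, and a monomial
  is a finitely supported exponent function.  The ring $\mathbb{C}[x_i \mid i \in I]$ is the set
  \<open>poly_ring I\<close>.  The type of variable indices is arbitrary because the coordinates on the
  projective space of forms of degree \<open>d\<close> are themselves indexed by monomials.
\<close>

type_synonym 'v mpoly = "('v \<Rightarrow>\<^sub>0 nat) \<Rightarrow>\<^sub>0 complex"

definition mvar :: "'v \<Rightarrow> 'v mpoly" where
  "mvar i = Poly_Mapping.single (Poly_Mapping.single i 1) 1"

definition mconst :: "complex \<Rightarrow> 'v mpoly" where
  "mconst c = Poly_Mapping.single 0 c"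

definition poly_ring :: "'v set \<Rightarrow> 'v mpoly set" where
  "poly_ring I = {p. \<forall>m\<in>Poly_Mapping.keys p. Poly_Mapping.keys m \<subseteq> I}"

definition monomials :: "'v set \<Rightarrow> nat \<Rightarrow> ('v \<Rightarrow>\<^sub>0 nat) set" where
  "monomials I d =
     {m. Poly_Mapping.keys m \<subseteq> I \<and> (\<Sum>i\<in>Poly_Mapping.keys m. Poly_Mapping.lookup m i) = d}"

text \<open>The homogeneous polynomials of degree \<open>d\<close>, including zero.\<close>

definition forms :: "'v set \<Rightarrow> nat \<Rightarrow> 'v mpoly set" where
  "forms I d = {p. Poly_Mapping.keys p \<subseteq> monomials I d}"

text \<open>
  \<open>mpoly_map h v\<close> is the ring homomorphism acting as \<open>h\<close> on coefficients and sending the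
  variable \<open>i\<close> to \<open>v i\<close>.
\<close>

definition mpoly_map :: "(complex \<Rightarrow> 'b::comm_ring_1) \<Rightarrow> ('v \<Rightarrow> 'b) \<Rightarrow> 'v mpoly \<Rightarrow> 'b" where
  "mpoly_map h v p =
     (\<Sum>m\<in>Poly_Mapping.keys p. h (Poly_Mapping.lookup p m) *
        (\<Prod>i\<in>Poly_Mapping.keys m. v i ^ Poly_Mapping.lookup m i))"

definition meval :: "('v \<Rightarrow> complex) \<Rightarrow> 'v mpoly \<Rightarrow> complex" where
  "meval v p = mpoly_map (\<lambda>c. c) v p"

definition msubst :: "('v \<Rightarrow> 'w mpoly) \<Rightarrow> 'v mpoly \<Rightarrow> 'w mpoly" where
  "msubst q p = mpoly_map mconst q p"

text \<open>
  In \<open>partial\<close> the exponent subtraction is truncated, but if \<open>i\<close> does not occur in \<open>m\<close> then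
  the coefficient is zero.
\<close>

definition partial :: "'v \<Rightarrow> 'v mpoly \<Rightarrow> 'v mpoly" where
  "partial i p =
     (\<Sum>m\<in>Poly_Mapping.keys p.
        Poly_Mapping.single (m - Poly_Mapping.single i 1)
          (of_nat (Poly_Mapping.lookup m i) * Poly_Mapping.lookup p m))"

definition linear_form :: "'v set \<Rightarrow> ('v \<Rightarrow> complex) \<Rightarrow> 'v mpoly" where
  "linear_form I a = (\<Sum>i\<in>I. mconst (a i) * mvar i)"

section \<open>Vectors and matrices\<close>

definition vecs :: "'v set \<Rightarrow> ('v \<Rightarrow> complex) set" where
  "vecs I = {v. \<forall>i. i \<notin> I \<longrightarrow> v i = 0}"

definition nonzero_vecs :: "'v set \<Rightarrow> ('v \<Rightarrow> complex) set" where
  "nonzero_vecs I = vecs I - {\<lambda>_. 0}"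

definition mat_vec :: "'w set \<Rightarrow> ('v \<times> 'w \<Rightarrow> complex) \<Rightarrow> ('w \<Rightarrow> complex) \<Rightarrow> 'v \<Rightarrow> complex" where
  "mat_vec J A v = (\<lambda>i. \<Sum>j\<in>J. A (i, j) * v j)"

definition mat_mul ::
  "'v set \<Rightarrow> ('v \<times> 'v \<Rightarrow> complex) \<Rightarrow> ('v \<times> 'v \<Rightarrow> complex) \<Rightarrow> 'v \<times> 'v \<Rightarrow> complex" where
  "mat_mul I A B = (\<lambda>(i, k). \<Sum>j\<in>I. A (i, j) * B (j, k))"

definition mat_one :: "'v set \<Rightarrow> 'v \<times> 'v \<Rightarrow> complex" where
  "mat_one I = (\<lambda>(i, j). if i \<in> I \<and> i = j then 1 else 0)"

definition GL :: "'v set \<Rightarrow> ('v \<times> 'v \<Rightarrow> complex) set" where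
  "GL I = {A \<in> vecs (I \<times> I).
     \<exists>B\<in>vecs (I \<times> I). mat_mul I A B = mat_one I \<and> mat_mul I B A = mat_one I}"

text \<open>The composition of the polynomial \<open>p\<close> with the linear map \<open>mat_vec J A\<close>.\<close>

definition lin_subst :: "'w set \<Rightarrow> ('v \<times> 'w \<Rightarrow> complex) \<Rightarrow> 'v mpoly \<Rightarrow> 'w mpoly" where
  "lin_subst J A p = msubst (\<lambda>i. linear_form J (\<lambda>j. A (i, j))) p"

section \<open>Projective space and its Zariski topology\<close>

text \<open>A point of projective space is the set of its vectors of homogeneous coordinates.\<close>

definition proj_point :: "('v \<Rightarrow> complex) \<Rightarrow> ('v \<Rightarrow> complex) set" where
  "proj_point v = {\<lambda>i. c * v i | c. c \<noteq> 0}"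

definition proj_space :: "'v set \<Rightarrow> ('v \<Rightarrow> complex) set set" where
  "proj_space I = proj_point ` nonzero_vecs I"

definition vanishing_locus :: "'v set \<Rightarrow> 'v mpoly \<Rightarrow> ('v \<Rightarrow> complex) set set" where
  "vanishing_locus I p = proj_point ` {v \<in> nonzero_vecs I. meval v p = 0}"

text \<open>The complements of the loci \<open>V(p)\<close>, \<open>p\<close> homogeneous, form a base of the Zariski topology.\<close>

definition zariski :: "'v set \<Rightarrow> ('v \<Rightarrow> complex) set topology" where
  "zariski I = topology_generated_by
     {proj_space I - vanishing_locus I p | p k. p \<in> forms I k}"

definition irreducible_in :: "'a topology \<Rightarrow> 'a set \<Rightarrow> bool" where
  "irreducible_in T Z \<longleftrightarrow> Z \<noteq> {} \<and> Z \<subseteq> topspace T \<and>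
     (\<forall>A B. closedin T A \<and> closedin T B \<and> Z \<subseteq> A \<union> B \<longrightarrow> Z \<subseteq> A \<or> Z \<subseteq> B)"

text \<open>Krull dimension; the empty space gets dimension 0 here.\<close>

definition krull_dim :: "'a topology \<Rightarrow> enat" where
  "krull_dim T = Sup {enat r | r. \<exists>Z::nat \<Rightarrow> 'a set.
     (\<forall>i\<le>r. closedin T (Z i) \<and> irreducible_in T (Z i)) \<and> (\<forall>i<r. Z i \<subset> Z (Suc i))}"

section \<open>Hypersurfaces, singularities, automorphisms\<close>

text \<open>
  The singular locus of the scheme $V(p)$, by the Jacobian criterion.  It is everything if
  \<open>p = 0\<close>.
\<close>

definition sing_locus :: "'v set \<Rightarrow> 'v mpoly \<Rightarrow> ('v \<Rightarrow> complex) set set" where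
  "sing_locus I p = proj_point `
     {v \<in> nonzero_vecs I. meval v p = 0 \<and> (\<forall>i\<in>I. meval v (partial i p) = 0)}"

definition smooth_hypersurface :: "'v set \<Rightarrow> 'v mpoly \<Rightarrow> bool" where
  "smooth_hypersurface I p \<longleftrightarrow> sing_locus I p = {}"

definition isolated_singularities :: "'v set \<Rightarrow> 'v mpoly \<Rightarrow> bool" where
  "isolated_singularities I p \<longleftrightarrow>
     (\<forall>x\<in>sing_locus I p. \<exists>U. openin (zariski I) U \<and> U \<inter> sing_locus I p = {x})"

text \<open>PGL is an open subset of the projective space of matrices.\<close>

definition PGL :: "'v set \<Rightarrow> ('v \<times> 'v \<Rightarrow> complex) set set" where
  "PGL I = proj_point ` GL I"

definition PGL_act ::
  "'v set \<Rightarrow> ('v \<times> 'v \<Rightarrow> complex) set \<Rightarrow> ('v \<Rightarrow> complex) set \<Rightarrow> ('v \<Rightarrow> complex) set" where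
  "PGL_act I \<gamma> x = {mat_vec I A v | A v. A \<in> \<gamma> \<and> v \<in> x}"

definition proj_Aut ::
  "'v set \<Rightarrow> ('v \<Rightarrow> complex) set set \<Rightarrow> ('v \<times> 'v \<Rightarrow> complex) set set" where
  "proj_Aut I X = {\<gamma> \<in> PGL I. PGL_act I \<gamma> ` X = X}"

definition dim_Aut :: "'v set \<Rightarrow> ('v \<Rightarrow> complex) set set \<Rightarrow> enat" where
  "dim_Aut I X = krull_dim (subtopology (zariski (I \<times> I)) (proj_Aut I X))"

section \<open>Jacobian ideal, saturation, syzygies\<close>

definition ideal_gen :: "'v set \<Rightarrow> 'v mpoly set \<Rightarrow> 'v mpoly set" where
  "ideal_gen I S =
     {\<Sum>s\<in>T. c s * s | T c. finite T \<and> T \<subseteq> S \<and> (\<forall>s\<in>T. c s \<in> poly_ring I)}"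

definition jacobian_ideal :: "'v set \<Rightarrow> 'v mpoly \<Rightarrow> 'v mpoly set" where
  "jacobian_ideal I g = ideal_gen I ((\<lambda>i. partial i g) ` I)"

text \<open>The \<open>k\<close>-th power of the irrelevant ideal is generated by the \<open>k\<close>-fold products of variables.\<close>

definition irrelevant_power :: "'v set \<Rightarrow> nat \<Rightarrow> 'v mpoly set" where
  "irrelevant_power I k = ideal_gen I {\<Prod>j<k. mvar (s j) | s. \<forall>j<k. s j \<in> I}"

definition saturation :: "'v set \<Rightarrow> 'v mpoly set \<Rightarrow> 'v mpoly set" where
  "saturation I J = {p \<in> poly_ring I. \<exists>k. \<forall>q\<in>irrelevant_power I k. q * p \<in> J}"

text \<open>
  The argument of \<open>indeg\<close> is the family of graded pieces of a graded module; the value is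
  infinite for the zero module.
\<close>

definition indeg :: "(nat \<Rightarrow> 'a::zero set) \<Rightarrow> enat" where
  "indeg N = Inf {enat k | k. \<exists>x\<in>N k. x \<noteq> 0}"

definition syz_graded :: "'v set \<Rightarrow> 'v mpoly \<Rightarrow> nat \<Rightarrow> ('v \<Rightarrow>\<^sub>0 'v mpoly) set" where
  "syz_graded I g k = {a. Poly_Mapping.keys a \<subseteq> I \<and>
     (\<forall>i\<in>I. Poly_Mapping.lookup a i \<in> forms I k) \<and>
     (\<Sum>i\<in>I. Poly_Mapping.lookup a i * partial i g) = 0}"

definition r_inv :: "'v set \<Rightarrow> 'v mpoly \<Rightarrow> enat" where
  "r_inv I g = indeg (syz_graded I g)"

definition s_inv :: "'v set \<Rightarrow> 'v mpoly \<Rightarrow> enat" where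
  "s_inv I g = indeg (\<lambda>k. saturation I (jacobian_ideal I g) \<inter> forms I k)"

section \<open>The moduli space of smooth hypersurfaces\<close>

text \<open>
  The form \<open>g\<close> of degree \<open>d\<close> corresponds to the point \<open>form_point g\<close> of the projective space with
  coordinates indexed by the monomials of degree \<open>d\<close>.
\<close>

definition form_point :: "'v mpoly \<Rightarrow> (('v \<Rightarrow>\<^sub>0 nat) \<Rightarrow> complex) set" where
  "form_point g = proj_point (Poly_Mapping.lookup g)"

definition smooth_forms_locus :: "'v set \<Rightarrow> nat \<Rightarrow> (('v \<Rightarrow>\<^sub>0 nat) \<Rightarrow> complex) set set" where
  "smooth_forms_locus I d = form_point ` {g \<in> forms I d. g \<noteq> 0 \<and> smooth_hypersurface I g}"

definition PGL_orbit ::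
  "'v set \<Rightarrow> (('v \<Rightarrow>\<^sub>0 nat) \<Rightarrow> complex) set \<Rightarrow> (('v \<Rightarrow>\<^sub>0 nat) \<Rightarrow> complex) set set" where
  "PGL_orbit I x =
     {form_point (lin_subst I B g) | B g. B \<in> GL I \<and> Poly_Mapping.lookup g \<in> x}"

definition quotient_topology :: "'a topology \<Rightarrow> ('a \<Rightarrow> 'b) \<Rightarrow> 'b topology" where
  "quotient_topology T q =
     topology (\<lambda>U. U \<subseteq> q ` topspace T \<and> openin T {x \<in> topspace T. q x \<in> U})"

lemma openin_quotient_topology:
  "openin (quotient_topology T q) U \<longleftrightarrow>
     U \<subseteq> q ` topspace T \<and> openin T {x \<in> topspace T. q x \<in> U}"
proof -
  have "istopology (\<lambda>U. U \<subseteq> q ` topspace T \<and> openin T {x \<in> topspace T. q x \<in> U})"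
    unfolding istopology_def
  proof (intro conjI allI impI)
    fix A B
    assume A: "A \<subseteq> q ` topspace T \<and> openin T {x \<in> topspace T. q x \<in> A}"
      and B: "B \<subseteq> q ` topspace T \<and> openin T {x \<in> topspace T. q x \<in> B}"
    have "{x \<in> topspace T. q x \<in> A \<inter> B} =
        {x \<in> topspace T. q x \<in> A} \<inter> {x \<in> topspace T. q x \<in> B}" by auto
    then show "openin T {x \<in> topspace T. q x \<in> A \<inter> B}" using A B by auto
    show "A \<inter> B \<subseteq> q ` topspace T" using A by auto
  next
    fix K
    assume K: "\<forall>S\<in>K. S \<subseteq> q ` topspace T \<and> openin T {x \<in> topspace T. q x \<in> S}"
    have "{x \<in> topspace T. q x \<in> \<Union>K} = (\<Union>S\<in>K. {x \<in> topspace T. q x \<in> S})" by auto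
    then show "openin T {x \<in> topspace T. q x \<in> \<Union>K}" using K by auto
    show "\<Union>K \<subseteq> q ` topspace T" using K by auto
  qed
  then show ?thesis
    unfolding quotient_topology_def by (simp add: topology_inverse')
qed

text \<open>
  A geometric quotient has the orbits as its (closed) points and carries the quotient of the
  Zariski topology.
\<close>

definition moduli_space :: "'v set \<Rightarrow> nat \<Rightarrow> (('v \<Rightarrow>\<^sub>0 nat) \<Rightarrow> complex) set set topology" where
  "moduli_space I d =
     quotient_topology (subtopology (zariski (monomials I d)) (smooth_forms_locus I d)) (PGL_orbit I)"

section \<open>Hyperplane sections\<close>

text \<open>
  \<open>g\<close> is an equation of $V(f) \cap V(\ell)$, where $\ell = \sum_i a_i x_i$, in some system of
  homogeneous coordinates $y_1, \ldots, y_n$ on $V(\ell)$; such a system is a linear isomorphism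
  from $\mathbb{C}^n$ to the kernel of $\ell$.
\<close>

definition section_equation :: "nat \<Rightarrow> nat mpoly \<Rightarrow> (nat \<Rightarrow> complex) \<Rightarrow> nat mpoly \<Rightarrow> bool" where
  "section_equation n f a g \<longleftrightarrow> (\<exists>A\<in>vecs ({0..n} \<times> {1..n}). \<exists>c.
     bij_betw (mat_vec {1..n} A) (vecs {1..n})
       {v \<in> vecs {0..n}. meval v (linear_form {0..n} a) = 0} \<and>
     c \<noteq> 0 \<and> g = mconst c * lin_subst {1..n} A f)"

text \<open>
  A hyperplane \<open>H\<close> of $\mathbb{P}^n$ is given by the class of its coefficient vectors, a point of
  the dual projective space, whose coordinates are also indexed by \<open>{0..n}\<close>.
\<close>

definition smooth_sections :: "nat \<Rightarrow> nat mpoly \<Rightarrow> (nat \<Rightarrow> complex) set set" where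
  "smooth_sections n f = {H \<in> proj_space {0..n}.
     \<exists>a\<in>H. \<exists>g. section_equation n f a g \<and> smooth_hypersurface {1..n} g}"

text \<open>
  The equation chosen by \<open>SOME\<close> is unique up to a scalar and a linear change of coordinates, so
  its orbit depends on \<open>H\<close> only.
\<close>

definition hyperplane_section_map ::
  "nat \<Rightarrow> nat mpoly \<Rightarrow> (nat \<Rightarrow> complex) set \<Rightarrow> ((nat \<Rightarrow>\<^sub>0 nat) \<Rightarrow> complex) set set" where
  "hyperplane_section_map n f H =
     PGL_orbit {1..n} (form_point (SOME g. \<exists>a\<in>H. section_equation n f a g))"

text \<open>
  \<open>\<phi>\<close> is a map defined on \<open>U\<close> with values in \<open>T\<close>; its fiber is finite over a nonempty dense open
  subset of the image.
\<close>

definition generically_finite_onto_image :: "'b topology \<Rightarrow> 'a set \<Rightarrow> ('a \<Rightarrow> 'b) \<Rightarrow> bool" where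
  "generically_finite_onto_image T U \<phi> \<longleftrightarrow>
     (\<exists>V. openin (subtopology T (\<phi> ` U)) V \<and> V \<noteq> {} \<and>
        subtopology T (\<phi> ` U) closure_of V = \<phi> ` U \<and>
        (\<forall>p\<in>V. finite {x \<in> U. \<phi> x = p}))"

end

theory Submission
  imports Defs "HOL-Computational_Algebra.Polynomial" "HOL-Computational_Algebra.Fundamental_Theorem_Algebra"
begin

text \<open>Let \<open>\<Psi> A\<close> be the coefficient vector of the composition of \<open>f\<close> with the matrix \<open>A\<close>. At a parametrization of
  \<open>H'\<close> the differential of \<open>\<Psi>\<close> is injective: since \<open>H'\<close> avoids the singular points of \<open>f\<close>, a kernel element yields
  a linear form in the saturated Jacobian ideal of \<open>g\<close>, and if this form is zero a linear syzygy of \<open>g\<close>. Hence suitable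
  linear combinations of the components of \<open>\<Psi>\<close> are algebraically independent, every matrix entry is algebraic over them,
  and the fibers of \<open>\<Psi>\<close> are finite over a nonempty set \<open>c \<noteq> 0\<close>. The orbits that meet \<open>c \<noteq> 0\<close> form an open set over
  which the hyperplane-section map has finite fibers. Its intersection with the image is dense because all conditions
  are polynomial in the coefficients of the hyperplane; smoothness is such a condition because a relation between \<open>f\<close>
  and its partial derivatives vanishes on the dual variety and \<open>f\<close> has finitely many singular points.\<close>

section \<open>Evaluation of polynomials\<close>

text \<open>The section by \<open>H'\<close> is singular, so it gives no point of the moduli space,
  and the section map cannot be differentiated there. The map \<Psi> on the affine space of all
  matrices is defined at \<open>H'\<close> as well and replaces it. The linear group of the
  hyperplane coordinates acts on both sides of \<Psi>: a hyperplane whose section lies in a given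
  orbit has a parametrization that \<Psi> sends to any prescribed coefficient vector of a form in
  that orbit, and a parametrization determines its hyperplane. This is why finiteness of single
  fibers of \<Psi> is enough. Two mismatches have to be repaired: a matrix with
  \<open>c \<noteq> 0\<close> need not have full rank, and \<open>c\<close> is not homogeneous
  although Zariski open sets of projective space are described by forms. Transcendence degree is
  replaced by counting monomials, derivatives are the coefficients of \<open>t\<close> in
  substitutions along \<open>A + t * B\<close>, and the zeros demanded by the Nullstellensatz come
  from the uncountability of the complex numbers. Open conditions are nonvanishing of polynomials,
  so finitely many of them hold together as soon as each holds somewhere.\<close>

abbreviation "lookup \<equiv> Poly_Mapping.lookup"
abbreviation "single \<equiv> Poly_Mapping.single"
abbreviation "keys \<equiv> Poly_Mapping.keys"

definition mon :: "('v \<Rightarrow> 'b::comm_ring_1) \<Rightarrow> ('v \<Rightarrow>\<^sub>0 nat) \<Rightarrow> 'b" where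
  "mon v m = (\<Prod>i\<in>keys m. v i ^ lookup m i)"

text \<open>Ring homomorphisms from the constants. The instances used are the identity (evaluation),
  \<open>mconst\<close> (substitution) and the constants of univariate polynomial rings (curves,
  pencils), so one set of rules for \<open>mpoly_map\<close> serves all of them.\<close>

definition coeff_hom :: "(complex \<Rightarrow> 'b::comm_ring_1) \<Rightarrow> bool" where
  "coeff_hom h \<longleftrightarrow> h 0 = 0 \<and> h 1 = 1 \<and> (\<forall>a b. h (a + b) = h a + h b) \<and> (\<forall>a b. h (a * b) = h a * h b)"

lemma mon_superset:
  assumes "finite S" "keys m \<subseteq> S"
  shows "mon v m = (\<Prod>i\<in>S. v i ^ lookup m i)"
  unfolding mon_def by (rule prod.mono_neutral_left) (use assms in \<open>auto simp: in_keys_iff\<close>)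

lemma mon_add: "mon v (m + m') = mon v m * mon v m'"
proof -
  let ?S = "keys m \<union> keys m'"
  have "mon v (m + m') = (\<Prod>i\<in>?S. v i ^ lookup (m + m') i)"
    by (rule mon_superset) (use keys_add[of m m'] in auto)
  also have "\<dots> = (\<Prod>i\<in>?S. v i ^ lookup m i) * (\<Prod>i\<in>?S. v i ^ lookup m' i)"
    by (simp add: lookup_add power_add prod.distrib)
  finally show ?thesis by (subst (1 2) mon_superset[of ?S]) auto
qed

lemma mon_0 [simp]: "mon v 0 = 1" by (simp add: mon_def)

lemma mon_single [simp]: "mon v (single i k) = v i ^ k"
  by (cases "k = 0") (auto simp: mon_def)

lemma mpoly_map_superset:
  assumes "finite S" "keys p \<subseteq> S" "h 0 = 0"
  shows "mpoly_map h v p = (\<Sum>m\<in>S. h (lookup p m) * mon v m)"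
  unfolding mpoly_map_def mon_def[symmetric]
  by (rule sum.mono_neutral_left) (use assms in \<open>auto simp: in_keys_iff\<close>)

lemma sum_singles: "(\<Sum>m\<in>keys p. single m (lookup p m)) = p"
  by (rule poly_mapping_eqI) (auto simp: lookup_sum lookup_single when_def in_keys_iff)

lemma sum_singles_superset:
  assumes "finite S" "keys p \<subseteq> S"
  shows "(\<Sum>m\<in>S. single m (lookup p m)) = p"
proof -
  have "(\<Sum>m\<in>S. single m (lookup p m)) = (\<Sum>m\<in>keys p. single m (lookup p m))"
    by (rule sum.mono_neutral_right) (use assms in \<open>auto simp: in_keys_iff\<close>)
  then show ?thesis by (simp add: sum_singles)
qed

context
  fixes h :: "complex \<Rightarrow> 'b::comm_ring_1"
  assumes h: "coeff_hom h"
begin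

lemma coeff_hom_0: "h 0 = 0" using h by (simp add: coeff_hom_def)

lemma mpoly_map_add: "mpoly_map h v (p + q) = mpoly_map h v p + mpoly_map h v q"
proof -
  let ?S = "keys p \<union> keys q"
  have "mpoly_map h v (p + q) = (\<Sum>m\<in>?S. h (lookup (p + q) m) * mon v m)"
    by (rule mpoly_map_superset) (use keys_add[of p q] in \<open>auto simp: coeff_hom_0\<close>)
  also have "\<dots> = (\<Sum>m\<in>?S. h (lookup p m) * mon v m) + (\<Sum>m\<in>?S. h (lookup q m) * mon v m)"
    using h by (simp add: lookup_add coeff_hom_def distrib_right sum.distrib)
  finally show ?thesis by (subst (1 2) mpoly_map_superset[of ?S]) (auto simp: coeff_hom_0)
qed

lemma mpoly_map_single [simp]: "mpoly_map h v (single m c) = h c * mon v m"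
  by (simp add: mpoly_map_superset[of "{m}"] coeff_hom_0)

lemma mpoly_map_0 [simp]: "mpoly_map h v 0 = 0" by (simp add: mpoly_map_def)

lemma mpoly_map_sum: "mpoly_map h v (\<Sum>x\<in>A. p x) = (\<Sum>x\<in>A. mpoly_map h v (p x))"
  by (induction A rule: infinite_finite_induct) (auto simp: mpoly_map_add)

lemma mpoly_map_mult: "mpoly_map h v (p * q) = mpoly_map h v p * mpoly_map h v q"
proof -
  have "mpoly_map h v (p * q) = mpoly_map h v
      ((\<Sum>m\<in>keys p. single m (lookup p m)) * (\<Sum>m\<in>keys q. single m (lookup q m)))"
    by (simp add: sum_singles)
  also have "\<dots> = (\<Sum>m\<in>keys p. \<Sum>m'\<in>keys q. h (lookup p m * lookup q m') * mon v (m + m'))"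
    by (simp add: sum_product mpoly_map_sum mult_single)
  also have "\<dots> = mpoly_map h v p * mpoly_map h v q"
    using h unfolding mpoly_map_def mon_def[symmetric] sum_product
    by (simp add: mon_add coeff_hom_def mult_ac)
  finally show ?thesis .
qed

lemma mpoly_map_1 [simp]: "mpoly_map h v 1 = 1"
  using mpoly_map_single[of v 0 1] h by (simp add: coeff_hom_def)

lemma mpoly_map_mconst [simp]: "mpoly_map h v (mconst c) = h c"
  by (simp add: mconst_def)

lemma mpoly_map_mvar [simp]: "mpoly_map h v (mvar i) = v i"
  using h by (simp add: mvar_def coeff_hom_def)

lemma mpoly_map_prod: "mpoly_map h v (\<Prod>x\<in>A. p x) = (\<Prod>x\<in>A. mpoly_map h v (p x))"
  by (induction A rule: infinite_finite_induct) (auto simp: mpoly_map_mult)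

lemma mpoly_map_power: "mpoly_map h v (p ^ k) = mpoly_map h v p ^ k"
  by (induction k) (auto simp: mpoly_map_mult)

lemma mpoly_map_uminus: "mpoly_map h v (- p) = - mpoly_map h v p"
  by (metis add.inverse_inverse mpoly_map_0 mpoly_map_add add_eq_0_iff)

lemma mpoly_map_diff: "mpoly_map h v (p - q) = mpoly_map h v p - mpoly_map h v q"
  using mpoly_map_add[of v p "- q"] by (simp add: mpoly_map_uminus)

lemma mpoly_map_linear_form: "mpoly_map h v (linear_form I a) = (\<Sum>i\<in>I. h (a i) * v i)"
  by (simp add: linear_form_def mpoly_map_sum mpoly_map_mult)

end

lemma coeff_hom_id [simp]: "coeff_hom (\<lambda>c. c)" by (simp add: coeff_hom_def)

lemma mconst_0 [simp]: "mconst 0 = 0" and mconst_1 [simp]: "mconst 1 = 1"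
  and mconst_add: "mconst (a + b) = mconst a + mconst b"
  and mconst_mult: "mconst (a * b) = mconst a * mconst b"
  by (simp_all add: mconst_def single_add mult_single)

lemma mconst_power: "mconst (c ^ k) = mconst c ^ k"
  by (induction k) (simp_all add: mconst_mult)

lemma coeff_hom_mconst [simp]: "coeff_hom mconst"
  by (simp add: coeff_hom_def mconst_add mconst_mult)

lemmas mpoly_map_simps = mpoly_map_add mpoly_map_mult mpoly_map_sum mpoly_map_prod mpoly_map_power mpoly_map_diff
  mpoly_map_uminus mpoly_map_0 mpoly_map_1 mpoly_map_mconst mpoly_map_mvar mpoly_map_linear_form mpoly_map_single

lemmas meval_simps [simp] = mpoly_map_simps[OF coeff_hom_id, folded meval_def]

lemmas msubst_simps [simp] = mpoly_map_simps[OF coeff_hom_mconst, folded msubst_def]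

lemma lookup_mconst_mult [simp]: "lookup (mconst c * p) m = c * lookup p m"
proof -
  have "mconst c * p = (\<Sum>m\<in>keys p. single m (c * lookup p m))"
    by (subst sum_singles[of p, symmetric]) (simp only: sum_distrib_left mconst_def mult_single add_0)
  then show ?thesis by (auto simp: lookup_sum lookup_single when_def in_keys_iff)
qed

lemma mconst_mon: "single m c = mconst c * mon mvar m"
proof -
  have *: "mon mvar m = single m (1::complex)" for m :: "'v \<Rightarrow>\<^sub>0 nat"
  proof -
    have pw: "mvar i ^ k = single (single i k) (1::complex)" for i :: 'v and k
      by (induction k) (auto simp: mvar_def mult_single single_add[symmetric] single_one)
    have "finite A \<Longrightarrow> (\<Prod>i\<in>A. mvar i ^ lookup m i) =
        single (\<Sum>i\<in>A. single i (lookup m i)) (1::complex)" for A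
      by (induction A rule: finite_induct) (auto simp: pw mult_single single_one)
    then show ?thesis unfolding mon_def by (simp add: sum_singles)
  qed
  show ?thesis by (simp add: * mconst_def mult_single)
qed

lemma mpoly_sum_mon: "p = (\<Sum>m\<in>keys p. mconst (lookup p m) * mon mvar m)"
  by (subst sum_singles[of p, symmetric]) (simp add: mconst_mon)

section \<open>The rings \<open>poly_ring I\<close>: closure, induction and substitution\<close>

lemma poly_ring_closed [simp, intro]:
  shows "mconst c \<in> poly_ring I" "i \<in> I \<Longrightarrow> mvar i \<in> poly_ring I" "0 \<in> poly_ring I" "1 \<in> poly_ring I"
    "p \<in> poly_ring I \<Longrightarrow> q \<in> poly_ring I \<Longrightarrow> p + q \<in> poly_ring I"
    "p \<in> poly_ring I \<Longrightarrow> q \<in> poly_ring I \<Longrightarrow> p * q \<in> poly_ring I"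
proof -
  show "mconst c \<in> poly_ring I" "i \<in> I \<Longrightarrow> mvar i \<in> poly_ring I" "0 \<in> poly_ring I" "1 \<in> poly_ring I"
    by (auto simp: poly_ring_def mconst_def mvar_def split: if_splits)
  show "p \<in> poly_ring I \<Longrightarrow> q \<in> poly_ring I \<Longrightarrow> p + q \<in> poly_ring I"
    unfolding poly_ring_def using keys_add[of p q] by blast
  assume p: "p \<in> poly_ring I" and q: "q \<in> poly_ring I"
  show "p * q \<in> poly_ring I" unfolding poly_ring_def
  proof (clarify)
    fix m x assume m: "m \<in> keys (p * q)" "x \<in> keys m"
    then obtain a b where "m = a + b" "a \<in> keys p" "b \<in> keys q" using keys_mult[of p q] by blast
    then show "x \<in> I" using m(2) p q keys_add[of a b] unfolding poly_ring_def by blast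
  qed
qed

lemma poly_ring_sum: "(\<And>x. x \<in> A \<Longrightarrow> p x \<in> poly_ring I) \<Longrightarrow> (\<Sum>x\<in>A. p x) \<in> poly_ring I"
  by (induction A rule: infinite_finite_induct) auto

lemma poly_ring_prod: "(\<And>x. x \<in> A \<Longrightarrow> p x \<in> poly_ring I) \<Longrightarrow> (\<Prod>x\<in>A. p x) \<in> poly_ring I"
  by (induction A rule: infinite_finite_induct) auto

lemma poly_ring_power: "p \<in> poly_ring I \<Longrightarrow> p ^ k \<in> poly_ring I"
  by (induction k) auto

lemma poly_ring_mono: "p \<in> poly_ring I \<Longrightarrow> I \<subseteq> J \<Longrightarrow> p \<in> poly_ring J"
  unfolding poly_ring_def by blast

text \<open>Constants and variables generate the ring, so identities between ring homomorphisms or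
  derivations need to be checked on generators only.\<close>

lemma poly_ring_induct [consumes 1, case_names mconst mvar add mult]:
  fixes p :: "'v mpoly"
  assumes p: "p \<in> poly_ring I"
    and c: "\<And>c. P (mconst c)" and v: "\<And>i. i \<in> I \<Longrightarrow> P (mvar i)"
    and a: "\<And>p q. P p \<Longrightarrow> P q \<Longrightarrow> P (p + q)" and m: "\<And>p q. P p \<Longrightarrow> P q \<Longrightarrow> P (p * q)"
  shows "P p"
proof -
  have 1: "P 1" and 0: "P 0" using c[of 1] c[of 0] by simp_all
  have pw: "P (mvar i ^ k)" if "i \<in> I" for i k
    using that by (induction k) (auto intro: m v 1)
  have mon: "P (mon mvar m)" if "keys m \<subseteq> I" for m
  proof -
    have "finite A \<Longrightarrow> A \<subseteq> I \<Longrightarrow> P (\<Prod>i\<in>A. mvar i ^ lookup m i)" for A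
      by (induction A rule: finite_induct) (auto intro: m pw 1)
    then show ?thesis using that by (simp add: mon_def)
  qed
  have "finite A \<Longrightarrow> A \<subseteq> keys p \<Longrightarrow> P (\<Sum>m\<in>A. mconst (lookup p m) * mon mvar m)" for A
    by (induction A rule: finite_induct) (use p in \<open>auto intro!: m a c mon 0 simp: poly_ring_def\<close>)
  then have "P (\<Sum>m\<in>keys p. mconst (lookup p m) * mon mvar m)" by simp
  then show ?thesis by (simp flip: mpoly_sum_mon)
qed

lemma poly_ring_UNIV [simp]: "p \<in> poly_ring UNIV" by (simp add: poly_ring_def)

lemmas mpoly_induct [case_names mconst mvar add mult] = poly_ring_induct[OF poly_ring_UNIV, simplified]

lemma meval_msubst: "meval v (msubst q p) = meval (\<lambda>i. meval v (q i)) p"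
  by (induction p rule: mpoly_induct) simp_all

lemma meval_lin_subst: "meval y (lin_subst J A p) = meval (mat_vec J A y) p"
  by (simp add: lin_subst_def meval_msubst mat_vec_def)

lemma poly_ringD: "p \<in> poly_ring I \<Longrightarrow> m \<in> keys p \<Longrightarrow> i \<in> keys m \<Longrightarrow> i \<in> I"
  by (auto simp: poly_ring_def)

lemma mpoly_map_cong:
  assumes "p \<in> poly_ring I" "\<And>i. i \<in> I \<Longrightarrow> v i = w i"
  shows "mpoly_map h v p = mpoly_map h w p"
  unfolding mpoly_map_def
  by (intro sum.cong refl arg_cong2[of _ _ _ _ "(*)"] prod.cong)
    (simp add: assms(2)[OF poly_ringD[OF assms(1)]])

lemmas meval_cong = mpoly_map_cong[where h = "\<lambda>c. c", folded meval_def]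
lemmas msubst_cong = mpoly_map_cong[where h = mconst, folded msubst_def]

lemma msubst_poly_ring:
  assumes "p \<in> poly_ring I" "\<And>i. i \<in> I \<Longrightarrow> q i \<in> poly_ring J"
  shows "msubst q p \<in> poly_ring J"
  unfolding msubst_def mpoly_map_def
  by (intro poly_ring_sum poly_ring_closed(6) poly_ring_closed(1) poly_ring_prod poly_ring_power)
     (rule assms(2)[OF poly_ringD[OF assms(1)]])

lemma msubst_mvar: "msubst mvar p = p"
  by (induction p rule: mpoly_induct) simp_all

section \<open>Monomials of given degree and homogeneous forms\<close>

lemma mdegree_sum_superset:
  assumes "finite S" "keys m \<subseteq> S"
  shows "(\<Sum>i\<in>keys m. lookup m i) = (\<Sum>i\<in>S. lookup m i :: nat)"
  by (rule sum.mono_neutral_left) (use assms in \<open>auto simp: in_keys_iff\<close>)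

lemma monomials_0 [simp]: "0 \<in> monomials I 0" by (simp add: monomials_def)

lemma monomials_add:
  assumes "m \<in> monomials I d" "m' \<in> monomials I e"
  shows "m + m' \<in> monomials I (d + e)"
proof -
  let ?S = "keys m \<union> keys m'"
  have "(\<Sum>i\<in>keys (m + m'). lookup (m + m') i) = (\<Sum>i\<in>?S. lookup (m + m') i)"
    by (rule mdegree_sum_superset) (use keys_add[of m m'] in auto)
  also have "\<dots> = (\<Sum>i\<in>?S. lookup m i) + (\<Sum>i\<in>?S. lookup m' i)"
    by (simp add: lookup_add sum.distrib)
  also have "\<dots> = d + e"
    using assms mdegree_sum_superset[of ?S m] mdegree_sum_superset[of ?S m'] by (simp add: monomials_def)
  finally show ?thesis using assms keys_add[of m m'] by (auto simp: monomials_def)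
qed

lemma finite_monomials: "finite I \<Longrightarrow> finite (monomials I d)"
proof -
  assume I: "finite I"
  have "lookup ` monomials I d \<subseteq> {g. \<forall>i. (i \<in> I \<longrightarrow> g i \<in> {..d}) \<and> (i \<notin> I \<longrightarrow> g i = 0)}"
  proof clarify
    fix m i assume m: "m \<in> monomials I d"
    show "(i \<in> I \<longrightarrow> lookup m i \<in> {..d}) \<and> (i \<notin> I \<longrightarrow> lookup m i = 0)"
    proof (cases "i \<in> keys m")
      case True
      then have "lookup m i \<le> (\<Sum>i\<in>keys m. lookup m i)" by (intro member_le_sum) auto
      then show ?thesis using m True by (auto simp: monomials_def)
    next
      case False then show ?thesis by (simp add: in_keys_iff)
    qed
  qed
  moreover have "finite {g. \<forall>i. (i \<in> I \<longrightarrow> g i \<in> {..d}) \<and> (i \<notin> I \<longrightarrow> g i = (0::nat))}"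
    by (rule finite_set_of_finite_funs) (use I in auto)
  ultimately have "finite (lookup ` monomials I d)" by (rule finite_subset)
  then show ?thesis by (rule finite_imageD) (simp add: inj_on_def lookup_inject)
qed

lemma forms_closed [simp, intro]:
  shows "mconst c \<in> forms I 0" "i \<in> I \<Longrightarrow> mvar i \<in> forms I 1" "0 \<in> forms I d"
    "p \<in> forms I d \<Longrightarrow> q \<in> forms I d \<Longrightarrow> p + q \<in> forms I d"
    "p \<in> forms I d \<Longrightarrow> q \<in> forms I e \<Longrightarrow> p * q \<in> forms I (d + e)"
proof -
  show "mconst c \<in> forms I 0" "i \<in> I \<Longrightarrow> mvar i \<in> forms I 1" "0 \<in> forms I d"
    by (auto simp: forms_def mconst_def mvar_def monomials_def split: if_splits)
  show "p \<in> forms I d \<Longrightarrow> q \<in> forms I d \<Longrightarrow> p + q \<in> forms I d"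
    unfolding forms_def using keys_add[of p q] by blast
  show "p \<in> forms I d \<Longrightarrow> q \<in> forms I e \<Longrightarrow> p * q \<in> forms I (d + e)"
    unfolding forms_def using keys_mult[of p q] monomials_add by blast
qed

lemma forms_1 [simp, intro]: "1 \<in> forms I 0" using forms_closed(1)[of 1 I] by simp

lemma forms_mconst_mult: "p \<in> forms I d \<Longrightarrow> mconst c * p \<in> forms I d"
  using forms_closed(5)[of "mconst c" I 0 p d] by simp

lemma forms_sum: "(\<And>x. x \<in> A \<Longrightarrow> p x \<in> forms I d) \<Longrightarrow> (\<Sum>x\<in>A. p x) \<in> forms I d"
  by (induction A rule: infinite_finite_induct) auto

lemma forms_power: "p \<in> forms I d \<Longrightarrow> p ^ k \<in> forms I (k * d)"
  by (induction k) auto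

lemma forms_prod:
  "finite A \<Longrightarrow> (\<And>x. x \<in> A \<Longrightarrow> p x \<in> forms I (e x)) \<Longrightarrow> (\<Prod>x\<in>A. p x) \<in> forms I (\<Sum>x\<in>A. e x)"
  by (induction A rule: finite_induct) auto

lemma forms_linear_form: "linear_form I a \<in> forms I 1"
  unfolding linear_form_def by (intro forms_sum forms_mconst_mult forms_closed(2))

lemma forms_poly_ring: "p \<in> forms I d \<Longrightarrow> p \<in> poly_ring I"
  unfolding forms_def poly_ring_def monomials_def by blast

lemma msubst_forms:
  assumes "p \<in> forms I d" "\<And>i. i \<in> I \<Longrightarrow> q i \<in> forms J e"
  shows "msubst q p \<in> forms J (d * e)"
  unfolding msubst_def mpoly_map_def
proof (intro forms_sum forms_mconst_mult)
  fix m assume "m \<in> keys p"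
  then have m: "keys m \<subseteq> I" "(\<Sum>i\<in>keys m. lookup m i) = d" using assms(1) by (auto simp: forms_def monomials_def)
  have "(\<Prod>i\<in>keys m. q i ^ lookup m i) \<in> forms J (\<Sum>i\<in>keys m. lookup m i * e)"
    by (intro forms_prod forms_power) (use m assms(2) in auto)
  then show "(\<Prod>i\<in>keys m. q i ^ lookup m i) \<in> forms J (d * e)"
    using m(2) by (simp add: sum_distrib_right[symmetric])
qed

lemma lin_subst_forms: "p \<in> forms I d \<Longrightarrow> lin_subst J A p \<in> forms J d"
  unfolding lin_subst_def using msubst_forms[of p I d _ J 1] forms_linear_form by force

lemma meval_scale:
  assumes "p \<in> forms I d"
  shows "meval (\<lambda>i. c * v i) p = c ^ d * meval v p"
proof -
  have "(\<Prod>i\<in>keys m. (c * v i) ^ lookup m i) = c ^ d * mon v m" if "m \<in> keys p" for m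
    using that assms by (auto simp: forms_def monomials_def mon_def power_mult_distrib prod.distrib power_sum)
  then show ?thesis
    unfolding meval_def mpoly_map_def mon_def[symmetric] sum_distrib_left by (intro sum.cong) (auto simp: mult_ac)
qed

section \<open>Zeros of polynomials and algebraic dependence\<close>

text \<open>Gaussian elimination, by induction on the equations: an equation with a nonzero
  coefficient is solved for one unknown, the pivot, and the remaining equations are freed of
  it.\<close>

lemma underdetermined_system:
  fixes A :: "'j \<Rightarrow> 'i \<Rightarrow> complex"
  assumes "finite J" "finite I" "card J < card I"
  shows "\<exists>x\<in>nonzero_vecs I. \<forall>j\<in>J. (\<Sum>i\<in>I. A j i * x i) = 0"
  using assms
proof (induction J arbitrary: I A rule: finite_induct)
  case empty
  then obtain i where i: "i \<in> I" by fastforce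
  show ?case
    by (rule bexI[of _ "\<lambda>k. if k = i then 1 else 0"]) (use i in \<open>auto simp: nonzero_vecs_def vecs_def fun_eq_iff\<close>)
next
  case (insert j J)
  show ?case
  proof (cases "\<forall>i\<in>I. A j i = 0")
    case True
    have "card J < card I" using insert.hyps insert.prems by simp
    from insert.IH[OF insert.prems(1) this, of A] True show ?thesis by (auto 0 3)
  next
    case False
    then obtain k where k: "k \<in> I" "A j k \<noteq> 0" by auto
    let ?I = "I - {k}"
    have fin: "finite ?I" using insert.prems by simp
    have "card J < card ?I" using insert.hyps insert.prems k by simp
    from insert.IH[OF fin this, of "\<lambda>i l. A i l - A i k * A j l / A j k"] obtain x where
      x: "x \<in> nonzero_vecs ?I" "\<And>i. i \<in> J \<Longrightarrow> (\<Sum>l\<in>?I. (A i l - A i k * A j l / A j k) * x l) = 0" by blast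
    \<comment> \<open>Back substitution: the pivot unknown receives the value that makes equation
      \<open>j\<close> true.\<close>
    define y where "y = x(k := - (\<Sum>l\<in>?I. A j l * x l) / A j k)"
    have yk: "y k = - (\<Sum>l\<in>?I. A j l * x l) / A j k" by (simp add: y_def)
    have split: "(\<Sum>l\<in>I. A i l * y l) = A i k * y k + (\<Sum>l\<in>?I. A i l * x l)" for i
      using insert.prems(1) k(1) by (subst sum.remove[of _ k]) (auto simp: y_def)
    have "(\<Sum>l\<in>I. A j l * y l) = 0"
      using k(2) by (simp add: split yk)
    moreover have "(\<Sum>l\<in>I. A i l * y l) = 0" if "i \<in> J" for i
    proof -
      have "(\<Sum>l\<in>?I. A i l * x l) - A i k / A j k * (\<Sum>l\<in>?I. A j l * x l) = 0"
        using x(2)[OF that] by (simp add: sum_subtractf[symmetric] sum_distrib_left algebra_simps)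
      then show ?thesis unfolding split yk by (simp add: field_simps)
    qed
    moreover obtain l where "l \<in> ?I" "x l \<noteq> 0" using x(1) by (auto simp: nonzero_vecs_def vecs_def fun_eq_iff)
    then have "y \<in> nonzero_vecs I"
      using x(1) k(1) by (auto simp: nonzero_vecs_def vecs_def fun_eq_iff y_def)
    ultimately show ?thesis by auto
  qed
qed

lemma meval_curve: "meval (\<lambda>i. poly (r i) t) p = poly (mpoly_map (\<lambda>c. [:c:]) r p) t"
proof -
  have h: "coeff_hom (\<lambda>c::complex. [:c:])" by (simp add: coeff_hom_def one_pCons)
  show ?thesis by (induction p rule: mpoly_induct) (simp_all add: mpoly_map_simps[OF h])
qed

lemma meval_line_finite:
  assumes "meval v p \<noteq> 0"
  shows "finite {t. meval (\<lambda>i. v i + t * w i) p = 0}"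
proof -
  define r where "r = mpoly_map (\<lambda>c. [:c:]) (\<lambda>i. [:v i, w i:]) p"
  have r: "meval (\<lambda>i. v i + t * w i) p = poly r t" for t
    using meval_curve[of "\<lambda>i. [:v i, w i:]" t p] by (simp add: r_def)
  have "r \<noteq> 0" using r[of 0] assms by auto
  then show ?thesis by (simp add: r poly_roots_finite)
qed

text \<open>On the line from \<open>v\<close> to \<open>w\<close> each polynomial is nonzero at one
  end, hence has finitely many zeros on it. This is the irreducibility of affine space in the form
  used throughout: open conditions that can be met separately can be met together.\<close>

lemma common_nonzero:
  assumes "meval v p \<noteq> 0" "meval w q \<noteq> 0" "v \<in> vecs I" "w \<in> vecs I"
  shows "\<exists>z\<in>vecs I. meval z p \<noteq> 0 \<and> meval z q \<noteq> 0"
proof -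
  have flip: "meval (\<lambda>i. v i + t * (w i - v i)) q = meval (\<lambda>i. w i + (1 - t) * (v i - w i)) q" for t
    by (rule arg_cong[where f = "\<lambda>x. meval x q"]) (auto simp: algebra_simps)
  have sub: "{t. meval (\<lambda>i. v i + t * (w i - v i)) q = 0} \<subseteq> (\<lambda>t. 1 - t) ` {t. meval (\<lambda>i. w i + t * (v i - w i)) q = 0}"
  proof
    fix t assume "t \<in> {t. meval (\<lambda>i. v i + t * (w i - v i)) q = 0}"
    then have "1 - t \<in> {t. meval (\<lambda>i. w i + t * (v i - w i)) q = 0}" unfolding mem_Collect_eq flip .
    then show "t \<in> (\<lambda>t. 1 - t) ` {t. meval (\<lambda>i. w i + t * (v i - w i)) q = 0}" by (rule rev_image_eqI) simp
  qed
  have "finite ({t. meval (\<lambda>i. v i + t * (w i - v i)) p = 0} \<union> {t. meval (\<lambda>i. v i + t * (w i - v i)) q = 0})"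
    using meval_line_finite[OF assms(1)] finite_subset[OF sub finite_imageI[OF meval_line_finite[OF assms(2)]]] by simp
  from ex_new_if_finite[OF infinite_UNIV_char_0 this] obtain t where
    "meval (\<lambda>i. v i + t * (w i - v i)) p \<noteq> 0" "meval (\<lambda>i. v i + t * (w i - v i)) q \<noteq> 0" by auto
  then show ?thesis using assms(3,4) by (intro bexI[of _ "\<lambda>i. v i + t * (w i - v i)"]) (auto simp: vecs_def)
qed

text \<open>The variable \<open>i\<close> becomes the indeterminate and all other variables move
  into the coefficients. These keep the same type; \<open>coeff_as_univariate\<close> records that
  \<open>i\<close> no longer occurs in them.\<close>

definition as_univariate :: "'v \<Rightarrow> 'v mpoly \<Rightarrow> 'v mpoly poly" where
  "as_univariate i = mpoly_map (\<lambda>c. [:mconst c:]) (\<lambda>j. if j = i then [:0, 1:] else [:mvar j:])"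

lemma coeff_hom_poly_mconst: "coeff_hom (\<lambda>c. [:mconst c:])"
  by (simp add: coeff_hom_def mconst_add mconst_mult one_pCons)

lemmas as_univariate_simps = mpoly_map_simps[OF coeff_hom_poly_mconst]

lemma poly_as_univariate: "poly (as_univariate i p) (mvar i) = p"
  unfolding as_univariate_def by (induction p rule: mpoly_induct) (simp_all add: as_univariate_simps)

lemma coeff_as_univariate:
  assumes "p \<in> poly_ring I"
  shows "coeff (as_univariate i p) e \<in> poly_ring (I - {i})"
  using assms unfolding as_univariate_def
  by (induction p arbitrary: e rule: poly_ring_induct)
     (auto simp: as_univariate_simps coeff_mult coeff_pCons intro!: poly_ring_sum split: nat.splits)

lemma meval_as_univariate:
  "meval v p = (\<Sum>e\<le>degree (as_univariate i p). meval v (coeff (as_univariate i p) e) * v i ^ e)"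
proof -
  have "meval v p = meval v (poly (as_univariate i p) (mvar i))" by (simp add: poly_as_univariate)
  also have "\<dots> = (\<Sum>e\<le>degree (as_univariate i p). meval v (coeff (as_univariate i p) e) * v i ^ e)"
    by (simp add: poly_altdef)
  finally show ?thesis .
qed

lemma finite_roots_as_univariate:
  assumes "p \<in> poly_ring I" "meval v (coeff (as_univariate i p) e) \<noteq> 0"
  shows "finite {t. meval (v(i := t)) p = 0}"
proof -
  let ?q = "as_univariate i p"
  define r where "r = (\<Sum>e\<le>degree ?q. monom (meval v (coeff ?q e)) e)"
  have "meval (v(i := t)) p = poly r t" for t
    unfolding meval_as_univariate[of "v(i := t)" p i] r_def
    by (auto simp: poly_sum poly_monom intro!: sum.cong meval_cong[OF coeff_as_univariate[OF assms(1)]])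
  moreover have "e \<le> degree ?q" using assms(2) by (intro le_degree) auto
  then have "coeff r e = meval v (coeff ?q e)" by (simp add: r_def coeff_sum)
  then have "r \<noteq> 0" using assms(2) by auto
  ultimately show ?thesis by (simp add: poly_roots_finite)
qed

lemma as_univariate_nonzero:
  assumes "p \<noteq> 0" shows "\<exists>e. coeff (as_univariate i p) e \<noteq> 0"
  using assms poly_as_univariate[of i p] by (metis leading_coeff_0_iff poly_0)

text \<open>Induction on the variables: a nonzero coefficient with respect to the new variable is
  nonzero at some point, and over that point only finitely many values of the new variable are
  roots. Consequently identities of polynomials can be checked by evaluation.\<close>

lemma nonzero_value:
  assumes "finite I" "p \<in> poly_ring I" "p \<noteq> 0"
  shows "\<exists>v\<in>vecs I. meval v p \<noteq> 0"
  using assms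
proof (induction I arbitrary: p rule: finite_induct)
  case empty
  have keys: "keys p \<subseteq> {0}"
    using empty.prems by (auto simp: poly_ring_def)
  have "p = single 0 (lookup p 0)"
    using sum_singles_superset[OF _ keys] by simp
  then obtain c where c: "p = mconst c" by (auto simp: mconst_def)
  then have "c \<noteq> 0" using empty.prems by auto
  then show ?case by (intro bexI[of _ "\<lambda>_. 0"]) (auto simp: c vecs_def)
next
  case (insert i I)
  from as_univariate_nonzero[OF insert.prems(2), of i] obtain e where e: "coeff (as_univariate i p) e \<noteq> 0" by blast
  have "coeff (as_univariate i p) e \<in> poly_ring I"
    using coeff_as_univariate[OF insert.prems(1), of i e] insert.hyps by simp
  from insert.IH[OF this e] obtain v where v: "v \<in> vecs I" "meval v (coeff (as_univariate i p) e) \<noteq> 0" by blast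
  from ex_new_if_finite[OF infinite_UNIV_char_0 finite_roots_as_univariate[OF insert.prems(1) v(2)]]
  obtain t where "meval (v(i := t)) p \<noteq> 0" by auto
  moreover have "v(i := t) \<in> vecs (insert i I)" using v(1) by (simp add: vecs_def)
  ultimately show ?case by blast
qed

lemma poly_ring_keys_union: "p \<in> poly_ring (\<Union>m\<in>keys p. keys m)"
  by (auto simp: poly_ring_def)

lemma mpoly_eq_0I: "(\<And>v. meval v p = 0) \<Longrightarrow> p = 0"
  using nonzero_value[OF _ poly_ring_keys_union[of p]] by auto

lemma mpoly_eqI: "(\<And>v. meval v p = meval v q) \<Longrightarrow> p = q"
  using mpoly_eq_0I[of "p - q"] by simp

text \<open>Bounding each exponent instead of the total degree makes the number of monomials an
  exact power, \<open>(e + 1) ^ card I\<close>, and the bounds still add under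
  multiplication.\<close>

definition box_monomials :: "'v set \<Rightarrow> nat \<Rightarrow> ('v \<Rightarrow>\<^sub>0 nat) set" where
  "box_monomials I e = {m. keys m \<subseteq> I \<and> (\<forall>i. lookup m i \<le> e)}"

lemma box_monomials_bij:
  assumes "finite I"
  shows "bij_betw (\<lambda>m. restrict (lookup m) I) (box_monomials I e) (PiE I (\<lambda>_. {..e}))"
proof (rule bij_betw_byWitness[where f' = "\<lambda>g. \<Sum>i\<in>I. single i (g i)"])
  show "\<forall>m\<in>box_monomials I e. (\<Sum>i\<in>I. single i (restrict (lookup m) I i)) = m"
    using assms by (auto simp: box_monomials_def sum_singles_superset)
  have l: "lookup (\<Sum>i\<in>I. single i (g i)) k = (if k \<in> I then g k else 0)" for g :: "'a \<Rightarrow> nat" and k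
    using assms by (auto simp: lookup_sum lookup_single when_def sum.delta)
  show "\<forall>g\<in>PiE I (\<lambda>_. {..e}). restrict (lookup (\<Sum>i\<in>I. single i (g i))) I = g"
    by (auto simp: l fun_eq_iff PiE_def extensional_def)
  show "(\<lambda>m. restrict (lookup m) I) ` box_monomials I e \<subseteq> PiE I (\<lambda>_. {..e})"
    by (auto simp: box_monomials_def)
  show "(\<lambda>g. \<Sum>i\<in>I. single i (g i)) ` PiE I (\<lambda>_. {..e}) \<subseteq> box_monomials I e"
    by (auto simp: box_monomials_def l in_keys_iff split: if_splits)
qed

lemma finite_box_monomials: "finite I \<Longrightarrow> finite (box_monomials I e)"
  using bij_betw_finite[OF box_monomials_bij[of I e]] finite_PiE[of I "\<lambda>_. {..e}"] by simp

lemma card_box_monomials: "finite I \<Longrightarrow> card (box_monomials I e) = (e + 1) ^ card I"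
  using bij_betw_same_card[OF box_monomials_bij[of I e]] by (simp add: card_PiE)

lemma keys_box_mult:
  assumes "keys p \<subseteq> box_monomials I d" "keys q \<subseteq> box_monomials I e"
  shows "keys (p * q) \<subseteq> box_monomials I (d + e)"
proof
  fix m assume "m \<in> keys (p * q)"
  then obtain a b where m: "m = a + b" "a \<in> keys p" "b \<in> keys q" using keys_mult[of p q] by blast
  have ab: "a \<in> box_monomials I d" "b \<in> box_monomials I e" using assms m by auto
  show "m \<in> box_monomials I (d + e)"
    using ab keys_add[of a b] unfolding m(1) box_monomials_def by (auto simp: lookup_add intro: add_mono)
qed

lemma keys_box_power: "keys p \<subseteq> box_monomials I d \<Longrightarrow> keys (p ^ k) \<subseteq> box_monomials I (k * d)"
proof (induction k)
  case 0 then show ?case by (simp add: box_monomials_def)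
next
  case (Suc k) then show ?case using keys_box_mult[of p I d "p ^ k" "k * d"] by simp
qed

lemma keys_box_prod:
  "finite A \<Longrightarrow> (\<And>x. x \<in> A \<Longrightarrow> keys (p x) \<subseteq> box_monomials I (e x)) \<Longrightarrow>
    keys (\<Prod>x\<in>A. p x) \<subseteq> box_monomials I (\<Sum>x\<in>A. e x)"
proof (induction A rule: finite_induct)
  case empty then show ?case by (simp add: box_monomials_def)
next
  case (insert x A) then show ?case using keys_box_mult[of "p x" I "e x" "\<Prod>x\<in>A. p x" "\<Sum>x\<in>A. e x"] by simp
qed

lemma box_monomials_mono: "d \<le> e \<Longrightarrow> box_monomials I d \<subseteq> box_monomials I e"
  by (auto simp: box_monomials_def intro: order_trans)

lemma keys_box_exists:
  assumes "p \<in> poly_ring I"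
  shows "\<exists>d. keys p \<subseteq> box_monomials I d"
proof -
  define d where "d = (\<Sum>m\<in>keys p. \<Sum>i\<in>keys m. lookup m i)"
  have "lookup m i \<le> d" if "m \<in> keys p" for m i
  proof (cases "i \<in> keys m")
    case True
    have "lookup m i \<le> (\<Sum>i\<in>keys m. lookup m i)" using True by (intro member_le_sum) auto
    also have "\<dots> \<le> d" unfolding d_def using that by (intro member_le_sum[of m _ "\<lambda>m. \<Sum>i\<in>keys m. lookup m i"]) auto
    finally show ?thesis .
  next
    case False then show ?thesis by (simp add: in_keys_iff)
  qed
  then show ?thesis using assms by (intro exI[of _ d]) (auto simp: box_monomials_def poly_ring_def)
qed

text \<open>The number of monomials in the \<open>q t\<close> with exponents at most \<open>E\<close> outgrows the dimension of the space of
  polynomials that contains them.\<close>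

lemma algebraic_dependence:
  assumes I: "finite I" and T: "finite T" and card: "card I < card T"
    and q: "\<And>t. t \<in> T \<Longrightarrow> q t \<in> poly_ring I"
  shows "\<exists>Q\<in>poly_ring T. Q \<noteq> 0 \<and> msubst q Q = 0"
proof -
  have "\<forall>t\<in>T. \<exists>d. keys (q t) \<subseteq> box_monomials I d" using q keys_box_exists by blast
  then obtain dd where dd: "\<And>t. t \<in> T \<Longrightarrow> keys (q t) \<subseteq> box_monomials I (dd t)" by metis
  define D where "D = sum dd T"
  have D: "keys (q t) \<subseteq> box_monomials I D" if "t \<in> T" for t
    using dd[OF that] box_monomials_mono[of "dd t" D I] member_le_sum[OF that _ T, of dd] by (auto simp: D_def)
  \<comment> \<open>This choice makes the count close: the dimension of the target is at most
    \<open>((card T * D + 1) * (E + 1)) ^ card I\<close>, which is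
    \<open>E * (E + 1) ^ card I\<close>, while there are at least
    \<open>(E + 1) ^ Suc (card I)\<close> monomials in the \<open>q t\<close>.\<close>
  define E where "E = (card T * D + 1) ^ card I"
  let ?X = "box_monomials T E" and ?Y = "box_monomials I (card T * (E * D))"
  have "card ?Y \<le> ((card T * D + 1) * (E + 1)) ^ card I"
    unfolding card_box_monomials[OF I] by (intro power_mono) (auto simp: algebra_simps)
  also have "\<dots> = E * (E + 1) ^ card I" by (subst power_mult_distrib) (simp only: E_def)
  also have "\<dots> < (E + 1) ^ Suc (card I)" by simp
  also have "\<dots> \<le> card ?X" unfolding card_box_monomials[OF T] using card by (intro power_increasing) auto
  finally have "\<exists>x\<in>nonzero_vecs ?X. \<forall>y\<in>?Y. (\<Sum>m\<in>?X. lookup (mon q m) y * x m) = 0"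
    by (rule underdetermined_system[OF finite_box_monomials[OF I] finite_box_monomials[OF T]])
  then obtain x where x: "x \<in> nonzero_vecs ?X"
    and sys: "\<And>y. y \<in> ?Y \<Longrightarrow> (\<Sum>m\<in>?X. lookup (mon q m) y * x m) = 0" by blast
  define Q where "Q = (\<Sum>m\<in>?X. single m (x m))"
  have lQ: "lookup Q m = x m" for m
    using x finite_box_monomials[OF T, of E]
    by (auto simp: Q_def lookup_sum lookup_single when_def sum.delta nonzero_vecs_def vecs_def)
  have mon_keys: "keys (mon q m) \<subseteq> ?Y" if "m \<in> ?X" for m
  proof -
    have m: "keys m \<subseteq> T" "\<And>i. lookup m i \<le> E" using that by (auto simp: box_monomials_def)
    have "keys (mon q m) \<subseteq> box_monomials I (\<Sum>i\<in>keys m. lookup m i * D)"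
      unfolding mon_def by (intro keys_box_prod keys_box_power D) (use m in auto)
    moreover have "(\<Sum>i\<in>keys m. lookup m i * D) \<le> (\<Sum>i\<in>keys m. E * D)" by (intro sum_mono mult_right_mono m) simp
    moreover have "\<dots> \<le> card T * (E * D)" using card_mono[OF T m(1)] by simp
    ultimately show ?thesis using box_monomials_mono by (meson order_trans)
  qed
  have "msubst q Q = 0"
  proof (rule poly_mapping_eqI)
    fix y
    have "lookup (msubst q Q) y = (\<Sum>m\<in>?X. lookup (mon q m) y * x m)"
      by (simp add: Q_def lookup_sum mult.commute)
    also have "\<dots> = 0"
    proof (cases "y \<in> ?Y")
      case True then show ?thesis by (rule sys)
    next
      case False
      then have "lookup (mon q m) y = 0" if "m \<in> ?X" for m using mon_keys[OF that] by (auto simp: in_keys_iff)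
      then show ?thesis by simp
    qed
    finally show "lookup (msubst q Q) y = lookup 0 y" by simp
  qed
  moreover have "Q \<noteq> 0" using x lQ by (auto simp: nonzero_vecs_def fun_eq_iff poly_mapping_eq_iff)
  moreover have "Q \<in> poly_ring T" using x
    by (auto simp: poly_ring_def in_keys_iff lQ nonzero_vecs_def vecs_def box_monomials_def subset_iff)
  ultimately show ?thesis by blast
qed

section \<open>Derivatives, pencils of substitutions and homogeneous parts\<close>

lemma partial_superset:
  assumes "finite S" "keys p \<subseteq> S"
  shows "partial i p = (\<Sum>m\<in>S. single (m - single i 1) (of_nat (lookup m i) * lookup p m))"
  unfolding partial_def by (rule sum.mono_neutral_left) (use assms in \<open>auto simp: in_keys_iff\<close>)

lemma partial_add: "partial i (p + q) = partial i p + partial i q"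
proof -
  let ?S = "keys p \<union> keys q"
  have "partial i (p + q) = (\<Sum>m\<in>?S. single (m - single i 1) (of_nat (lookup m i) * lookup (p + q) m))"
    by (rule partial_superset) (use keys_add[of p q] in auto)
  also have "\<dots> = partial i p + partial i q"
    by (subst (1 2) partial_superset[of ?S]) (auto simp: lookup_add distrib_left single_add sum.distrib)
  finally show ?thesis .
qed

lemma partial_0 [simp]: "partial i 0 = 0" by (simp add: partial_def)

lemma partial_sum: "partial i (\<Sum>x\<in>A. p x) = (\<Sum>x\<in>A. partial i (p x))"
  by (induction A rule: infinite_finite_induct) (auto simp: partial_add)

lemma partial_single: "partial i (single m c) =
    single (m - single i 1) (of_nat (lookup m i) * c)"
  by (simp add: partial_superset[of "{m}"])

lemma monomial_diff_add:
  fixes m :: "'v \<Rightarrow>\<^sub>0 nat"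
  assumes "lookup m i \<noteq> 0"
  shows "m - single i 1 + single i 1 = m"
  by (rule poly_mapping_eqI) (use assms in \<open>auto simp: lookup_add lookup_minus lookup_single when_def\<close>)

lemma partial_single_mult:
  "partial i (single m a * single m' b) =
    partial i (single m a) * single m' b +
    single m a * partial i (single m' b)"
proof -
  \<comment> \<open>Exponent subtraction is truncated, so it commutes with the addition of monomials
    only if the variable \<open>i\<close> occurs; otherwise the coefficient in question is
    zero.\<close>
  have 1: "m + m' - single i 1 = (m - single i 1) + m'" if "lookup m i \<noteq> 0"
    by (rule poly_mapping_eqI) (use that in \<open>auto simp: lookup_add lookup_minus lookup_single when_def\<close>)
  have 2: "m + m' - single i 1 = m + (m' - single i 1)" if "lookup m' i \<noteq> 0"
    by (rule poly_mapping_eqI) (use that in \<open>auto simp: lookup_add lookup_minus lookup_single when_def\<close>)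
  have 3: "single (m + m' - single i 1) (of_nat (lookup m i) * a * b) =
      single ((m - single i 1) + m') (of_nat (lookup m i) * a * b)"
    by (cases "lookup m i = 0") (simp_all add: 1[unfolded One_nat_def])
  have 4: "single (m + m' - single i 1) (a * (of_nat (lookup m' i) * b)) =
      single (m + (m' - single i 1)) (a * (of_nat (lookup m' i) * b))"
    by (cases "lookup m' i = 0") (simp_all add: 2[unfolded One_nat_def])
  have "partial i (single m a * single m' b) =
     single (m + m' - single i 1) (of_nat (lookup m i) * a * b) +
     single (m + m' - single i 1) (a * (of_nat (lookup m' i) * b))"
    by (simp add: mult_single partial_single lookup_add single_add[symmetric] algebra_simps)
  then show ?thesis unfolding 3 4 by (simp add: partial_single mult_single)
qed

lemma partial_mult: "partial i (p * q) = partial i p * q + p * partial i q"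
proof -
  let ?s = "\<lambda>p m. single m (lookup p m)"
  have "partial i ((\<Sum>m\<in>keys p. ?s p m) * (\<Sum>m\<in>keys q. ?s q m)) =
      (\<Sum>m\<in>keys p. partial i (?s p m)) * (\<Sum>m\<in>keys q. ?s q m) + (\<Sum>m\<in>keys p. ?s p m) * (\<Sum>m\<in>keys q. partial i (?s q m))"
    by (simp add: sum_product partial_sum partial_single_mult sum.distrib)
  then show ?thesis by (simp only: partial_sum[symmetric] sum_singles)
qed

lemma partial_mconst [simp]: "partial i (mconst c) = 0"
  by (simp add: mconst_def partial_single)

lemma partial_mvar: "partial i (mvar j) = (if i = j then 1 else 0)"
  by (auto simp: mvar_def partial_single lookup_single when_def)

lemma partial_linear_form:
  assumes "finite J" "j \<in> J"
  shows "partial j (linear_form J a) = mconst (a j)"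
  using assms by (simp add: linear_form_def partial_sum partial_mult partial_mvar sum.delta' if_distrib cong: if_cong)

lemma partial_mconst_mult: "partial i (mconst c * p) = mconst c * partial i p"
  by (simp add: partial_mult)

lemma keys_monomial_diff: "keys (m - k :: 'v \<Rightarrow>\<^sub>0 nat) \<subseteq> keys m"
  by (auto simp: in_keys_iff lookup_minus)

lemma monomials_diff:
  assumes "m \<in> monomials I d" "lookup m i \<noteq> 0"
  shows "m - single i 1 \<in> monomials I (d - 1)"
proof -
  let ?m = "m - single i 1"
  have k: "keys ?m \<subseteq> keys m"
    by (auto simp: in_keys_iff lookup_minus)
  have i: "i \<in> keys m" using assms(2) by (simp add: in_keys_iff)
  have "(\<Sum>i\<in>keys ?m. lookup ?m i) = (\<Sum>j\<in>keys m. lookup ?m j)"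
    by (rule mdegree_sum_superset) (use k in auto)
  also have "\<dots> = lookup m i - 1 + (\<Sum>j\<in>keys m - {i}. lookup m j)"
    using i by (subst sum.remove[of _ i]) (auto simp: lookup_minus lookup_single when_def intro!: sum.cong split: if_splits)
  also have "\<dots> = d - 1"
    using assms i sum.remove[of "keys m" i "lookup m"] by (auto simp: monomials_def)
  finally show ?thesis using k assms(1) by (auto simp: monomials_def)
qed

lemma partial_forms:
  assumes "p \<in> forms I d"
  shows "partial i p \<in> forms I (d - 1)"
  unfolding partial_def
proof (rule forms_sum)
  fix m assume "m \<in> keys p"
  then have m: "m \<in> monomials I d" using assms by (auto simp: forms_def)
  show "single (m - single i 1) (of_nat (lookup m i) * lookup p m) \<in> forms I (d - 1)"
    using monomials_diff[OF m, of i] by (cases "lookup m i = 0") (auto simp: forms_def split: if_splits)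
qed

lemma partial_poly_ring: "p \<in> poly_ring I \<Longrightarrow> partial i p \<in> poly_ring I"
  unfolding partial_def
  by (rule poly_ring_sum) (use keys_monomial_diff in \<open>fastforce simp: poly_ring_def split: if_splits\<close>)

lemma euler_identity:
  assumes "finite I" "p \<in> forms I d"
  shows "(\<Sum>i\<in>I. mvar i * partial i p) = mconst (of_nat d) * p"
proof -
  have "(\<Sum>i\<in>I. mvar i * partial i (single m c)) = mconst (of_nat d) * single m c"
    if "m \<in> monomials I d" for m c
  proof -
    have *: "mvar i * partial i (single m c) = single m (of_nat (lookup m i) * c)" for i
      using monomial_diff_add[of m i]
      by (cases "lookup m i = 0") (auto simp: mvar_def partial_single mult_single add.commute)
    have "(\<Sum>i\<in>I. single m (of_nat (lookup m i) * c)) = single m (\<Sum>i\<in>I. of_nat (lookup m i) * c)" for I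
      by (induction I rule: infinite_finite_induct) (auto simp: single_add)
    moreover have "(\<Sum>i\<in>I. of_nat (lookup m i) * c) = of_nat d * c"
      using that mdegree_sum_superset[OF assms(1), of m] by (simp add: monomials_def sum_distrib_right[symmetric])
    ultimately show ?thesis by (simp only: * mconst_def mult_single add_0)
  qed
  then have *: "(\<Sum>i\<in>I. mvar i * partial i (single m (lookup p m))) = mconst (of_nat d) * single m (lookup p m)"
    if "m \<in> keys p" for m using that assms(2) by (auto simp: forms_def)
  have "(\<Sum>i\<in>I. mvar i * partial i p) = (\<Sum>i\<in>I. mvar i * partial i (\<Sum>m\<in>keys p. single m (lookup p m)))"
    by (simp add: sum_singles)
  also have "\<dots> = (\<Sum>m\<in>keys p. mconst (of_nat d) * single m (lookup p m))"
    unfolding partial_sum sum_distrib_left by (subst sum.swap) (simp add: *)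
  also have "\<dots> = mconst (of_nat d) * p"
    by (simp add: sum_distrib_left[symmetric] sum_singles)
  finally show ?thesis .
qed

lemma lin_subst_simps [simp]:
  "lin_subst J A (mconst c) = mconst c" "lin_subst J A (mvar i) = linear_form J (\<lambda>j. A (i, j))"
  "lin_subst J A (p + q) = lin_subst J A p + lin_subst J A q"
  "lin_subst J A (p * q) = lin_subst J A p * lin_subst J A q" "lin_subst J A 0 = 0" "lin_subst J A 1 = 1"
  by (simp_all add: lin_subst_def)

lemma partial_lin_subst:
  assumes "finite I" "finite J" "j \<in> J" "p \<in> poly_ring I"
  shows "partial j (lin_subst J A p) = (\<Sum>i\<in>I. mconst (A (i, j)) * lin_subst J A (partial i p))"
  using assms(4)
proof (induction p rule: poly_ring_induct)
  case (mvar i)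
  then show ?case using assms(1)
    by (simp add: partial_linear_form[OF assms(2,3)] partial_mvar if_distrib sum.delta' cong: if_cong)
qed (simp_all add: partial_add partial_mult algebra_simps sum.distrib sum_distrib_left)

text \<open>The composition of a polynomial with \<open>A + t * B\<close>, as a univariate
  polynomial in \<open>t\<close> with polynomial coefficients. Its coefficient of \<open>t\<close>
  is the differential of the substitution at \<open>A\<close> in direction \<open>B\<close>,
  obtained without limits.\<close>

definition pencil :: "'w set \<Rightarrow> ('v \<times> 'w \<Rightarrow> complex) \<Rightarrow> ('v \<times> 'w \<Rightarrow> complex) \<Rightarrow> 'v mpoly \<Rightarrow> 'w mpoly poly" where
  "pencil J A B = mpoly_map (\<lambda>c. [:mconst c:]) (\<lambda>i. [:linear_form J (\<lambda>j. A (i, j)), linear_form J (\<lambda>j. B (i, j)):])"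

lemma linear_form_line:
  "linear_form J a + mconst t * linear_form J b = linear_form J (\<lambda>j. a j + t * b j)"
  by (simp add: linear_form_def mconst_add mconst_mult algebra_simps sum.distrib sum_distrib_left)

lemma poly_pencil: "poly (pencil J A B p) (mconst t) = lin_subst J (\<lambda>k. A k + t * B k) p"
  unfolding pencil_def by (induction p rule: mpoly_induct) (simp_all add: as_univariate_simps linear_form_line)

lemma coeff_0_pencil: "coeff (pencil J A B p) 0 = lin_subst J A p"
  unfolding pencil_def by (induction p rule: mpoly_induct) (simp_all add: as_univariate_simps coeff_mult)

text \<open>The chain rule, checked on generators: both sides are derivations along
  \<open>lin_subst J A\<close>.\<close>

lemma coeff_1_pencil:
  assumes "finite I" "p \<in> poly_ring I"
  shows "coeff (pencil J A B p) 1 = (\<Sum>i\<in>I. linear_form J (\<lambda>j. B (i, j)) * lin_subst J A (partial i p))"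
  using assms(2)
proof (induction p rule: poly_ring_induct)
  case (mconst c) then show ?case by (simp add: pencil_def as_univariate_simps)
next
  case (mvar i) then show ?case using assms(1)
    by (simp add: pencil_def as_univariate_simps partial_mvar if_distrib sum.delta' cong: if_cong)
next
  case (add p q) then show ?case
    by (simp add: pencil_def as_univariate_simps partial_add algebra_simps sum.distrib)
next
  case (mult p q)
  have "coeff (pencil J A B (p * q)) 1 = coeff (pencil J A B p) 0 * coeff (pencil J A B q) 1 + coeff (pencil J A B p) 1 * coeff (pencil J A B q) 0"
    by (simp add: pencil_def as_univariate_simps coeff_mult)
  then show ?case unfolding mult coeff_0_pencil
    by (simp add: partial_mult algebra_simps sum.distrib sum_distrib_left)
qed

definition divisors :: "('v \<Rightarrow>\<^sub>0 nat) \<Rightarrow> ('v \<Rightarrow>\<^sub>0 nat) set" where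
  "divisors m = {a. \<exists>b. m = a + b}"

lemma finite_divisors: "finite (divisors m)"
proof -
  obtain d where "m \<in> box_monomials (keys m) d"
    using keys_box_exists[of "single m 1" "keys m"] by (auto simp: poly_ring_def)
  then have le: "lookup m i \<le> d" for i by (auto simp: box_monomials_def)
  have "divisors m \<subseteq> box_monomials (keys m) d"
  proof
    fix a assume "a \<in> divisors m"
    then obtain b where m: "m = a + b" by (auto simp: divisors_def)
    show "a \<in> box_monomials (keys m) d"
      using le by (auto simp: box_monomials_def m lookup_add in_keys_iff intro: order_trans[OF le_add1])
  qed
  then show ?thesis using finite_subset finite_box_monomials finite_keys by blast
qed

text \<open>The convolution is indexed by \<open>m\<close> alone and not by the supports of the
  factors. Hence \<open>coeff_lin_subst_polynomial\<close> can express a coefficient of a product by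
  one formula for all matrices \<open>A\<close>.\<close>

lemma lookup_mult_divisors: "lookup (p * q) m = (\<Sum>a\<in>divisors m. lookup p a * lookup q (m - a))"
proof -
  have "p * q = (\<Sum>a\<in>keys p. \<Sum>b\<in>keys q. single (a + b) (lookup p a * lookup q b))"
    by (subst sum_singles[of p, symmetric], subst sum_singles[of q, symmetric]) (simp add: sum_product mult_single)
  then have "lookup (p * q) m = (\<Sum>a\<in>keys p. \<Sum>b\<in>keys q. lookup p a * lookup q b when a + b = m)"
    by (simp add: lookup_sum lookup_single)
  also have "\<dots> = (\<Sum>a\<in>keys p. lookup p a * lookup q (m - a) when a \<in> divisors m)"
  proof (rule sum.cong[OF refl])
    fix a
    show "(\<Sum>b\<in>keys q. lookup p a * lookup q b when a + b = m) = (lookup p a * lookup q (m - a) when a \<in> divisors m)"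
    proof (cases "a \<in> divisors m")
      case True
      then obtain c where c: "m = a + c" by (auto simp: divisors_def)
      have "(\<Sum>b\<in>keys q. lookup p a * lookup q b when a + b = m) = (\<Sum>b\<in>keys q. if b = c then lookup p a * lookup q b else 0)"
        by (rule sum.cong) (auto simp: c when_def)
      also have "\<dots> = lookup p a * lookup q c" by (auto simp: sum.delta in_keys_iff)
      finally show ?thesis using True c by (simp add: when_def)
    next
      case False then show ?thesis by (auto simp: divisors_def when_def intro!: sum.neutral)
    qed
  qed
  also have "\<dots> = (\<Sum>a\<in>keys p \<inter> divisors m. lookup p a * lookup q (m - a))"
    by (simp add: when_def sum.If_cases Int_def)
  also have "\<dots> = (\<Sum>a\<in>divisors m. lookup p a * lookup q (m - a))"
    by (rule sum.mono_neutral_left) (auto simp: finite_divisors in_keys_iff)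
  finally show ?thesis .
qed

lemma coeff_lin_subst_polynomial:
  assumes "finite J" "p \<in> poly_ring I"
  shows "\<exists>C. \<forall>m. C m \<in> poly_ring (I \<times> J) \<and> (\<forall>A. meval A (C m) = lookup (lin_subst J A p) m)"
  using assms(2)
proof (induction p rule: poly_ring_induct)
  case (mconst c)
  then show ?case by (intro exI[of _ "\<lambda>m. mconst (lookup (mconst c) m)"]) simp
next
  case (mvar i)
  let ?C = "\<lambda>m. \<Sum>j\<in>J. mconst (lookup (mvar j) m) * mvar (i, j)"
  have C: "meval A (?C m) = lookup (lin_subst J A (mvar i)) m" for A m
    by (simp add: linear_form_def lookup_sum) (simp add: mult.commute)
  have C': "?C m \<in> poly_ring (I \<times> J)" for m using mvar by (intro poly_ring_sum) auto
  show ?case by (intro exI[of _ ?C] allI conjI C C')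
next
  case (add p q)
  then obtain C C' where C: "\<And>m. C m \<in> poly_ring (I \<times> J)" "\<And>m A. meval A (C m) = lookup (lin_subst J A p) m"
    and C': "\<And>m. C' m \<in> poly_ring (I \<times> J)" "\<And>m A. meval A (C' m) = lookup (lin_subst J A q) m" by metis
  show ?case by (intro exI[of _ "\<lambda>m. C m + C' m"]) (simp add: C C' lookup_add)
next
  case (mult p q)
  then obtain C C' where C: "\<And>m. C m \<in> poly_ring (I \<times> J)" "\<And>m A. meval A (C m) = lookup (lin_subst J A p) m"
    and C': "\<And>m. C' m \<in> poly_ring (I \<times> J)" "\<And>m A. meval A (C' m) = lookup (lin_subst J A q) m" by metis
  show ?case by (intro exI[of _ "\<lambda>m. \<Sum>a\<in>divisors m. C a * C' (m - a)"])
     (simp add: C C' lookup_mult_divisors poly_ring_sum)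
qed

definition hom_part :: "nat \<Rightarrow> 'v mpoly \<Rightarrow> 'v mpoly" where
  "hom_part k p = (\<Sum>m\<in>{m \<in> keys p. (\<Sum>i\<in>keys m. lookup m i) = k}. single m (lookup p m))"

lemma hom_part_forms: "p \<in> poly_ring I \<Longrightarrow> hom_part k p \<in> forms I k"
  unfolding hom_part_def
  by (rule forms_sum) (auto simp: forms_def poly_ring_def monomials_def split: if_splits)

lemma hom_part_sum: "\<exists>N. p = (\<Sum>k\<le>N. hom_part k p)"
proof -
  define deg where "deg m = (\<Sum>i\<in>keys m. lookup m i)" for m :: "'a \<Rightarrow>\<^sub>0 nat"
  define N where "N = (\<Sum>m\<in>keys p. deg m)"
  have "deg m \<le> N" if "m \<in> keys p" for m unfolding N_def using that by (intro member_le_sum) auto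
  then have "(\<Sum>k\<le>N. hom_part k p) = (\<Sum>m\<in>keys p. single m (lookup p m))"
    unfolding hom_part_def deg_def[symmetric] by (intro sum.group) auto
  then have "p = (\<Sum>k\<le>N. hom_part k p)" by (simp add: sum_singles)
  then show ?thesis by (rule exI)
qed

lemma meval_scale_sum:
  assumes "p = (\<Sum>k\<le>N. hom_part k p)"
  shows "meval (\<lambda>i. c * v i) p = (\<Sum>k\<le>N. c ^ k * meval v (hom_part k p))"
proof -
  have "meval (\<lambda>i. c * v i) (\<Sum>k\<le>N. hom_part k p) = (\<Sum>k\<le>N. c ^ k * meval v (hom_part k p))"
    by (simp add: meval_scale[OF hom_part_forms[OF poly_ring_UNIV]])
  then show ?thesis using assms by simp
qed

section \<open>The homogeneous Nullstellensatz\<close>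

text \<open>Ideals of the ring in all variables of the index type, even when only the variables in
  some \<open>J\<close> matter. The ideal to which the Nullstellensatz is applied contains the
  variables outside \<open>J\<close>, which forces these coordinates of a zero to vanish.\<close>

definition mideal :: "'v mpoly set \<Rightarrow> bool" where
  "mideal M \<longleftrightarrow> 0 \<in> M \<and> (\<forall>p\<in>M. \<forall>q\<in>M. p + q \<in> M) \<and> (\<forall>r. \<forall>p\<in>M. r * p \<in> M)"

lemma mideal_sum: "mideal M \<Longrightarrow> (\<And>x. x \<in> A \<Longrightarrow> p x \<in> M) \<Longrightarrow> (\<Sum>x\<in>A. p x) \<in> M"
  by (induction A rule: infinite_finite_induct) (auto simp: mideal_def)

lemma mideal_mult: "mideal M \<Longrightarrow> p \<in> M \<Longrightarrow> r * p \<in> M"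
  by (simp add: mideal_def)

lemma mideal_add: "mideal M \<Longrightarrow> p \<in> M \<Longrightarrow> q \<in> M \<Longrightarrow> p + q \<in> M"
  by (simp add: mideal_def)

lemma mideal_diff: "mideal M \<Longrightarrow> p \<in> M \<Longrightarrow> q \<in> M \<Longrightarrow> p - q \<in> M"
  using mideal_add[of M p "-1 * q"] mideal_mult[of M q "-1"] by simp

text \<open>A monomial is determined by the finite graph of its exponents on its support.\<close>

lemma countable_monomials: "countable (UNIV :: ('v::countable \<Rightarrow>\<^sub>0 nat) set)"
proof -
  let ?g = "\<lambda>m :: 'v \<Rightarrow>\<^sub>0 nat. (\<lambda>i. (i, lookup m i)) ` keys m"
  have "inj ?g"
  proof
    fix m m' :: "'v \<Rightarrow>\<^sub>0 nat" assume eq: "?g m = ?g m'"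
    have g: "(i, k) \<in> ?g n \<longleftrightarrow> k \<noteq> 0 \<and> lookup n i = k" for i k and n :: "'v \<Rightarrow>\<^sub>0 nat"
      by (auto simp: in_keys_iff image_iff)
    have "k \<noteq> 0 \<and> lookup m i = k \<longleftrightarrow> k \<noteq> 0 \<and> lookup m' i = k" for i k
      using g[of i k m] g[of i k m'] by (simp only: eq)
    then show "m = m'" by (intro poly_mapping_eqI) metis
  qed
  moreover have "countable (range ?g)"
    by (rule countable_subset[OF _ countable_Collect_finite]) auto
  ultimately show ?thesis using countable_image_inj_on by blast
qed

section \<open>Ideals maximal among those without powers of the variable \<open>s\<close>\<close>

context
  fixes M :: "'v::countable mpoly set" and s :: 'v
  assumes M: "mideal M" and nopow: "\<And>k. mvar s ^ k \<notin> M"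
    and max: "\<And>q. q \<notin> M \<Longrightarrow> \<exists>k r. mvar s ^ k - r * q \<in> M"
begin

text \<open>By \<open>max\<close> every polynomial outside \<open>M\<close> divides a power of
  \<open>s\<close> modulo \<open>M\<close>; multiplying two such relations would put a power of
  \<open>s\<close> into \<open>M\<close>.\<close>

lemma maximal_prime:
  assumes "q * q' \<in> M" shows "q \<in> M \<or> q' \<in> M"
proof (rule ccontr)
  assume "\<not> ?thesis"
  then obtain k r k' r' where *: "mvar s ^ k - r * q \<in> M" "mvar s ^ k' - r' * q' \<in> M" using max by metis
  have "mvar s ^ (k + k') = mvar s ^ k' * (mvar s ^ k - r * q) + (r * q) * (mvar s ^ k' - r' * q') + (r * r') * (q * q')"
    by (simp add: power_add algebra_simps)
  also have "\<dots> \<in> M" by (intro mideal_add mideal_mult M * assms)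
  finally show False using nopow by blast
qed

lemma maximal_mconst: "mconst a * p \<in> M \<Longrightarrow> a \<noteq> 0 \<Longrightarrow> p \<in> M"
  using mideal_mult[OF M, of "mconst a * p" "mconst (1 / a)"] by (simp add: mult.assoc[symmetric] mconst_mult[symmetric])

text \<open>This is \<open>s ^ N * f (x / s)\<close> with denominators cleared. After inverting
  \<open>s\<close> the ideal \<open>M\<close> would become maximal, but the argument stays in the
  polynomial ring.\<close>

definition homogenize :: "'v mpoly \<Rightarrow> complex poly \<Rightarrow> nat \<Rightarrow> 'v mpoly" where
  "homogenize x f N = (\<Sum>e\<le>N. mconst (coeff f e) * x ^ e * mvar s ^ (N - e))"

lemma homogenize_linear_factor:
  assumes "degree f \<le> N"
  shows "homogenize x ([:- c, 1:] * f) (Suc N) = (x - mconst c * mvar s) * homogenize x f N"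
proof -
  have cf: "coeff ([:- c, 1:] * f) e = (case e of 0 \<Rightarrow> 0 | Suc e \<Rightarrow> coeff f e) - c * coeff f e" for e
    by (simp add: coeff_pCons split: nat.split)
  have mm: "mconst (a - b) = mconst a - mconst b" for a b
    using mconst_add[of "a - b" b, symmetric] by (simp add: eq_diff_eq)
  have "homogenize x ([:- c, 1:] * f) (Suc N) =
      (\<Sum>e\<le>Suc N. mconst (case e of 0 \<Rightarrow> 0 | Suc e \<Rightarrow> coeff f e) * x ^ e * mvar s ^ (Suc N - e)) -
      (\<Sum>e\<le>Suc N. mconst (c * coeff f e) * x ^ e * mvar s ^ (Suc N - e))"
    unfolding homogenize_def cf mm by (simp only: left_diff_distrib sum_subtractf)
  also have "(\<Sum>e\<le>Suc N. mconst (case e of 0 \<Rightarrow> 0 | Suc e \<Rightarrow> coeff f e) * x ^ e * mvar s ^ (Suc N - e)) = x * homogenize x f N"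
    unfolding homogenize_def sum.atMost_Suc_shift by (simp add: sum_distrib_left mult_ac)
  also have "(\<Sum>e\<le>Suc N. mconst (c * coeff f e) * x ^ e * mvar s ^ (Suc N - e)) = mconst c * mvar s * homogenize x f N"
    using assms by (simp add: homogenize_def sum_distrib_left mconst_mult mult_ac Suc_diff_le coeff_eq_0)
  finally show ?thesis by (simp add: left_diff_distrib)
qed

lemma homogenize_sum_smult:
  "homogenize x (\<Sum>c\<in>A. smult (l c) (f c)) N = (\<Sum>c\<in>A. mconst (l c) * homogenize x (f c) N)"
proof -
  have ms: "mconst (\<Sum>c\<in>A. g c) = (\<Sum>c\<in>A. mconst (g c))" for g
    by (induction A rule: infinite_finite_induct) (auto simp: mconst_add)
  show ?thesis unfolding homogenize_def sum_distrib_left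
    by (subst sum.swap) (simp add: coeff_sum ms sum_distrib_right sum_distrib_left mconst_mult mult_ac)
qed

lemma degree_linear_prod: "degree (\<Prod>c\<in>A. [:- c, 1 :: complex:]) = card A"
  by (cases "finite A") (simp_all add: degree_prod_eq_sum_degree)

lemma homogenize_linear_prod:
  "finite A \<Longrightarrow> homogenize x (\<Prod>c\<in>A. [:- c, 1:]) (card A) = (\<Prod>c\<in>A. x - mconst c * mvar s)"
proof (induction A rule: finite_induct)
  case empty then show ?case by (simp add: homogenize_def)
next
  case (insert c A)
  then show ?case using homogenize_linear_factor[of "\<Prod>c\<in>A. [:- c, 1:]" "card A" x c] by (simp add: degree_linear_prod)
qed

text \<open>Over the complex numbers \<open>f\<close> splits into linear factors. Their
  homogenizations lie outside the prime ideal \<open>M\<close>, and the remaining constant leaves a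
  power of \<open>s\<close>.\<close>

lemma homogenize_notin:
  assumes x: "\<And>c. x - mconst c * mvar s \<notin> M" and "f \<noteq> 0" "degree f \<le> N"
  shows "homogenize x f N \<notin> M"
  using assms(2,3)
proof (induction "degree f" arbitrary: f N)
  case 0
  then obtain a where f: "f = [:a:]" by (metis degree_eq_zeroE)
  have "homogenize x f N = mconst a * mvar s ^ N"
    unfolding homogenize_def by (subst sum.remove[of _ 0]) (auto simp: f coeff_pCons intro!: sum.neutral split: nat.splits)
  then show ?case using maximal_mconst nopow 0 f by auto
next
  case (Suc n)
  obtain c where "poly f c = 0"
    using fundamental_theorem_of_algebra[of f] Suc.hyps(2) constant_degree[of f] by auto
  then obtain g where g: "f = [:- c, 1:] * g" by (metis poly_eq_0_iff_dvd dvdE)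
  have g0: "g \<noteq> 0" using Suc.prems g by auto
  have "degree f = degree [:- c, 1:] + degree g" unfolding g by (rule degree_mult_eq) (use g0 in auto)
  then have dg: "degree f = Suc (degree g)" by simp
  obtain N' where N: "N = Suc N'" "degree g \<le> N'" using Suc.prems dg by (cases N) auto
  have "homogenize x g N' \<notin> M" using Suc.hyps dg g0 N by auto
  then show ?case using homogenize_linear_factor[OF N(2), of x c] x[of c] maximal_prime g N by metis
qed

text \<open>If no \<open>x - c s\<close> lay in \<open>M\<close>, there would be uncountably many \<open>r c\<close> inverting them up to a power of \<open>s\<close>;
  since there are only countably many monomials, many of the \<open>r c\<close> lie in a common finite-dimensional space.\<close>

lemma maximal_eigenvalue: "\<exists>c. x - mconst c * mvar s \<in> M"
proof (rule ccontr)
  assume "\<not> ?thesis"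
  then have nx: "x - mconst c * mvar s \<notin> M" for c by blast
  let ?l = "\<lambda>c. x - mconst c * mvar s"
  obtain k r where kr: "\<And>c. mvar s ^ k c - r c * ?l c \<in> M" using max[OF nx] by metis
  let ?f = "\<lambda>c. (k c, keys (r c))"
  have "range ?f \<subseteq> UNIV \<times> {A. finite A \<and> A \<subseteq> UNIV}" by auto
  then have cr: "countable (range ?f)"
    by (rule countable_subset) (intro countable_SIGMA countable_Collect_finite_subset countable_monomials, simp)
  have "\<exists>y\<in>range ?f. infinite (?f -` {y})"
  proof (rule ccontr)
    assume "\<not> ?thesis"
    then have "countable (\<Union>y\<in>range ?f. ?f -` {y})" by (intro countable_UN cr countable_finite) auto
    moreover have "(\<Union>y\<in>range ?f. ?f -` {y}) = UNIV" by auto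
    ultimately show False using uncountable_UNIV_complex by simp
  qed
  then obtain K S where inf: "infinite (?f -` {(K, S)})" "(K, S) \<in> range ?f" by auto
  then have S: "finite S" by auto
  obtain C where C: "finite C" "card C = card S + 1" "C \<subseteq> ?f -` {(K, S)}"
    using infinite_arbitrarily_large[OF inf(1)] by blast
  then have C': "k c = K" "keys (r c) = S" if "c \<in> C" for c using that by auto
  from underdetermined_system[OF S C(1), of "\<lambda>m c. lookup (r c) m"] C(2) obtain l where
    l: "l \<in> nonzero_vecs C" "\<And>m. m \<in> S \<Longrightarrow> (\<Sum>c\<in>C. lookup (r c) m * l c) = 0" by auto
  have lr: "(\<Sum>c\<in>C. mconst (l c) * r c) = 0"
  proof (rule poly_mapping_eqI)
    fix m
    show "lookup (\<Sum>c\<in>C. mconst (l c) * r c) m = lookup 0 m"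
    proof (cases "m \<in> S")
      case True then show ?thesis using l(2)[OF True] by (simp add: lookup_sum) (simp add: mult.commute)
    next
      case False then have "lookup (r c) m = 0" if "c \<in> C" for c using C'(2)[OF that] by (auto simp: in_keys_iff)
      then show ?thesis by (simp add: lookup_sum)
    qed
  qed
  \<comment> \<open>The relation between the \<open>r c\<close>, read as a relation between the
    partial fractions \<open>1 / (x - c s)\<close>, with the common denominator cleared.\<close>
  define h where "h = (\<Sum>c\<in>C. mconst (l c) * (\<Prod>c\<in>C - {c}. ?l c))"
  have "mvar s ^ K * h = (\<Sum>c\<in>C. (mconst (l c) * (\<Prod>c\<in>C - {c}. ?l c)) * (mvar s ^ k c - r c * ?l c)) +
      (\<Sum>c\<in>C. mconst (l c) * r c) * (\<Prod>c\<in>C. ?l c)"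
  proof -
    have "(\<Prod>c\<in>C. ?l c) = ?l c * (\<Prod>c\<in>C - {c}. ?l c)" if "c \<in> C" for c
      using C(1) that by (rule prod.remove)
    then have "(\<Sum>c\<in>C. mconst (l c) * r c) * (\<Prod>c\<in>C. ?l c) = (\<Sum>c\<in>C. (mconst (l c) * (\<Prod>c\<in>C - {c}. ?l c)) * (r c * ?l c))"
      unfolding sum_distrib_right by (intro sum.cong refl) (simp add: mult_ac)
    then show ?thesis
      by (simp add: h_def sum_distrib_left right_diff_distrib sum_subtractf C') (simp add: mult_ac)
  qed
  also have "\<dots> \<in> M" unfolding lr mult_zero_left add_0_right by (intro mideal_sum mideal_mult M kr)
  finally have "h \<in> M" using maximal_prime nopow by blast
  \<comment> \<open>The dehomogenization of \<open>h\<close>. At a node \<open>c\<close> with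
    \<open>l c \<noteq> 0\<close> only one summand survives, so \<open>f\<close> is not zero and
    \<open>homogenize_notin\<close> contradicts \<open>h \<in> M\<close>.\<close>
  define f where "f = (\<Sum>c\<in>C. smult (l c) (\<Prod>c\<in>C - {c}. [:- c, 1:]))"
  have "h = homogenize x f (card S)"
    unfolding f_def homogenize_sum_smult h_def
  proof (intro sum.cong refl arg_cong2[of _ _ _ _ "(*)"])
    fix c assume "c \<in> C"
    then have "card (C - {c}) = card S" using C by simp
    then show "(\<Prod>c\<in>C - {c}. ?l c) = homogenize x (\<Prod>c\<in>C - {c}. [:- c, 1:]) (card S)"
      using homogenize_linear_prod[of "C - {c}" x] C(1) by simp
  qed
  moreover have "degree f \<le> card S" unfolding f_def
  proof (rule degree_sum_le[OF C(1)])
    fix c assume "c \<in> C"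
    have "degree (smult (l c) (\<Prod>c\<in>C - {c}. [:- c, 1:])) \<le> card (C - {c})"
      by (rule order_trans[OF degree_smult_le]) (simp only: degree_linear_prod)
    then show "degree (smult (l c) (\<Prod>c\<in>C - {c}. [:- c, 1:])) \<le> card S" using \<open>c \<in> C\<close> C by simp
  qed
  moreover have "f \<noteq> 0"
  proof -
    obtain c where c: "c \<in> C" "l c \<noteq> 0" using l(1) by (auto simp: nonzero_vecs_def vecs_def fun_eq_iff)
    have "poly f c = (\<Sum>c'\<in>C. l c' * (\<Prod>a\<in>C - {c'}. c - a))" by (simp add: f_def poly_sum poly_prod)
    also have "\<dots> = l c * (\<Prod>a\<in>C - {c}. c - a)"
      using C(1) c(1) by (subst sum.remove[of _ c]) (auto intro!: sum.neutral simp: prod_zero_iff)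
    also have "\<dots> \<noteq> 0" using C(1) c(2) by (simp add: prod_zero_iff)
    finally show ?thesis by auto
  qed
  ultimately show False using homogenize_notin[OF nx] \<open>h \<in> M\<close> by blast
qed

text \<open>Modulo \<open>M\<close> every variable \<open>j\<close> is the multiple
  \<open>v j\<close> of \<open>s\<close>, so a form of degree \<open>e\<close> is congruent to its
  value at \<open>v\<close> times \<open>s ^ e\<close>, and no power of \<open>s\<close> lies in
  \<open>M\<close>. An inhomogeneous member of \<open>M\<close> can have a nonzero value at
  \<open>v\<close>.\<close>

lemma maximal_point: "\<exists>v. v s = 1 \<and> (\<forall>p e. p \<in> M \<longrightarrow> p \<in> forms UNIV e \<longrightarrow> meval v p = 0)"
proof -
  have "\<forall>j. \<exists>c. mvar j - mconst c * mvar s \<in> M" using maximal_eigenvalue by blast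
  then obtain c where c: "\<And>j. mvar j - mconst (c j) * mvar s \<in> M" by metis
  \<comment> \<open>For \<open>s\<close> itself the constant 1 is always admissible, since the
    difference is then zero.\<close>
  define v where "v = c(s := 1)"
  have v: "mvar j - mconst (v j) * mvar s \<in> M" for j using c[of j] M by (auto simp: v_def mideal_def)
  let ?\<sigma> = "msubst (\<lambda>j. mconst (v j) * mvar s)"
  have cong: "p - ?\<sigma> p \<in> M" for p
  proof (induction p rule: mpoly_induct)
    case (mconst a) then show ?case using M by (simp add: mideal_def)
  next
    case (mvar i) then show ?case using v by simp
  next
    case (add p q) then show ?case using mideal_add[OF M add] by (simp add: algebra_simps)
  next
    case (mult p q)
    have "q * (p - ?\<sigma> p) + ?\<sigma> p * (q - ?\<sigma> q) \<in> M" by (intro mideal_add mideal_mult M mult)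
    then show ?case by (simp add: algebra_simps)
  qed
  have "meval v p = 0" if p: "p \<in> M" "p \<in> forms UNIV e" for p e
  proof (rule ccontr)
    assume nz: "meval v p \<noteq> 0"
    have "?\<sigma> p = mconst (meval v p) * mvar s ^ e"
      by (rule mpoly_eqI) (simp add: meval_msubst meval_scale[OF p(2)] mult.commute)
    moreover have "?\<sigma> p \<in> M" using mideal_diff[OF M p(1) cong[of p]] by simp
    ultimately show False using maximal_mconst nz nopow by metis
  qed
  then show ?thesis by (intro exI[of _ v]) (auto simp: v_def)
qed

end

text \<open>Zorn's lemma gives an ideal over \<open>K\<close> that is maximal among those without
  powers of \<open>s\<close>, and \<open>maximal_point\<close> applies to it. \<open>K\<close> may
  be inhomogeneous, since only its forms are claimed to vanish at \<open>v\<close>.\<close>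

theorem homogeneous_nullstellensatz:
  fixes K :: "'v::countable mpoly set"
  assumes K: "mideal K" and nopow: "\<And>k. mvar s ^ k \<notin> K"
  shows "\<exists>v. v s = 1 \<and> (\<forall>p e. p \<in> K \<longrightarrow> p \<in> forms UNIV e \<longrightarrow> meval v p = 0)"
proof -
  define \<A> where "\<A> = {M. mideal M \<and> K \<subseteq> M \<and> (\<forall>k. mvar s ^ k \<notin> M)}"
  have "\<exists>M\<in>\<A>. \<forall>X\<in>\<A>. M \<subseteq> X \<longrightarrow> X = M"
  proof (rule subset_Zorn_nonempty)
    show "\<A> \<noteq> {}" using assms by (auto simp: \<A>_def)
    fix C assume C: "C \<noteq> {}" "subset.chain \<A> C"
    then have CA: "C \<subseteq> \<A>" and tot: "\<And>X Y. X \<in> C \<Longrightarrow> Y \<in> C \<Longrightarrow> X \<subseteq> Y \<or> Y \<subseteq> X"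
      by (auto simp: subset_chain_def)
    have id: "mideal X" if "X \<in> C" for X using CA that by (auto simp: \<A>_def)
    have "mideal (\<Union>C)" unfolding mideal_def
    proof (intro conjI ballI allI)
      show "0 \<in> \<Union>C" using C(1) id by (auto simp: mideal_def)
      fix p assume p: "p \<in> \<Union>C"
      show "r * p \<in> \<Union>C" for r using p id mideal_mult by blast
      fix q assume "q \<in> \<Union>C"
      then obtain X Y where XY: "X \<in> C" "p \<in> X" "Y \<in> C" "q \<in> Y" using p by blast
      then have "\<exists>Z\<in>C. p \<in> Z \<and> q \<in> Z" using tot[of X Y] by blast
      then show "p + q \<in> \<Union>C" using id mideal_add by blast
    qed
    then show "\<Union>C \<in> \<A>" using CA C(1) by (auto simp: \<A>_def)
  qed
  then obtain M where MA: "M \<in> \<A>" and mx: "\<And>X. X \<in> \<A> \<Longrightarrow> M \<subseteq> X \<Longrightarrow> X = M" by blast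
  have M: "mideal M" "K \<subseteq> M" "\<And>k. mvar s ^ k \<notin> M" using MA by (auto simp: \<A>_def)
  have "\<exists>k r. mvar s ^ k - r * q \<in> M" if q: "q \<notin> M" for q
  proof -
    \<comment> \<open>The ideal generated by \<open>M\<close> and \<open>q\<close>; being strictly
      larger than \<open>M\<close> it must contain a power of \<open>s\<close>.\<close>
    define N where "N = {p. \<exists>r. p - r * q \<in> M}"
    have "mideal N" unfolding mideal_def
    proof (intro conjI ballI allI)
      show "0 \<in> N" using M(1) unfolding N_def by (auto intro!: exI[of _ 0] simp: mideal_def)
      fix p assume "p \<in> N"
      then obtain r where r: "p - r * q \<in> M" by (auto simp: N_def)
      show "t * p \<in> N" for t
        using mideal_mult[OF M(1) r, of t] unfolding N_def by (auto intro!: exI[of _ "t * r"] simp: algebra_simps)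
      fix p' assume "p' \<in> N"
      then obtain r' where r': "p' - r' * q \<in> M" by (auto simp: N_def)
      show "p + p' \<in> N"
        using mideal_add[OF M(1) r r'] unfolding N_def by (auto intro!: exI[of _ "r + r'"] simp: algebra_simps)
    qed
    moreover have "M \<subseteq> N" by (auto simp: N_def intro!: exI[of _ 0])
    moreover have "q \<in> N" using M(1) by (auto simp: N_def mideal_def intro!: exI[of _ 1])
    ultimately have "N \<notin> \<A>" using mx q by blast
    then show ?thesis using \<open>mideal N\<close> \<open>M \<subseteq> N\<close> M(2) by (auto simp: \<A>_def N_def)
  qed
  from maximal_point[OF M(1) M(3) this] show ?thesis using M(2) by blast
qed

section \<open>Perturbations of a singular section\<close>

lemma mat_vec_vecs: "A \<in> vecs (I \<times> J) \<Longrightarrow> mat_vec J A v \<in> vecs I"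
  by (auto simp: vecs_def mat_vec_def)

lemma mat_vec_lincomb:
  "mat_vec J A (\<lambda>i. \<Sum>x\<in>X. c x * v x i) = (\<lambda>i. \<Sum>x\<in>X. c x * mat_vec J A (v x) i)"
  by (auto simp: mat_vec_def sum_distrib_left fun_eq_iff mult_ac intro: sum.swap)

lemma mat_vec_scale: "mat_vec J A (\<lambda>i. c * v i) = (\<lambda>i. c * mat_vec J A v i)"
  by (auto simp: mat_vec_def sum_distrib_left fun_eq_iff mult_ac)

lemma mat_vec_mat_mul: "mat_vec J (mat_mul K A B) y = mat_vec K A (mat_vec J B y)"
  by (auto simp: mat_vec_def mat_mul_def sum_distrib_left sum_distrib_right fun_eq_iff mult_ac intro: sum.swap)

lemma lin_subst_mat_mul: "lin_subst J (mat_mul K A B) p = lin_subst J B (lin_subst K A p)"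
  by (rule mpoly_eqI) (simp add: meval_lin_subst mat_vec_mat_mul)

lemma mat_mul_vecs:
  assumes "A \<in> vecs (I \<times> K)" "B \<in> vecs (K \<times> J)"
  shows "mat_mul K A B \<in> vecs (I \<times> J)"
  using assms by (auto simp: vecs_def mat_mul_def intro!: sum.neutral)

definition unit_vec :: "'v \<Rightarrow> 'v \<Rightarrow> complex" where
  "unit_vec j = (\<lambda>i. if i = j then 1 else 0)"

lemma unit_vec_vecs [simp]: "j \<in> J \<Longrightarrow> unit_vec j \<in> vecs J"
  by (auto simp: unit_vec_def vecs_def)

lemma sum_mult_unit_vec:
  assumes "finite J" "j \<in> J"
  shows "(\<Sum>k\<in>J. h k * unit_vec j k) = h j" "(\<Sum>k\<in>J. unit_vec j k * h k) = h j"
proof -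
  have "(\<Sum>k\<in>J. h k * unit_vec j k) = (\<Sum>k\<in>J. if k = j then h k else 0)"
    by (rule sum.cong) (auto simp: unit_vec_def)
  then show "(\<Sum>k\<in>J. h k * unit_vec j k) = h j" using assms by simp
  then show "(\<Sum>k\<in>J. unit_vec j k * h k) = h j" by (simp add: mult.commute)
qed

lemma mat_vec_unit_vec: "finite J \<Longrightarrow> j \<in> J \<Longrightarrow> mat_vec J A (unit_vec j) = (\<lambda>i. A (i, j))"
  by (simp add: mat_vec_def sum_mult_unit_vec)

lemma sum_unit_vec:
  assumes "finite J" "v \<in> vecs J"
  shows "(\<Sum>j\<in>J. v j * unit_vec j i) = v i"
proof -
  have "(\<Sum>j\<in>J. v j * unit_vec j i) = (\<Sum>j\<in>J. if j = i then v j else 0)"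
    by (rule sum.cong) (auto simp: unit_vec_def)
  then show ?thesis using assms by (auto simp: vecs_def)
qed

lemma matrix_eqI:
  fixes A :: "'v \<times> 'w \<Rightarrow> complex"
  assumes "finite J" "A \<in> vecs (I \<times> J)" "B \<in> vecs (I \<times> J)"
    and "\<And>y. y \<in> vecs J \<Longrightarrow> mat_vec J A y = mat_vec J B y"
  shows "A = B"
proof
  fix k :: "'v \<times> 'w"
  obtain i j where k: "k = (i, j)" by (cases k)
  show "A k = B k"
  proof (cases "j \<in> J")
    case True
    then show ?thesis using assms(4)[of "unit_vec j"] by (simp add: mat_vec_unit_vec[OF assms(1)] k fun_eq_iff)
  next
    case False then show ?thesis using assms(2,3) by (simp add: vecs_def k)
  qed
qed

lemma sum_mult_swap:
  fixes x :: "'j \<Rightarrow> 'a::comm_ring_1"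
  shows "(\<Sum>k\<in>K. (\<Sum>j\<in>J. x j * b j k) * y k) = (\<Sum>j\<in>J. x j * (\<Sum>k\<in>K. b j k * y k))"
  unfolding sum_distrib_left sum_distrib_right mult.assoc by (rule sum.swap)

abbreviation hyperplane :: "'v set \<Rightarrow> ('v \<Rightarrow> complex) \<Rightarrow> ('v \<Rightarrow> complex) set" where
  "hyperplane I a \<equiv> {v \<in> vecs I. (\<Sum>i\<in>I. a i * v i) = 0}"

text \<open>The identity is split into the projection onto the hyperplane along \<open>u\<close>,
  read in the coordinates of \<open>A\<close> through \<open>L\<close>, and the projection onto
  \<open>u\<close>. With this every matrix is separated into a tangent and a transversal
  part.\<close>

lemma hyperplane_frame:
  fixes A :: "'v \<times> 'v \<Rightarrow> complex"
  assumes I: "finite I" and J: "finite J" and a: "a \<in> nonzero_vecs I" and A: "A \<in> vecs (I \<times> J)"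
    and bij: "bij_betw (mat_vec J A) (vecs J) (hyperplane I a)"
  shows "\<exists>L\<in>vecs (J \<times> I). \<exists>u\<in>vecs I. (\<Sum>i\<in>I. a i * u i) = 1 \<and>
    (\<forall>v\<in>vecs I. \<forall>i. v i = mat_vec J A (mat_vec I L v) i + (\<Sum>i\<in>I. a i * v i) * u i) \<and>
    (\<forall>y\<in>vecs J. mat_vec I L (mat_vec J A y) = y)"
proof -
  obtain k where k: "k \<in> I" "a k \<noteq> 0" using a by (auto simp: nonzero_vecs_def vecs_def fun_eq_iff)
  define u where "u = (\<lambda>i. if i = k then 1 / a k else 0)"
  have u: "u \<in> vecs I" using k by (auto simp: u_def vecs_def)
  have "(\<Sum>i\<in>I. a i * u i) = (\<Sum>i\<in>I. if i = k then a i / a k else 0)"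
    by (rule sum.cong) (auto simp: u_def)
  then have au: "(\<Sum>i\<in>I. a i * u i) = 1" using k I by simp
  define w where "w i = (\<lambda>j. unit_vec i j - a i * u j)" for i
  have w: "w i \<in> hyperplane I a" if "i \<in> I" for i
  proof -
    have "(\<Sum>j\<in>I. a j * unit_vec i j) = a i" by (rule sum_mult_unit_vec(1)[OF I that])
    moreover have "(\<Sum>j\<in>I. a j * w i j) = (\<Sum>j\<in>I. a j * unit_vec i j) - a i * (\<Sum>j\<in>I. a j * u j)"
      by (simp add: w_def sum_subtractf[symmetric] sum_distrib_left algebra_simps)
    ultimately show ?thesis using u unit_vec_vecs[OF that] au by (auto simp: w_def vecs_def)
  qed
  define z where "z i = inv_into (vecs J) (mat_vec J A) (w i)" for i
  have z: "z i \<in> vecs J" "mat_vec J A (z i) = w i" if "i \<in> I" for i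
    unfolding z_def using bij_betw_inv_into_right[OF bij w[OF that]] bij_betwE[OF bij_betw_inv_into[OF bij]] w[OF that]
    by auto
  define L where "L = (\<lambda>(j, i). if i \<in> I then z i j else 0)"
  have L: "L \<in> vecs (J \<times> I)" using z(1) by (auto simp: L_def vecs_def)
  have Lv: "mat_vec I L v = (\<lambda>j. \<Sum>i\<in>I. v i * z i j)" for v
    by (auto simp: mat_vec_def L_def fun_eq_iff mult.commute intro!: sum.cong)
  have dec: "v j = mat_vec J A (mat_vec I L v) j + (\<Sum>i\<in>I. a i * v i) * u j" if v: "v \<in> vecs I" for v j
  proof -
    have "mat_vec J A (mat_vec I L v) j = (\<Sum>i\<in>I. v i * w i j)"
      unfolding Lv mat_vec_lincomb by (intro sum.cong) (simp_all add: z)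
    also have "\<dots> = (\<Sum>i\<in>I. v i * unit_vec i j) - (\<Sum>i\<in>I. a i * v i) * u j"
      by (simp add: w_def right_diff_distrib sum_subtractf sum_distrib_left sum_distrib_right mult_ac)
    also have "(\<Sum>i\<in>I. v i * unit_vec i j) = v j" by (rule sum_unit_vec[OF I v])
    finally show ?thesis by simp
  qed
  have "mat_vec I L (mat_vec J A y) = y" if y: "y \<in> vecs J" for y
  proof -
    have "mat_vec J A y \<in> hyperplane I a" using bij_betwE[OF bij] y by blast
    then have Ay: "mat_vec J A y \<in> vecs I" "(\<Sum>i\<in>I. a i * mat_vec J A y i) = 0" by auto
    have "mat_vec J A (mat_vec I L (mat_vec J A y)) i = mat_vec J A y i" for i
      using dec[OF Ay(1), of i] unfolding Ay(2) by simp
    then have "mat_vec J A (mat_vec I L (mat_vec J A y)) = mat_vec J A y" by (rule ext)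
    then show ?thesis using bij_betw_imp_inj_on[OF bij] y mat_vec_vecs[OF L] by (auto dest: inj_onD)
  qed
  then show ?thesis using L u au dec by (intro bexI[of _ L] bexI[of _ u] conjI ballI allI) auto
qed

section \<open>Generated ideals and powers of the irrelevant ideal\<close>

lemma ideal_gen_0: "0 \<in> ideal_gen I S"
  unfolding ideal_gen_def by (auto intro!: exI[of _ "{}"])

lemma ideal_gen_base: "s \<in> S \<Longrightarrow> s \<in> ideal_gen I S"
  unfolding ideal_gen_def by (auto intro!: exI[of _ "{s}"] exI[of _ "\<lambda>_. 1"])

lemma ideal_gen_add:
  assumes "p \<in> ideal_gen I S" "q \<in> ideal_gen I S" shows "p + q \<in> ideal_gen I S"
proof -
  obtain T c where p: "p = (\<Sum>s\<in>T. c s * s)" "finite T" "T \<subseteq> S" "\<forall>s\<in>T. c s \<in> poly_ring I"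
    using assms(1) unfolding ideal_gen_def by blast
  obtain T' c' where q: "q = (\<Sum>s\<in>T'. c' s * s)" "finite T'" "T' \<subseteq> S" "\<forall>s\<in>T'. c' s \<in> poly_ring I"
    using assms(2) unfolding ideal_gen_def by blast
  let ?c = "\<lambda>s. (if s \<in> T then c s else 0) + (if s \<in> T' then c' s else 0)"
  have "(\<Sum>s\<in>T. c s * s) = (\<Sum>s\<in>T \<union> T'. (if s \<in> T then c s else 0) * s)"
    using p(2) q(2) by (intro sum.mono_neutral_cong_left) auto
  moreover have "(\<Sum>s\<in>T'. c' s * s) = (\<Sum>s\<in>T \<union> T'. (if s \<in> T' then c' s else 0) * s)"
    using p(2) q(2) by (intro sum.mono_neutral_cong_left) auto
  ultimately have "p + q = (\<Sum>s\<in>T \<union> T'. ?c s * s)"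
    unfolding p(1) q(1) by (simp add: sum.distrib[symmetric] distrib_right)
  moreover have "\<forall>s\<in>T \<union> T'. ?c s \<in> poly_ring I" using p(4) q(4) by auto
  ultimately show ?thesis unfolding ideal_gen_def using p(2,3) q(2,3)
    by (intro CollectI exI[of _ "T \<union> T'"] exI[of _ ?c]) auto
qed

lemma ideal_gen_mult:
  assumes "p \<in> ideal_gen I S" "r \<in> poly_ring I" shows "r * p \<in> ideal_gen I S"
proof -
  obtain T c where p: "p = (\<Sum>s\<in>T. c s * s)" "finite T" "T \<subseteq> S" "\<forall>s\<in>T. c s \<in> poly_ring I"
    using assms(1) unfolding ideal_gen_def by blast
  then have "r * p = (\<Sum>s\<in>T. (r * c s) * s)" by (simp add: sum_distrib_left mult.assoc)
  then show ?thesis unfolding ideal_gen_def using p assms(2)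
    by (intro CollectI exI[of _ T] exI[of _ "\<lambda>s. r * c s"]) auto
qed

lemma ideal_gen_sum: "(\<And>x. x \<in> X \<Longrightarrow> p x \<in> ideal_gen I S) \<Longrightarrow> (\<Sum>x\<in>X. p x) \<in> ideal_gen I S"
  by (induction X rule: infinite_finite_induct) (auto simp: ideal_gen_0 ideal_gen_add)

lemma ideal_gen_subset_mideal:
  assumes "mideal M" "S \<subseteq> M" "p \<in> ideal_gen I S" shows "p \<in> M"
  using assms unfolding ideal_gen_def by (auto intro!: mideal_sum mideal_mult)

lemma ideal_gen_poly_ring:
  assumes "S \<subseteq> poly_ring I" "p \<in> ideal_gen I S" shows "p \<in> poly_ring I"
  using assms unfolding ideal_gen_def by (auto intro!: poly_ring_sum)

text \<open>Pigeonhole: among more factors than the sum of the \<open>k i\<close> some variable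
  \<open>i\<close> occurs at least \<open>k i\<close> times. This turns powers of single variables,
  which the Nullstellensatz provides, into the condition that defines the saturation.\<close>

lemma irrelevant_power_subset_mideal:
  assumes J: "finite J" and M: "mideal M" and k: "\<And>i. i \<in> J \<Longrightarrow> mvar i ^ k i \<in> M"
  shows "irrelevant_power J (Suc (\<Sum>i\<in>J. k i)) \<subseteq> M"
proof -
  let ?N = "Suc (\<Sum>i\<in>J. k i)"
  have "(\<Prod>j<?N. mvar (s j)) \<in> M" if s: "\<forall>j<?N. s j \<in> J" for s
  proof -
    have "\<exists>i\<in>J. k i \<le> card {j \<in> {..<?N}. s j = i}"
    proof (rule ccontr)
      assume "\<not> ?thesis"
      then have "(\<Sum>i\<in>J. card {j \<in> {..<?N}. s j = i}) \<le> (\<Sum>i\<in>J. k i)" by (intro sum_mono) force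
      moreover have "(\<Sum>i\<in>J. \<Sum>j\<in>{j \<in> {..<?N}. s j = i}. 1) = (\<Sum>j\<in>{..<?N}. 1::nat)"
        by (rule sum.group) (use J s in auto)
      ultimately show False by simp
    qed
    then obtain i where i: "i \<in> J" "k i \<le> card {j \<in> {..<?N}. s j = i}" by blast
    let ?T = "{j \<in> {..<?N}. s j = i}"
    have "(\<Prod>j<?N. mvar (s j)) = (\<Prod>j\<in>{..<?N} - ?T. mvar (s j)) * (\<Prod>j\<in>?T. mvar (s j))"
      by (rule prod.subset_diff) auto
    also have "(\<Prod>j\<in>?T. mvar (s j)) = mvar i ^ card ?T" by simp
    also have "\<dots> = mvar i ^ (card ?T - k i) * mvar i ^ k i" using i(2) by (simp add: power_add[symmetric])
    finally show ?thesis using k[OF i(1)] by (auto intro!: mideal_mult M)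
  qed
  then have "{\<Prod>j<?N. mvar (s j) | s. \<forall>j<?N. s j \<in> J} \<subseteq> M" by auto
  from ideal_gen_subset_mideal[OF M this] show ?thesis unfolding irrelevant_power_def by blast
qed

lemma irrelevant_power_poly_ring: "irrelevant_power J k \<subseteq> poly_ring J"
proof -
  have "{\<Prod>j<k. mvar (s j) | s. \<forall>j<k. s j \<in> J} \<subseteq> poly_ring J" by (auto intro!: poly_ring_prod)
  from ideal_gen_poly_ring[OF this] show ?thesis unfolding irrelevant_power_def by blast
qed

lemma indeg_gt_1:
  assumes "indeg N > 1" "x \<in> N 1" shows "x = 0"
proof (rule ccontr)
  assume "x \<noteq> 0"
  then have "indeg N \<le> enat 1" unfolding indeg_def using assms(2) by (intro Inf_lower) auto
  then show False using assms(1) by (simp add: one_enat_def)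
qed

lemma linear_form_eq_0:
  assumes "finite J" "linear_form J a = 0" "j \<in> J" shows "a j = 0"
  using arg_cong[OF partial_linear_form[OF assms(1,3), of a], of "meval (\<lambda>_. 0)"] by (simp add: assms(2))

lemma partial_poly_ring_id:
  assumes "p \<in> poly_ring J" shows "msubst (\<lambda>i. if i \<in> J then mvar i else 0) p = p"
  using msubst_cong[OF assms, of _ mvar] by (simp add: msubst_mvar)

lemma meval_partial_lin_subst:
  assumes "finite I" "finite J" "j \<in> J" "f \<in> poly_ring I"
  shows "meval y (partial j (lin_subst J A f)) = (\<Sum>i\<in>I. A (i, j) * meval (mat_vec J A y) (partial i f))"
  by (simp add: partial_lin_subst[OF assms] meval_lin_subst)

text \<open>At a singular section that avoids the singular points of \<open>f\<close>, every perturbation \<open>B\<close> of the parametrization \<open>A\<close>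
  that is trivial to first order splits into a part \<open>b\<close> tangent to the hyperplane, a linear syzygy of \<open>g\<close>, and a
  transversal part \<open>\<beta>\<close>, a linear form in the saturated Jacobian ideal of \<open>g\<close>.\<close>

lemma differential_injective:
  fixes f g :: "'v::countable mpoly"
  assumes I: "finite I" and J: "finite J" and a: "a \<in> nonzero_vecs I" and A: "A \<in> vecs (I \<times> J)"
    and bij: "bij_betw (mat_vec J A) (vecs J) (hyperplane I a)"
    and f: "f \<in> forms I d" and d: "d \<ge> 1"
    and g: "g = mconst c * lin_subst J A f" and c: "c \<noteq> 0"
    and disj: "vanishing_locus I (linear_form I a) \<inter> sing_locus I f = {}"
    and r: "r_inv J g > 1" and s: "s_inv J g > 1"
    and B: "B \<in> vecs (I \<times> J)"
    and zero: "(\<Sum>i\<in>I. linear_form J (\<lambda>j. B (i, j)) * lin_subst J A (partial i f)) = 0"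
  shows "B = (\<lambda>_. 0)"
proof -
  obtain L u where L: "L \<in> vecs (J \<times> I)" and u: "u \<in> vecs I" and au: "(\<Sum>i\<in>I. a i * u i) = 1"
    and dec: "\<And>v i. v \<in> vecs I \<Longrightarrow> v i = mat_vec J A (mat_vec I L v) i + (\<Sum>i\<in>I. a i * v i) * u i"
    using hyperplane_frame[OF I J a A bij] by blast
  have fr: "f \<in> poly_ring I" using f by (rule forms_poly_ring)
  \<comment> \<open>By \<open>hyperplane_frame\<close>, \<open>b\<close> holds the components of
    \<open>B\<close> along the hyperplane and \<open>\<beta>\<close> those along \<open>u\<close>.
    \<open>F\<close> is the derivative of \<open>f\<close> in direction \<open>u\<close>, restricted
    to the hyperplane and scaled like \<open>g\<close>.\<close>
  define b where "b = mat_mul I L B"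
  define \<beta> where "\<beta> k = (\<Sum>i\<in>I. a i * B (i, k))" for k
  define F where "F = mconst c * (\<Sum>i\<in>I. mconst (u i) * lin_subst J A (partial i f))"
  have Bdec: "B (i, k) = (\<Sum>j\<in>J. A (i, j) * b (j, k)) + \<beta> k * u i" for i k
  proof -
    have "(\<lambda>i. B (i, k)) \<in> vecs I" using B by (auto simp: vecs_def)
    from dec[OF this, of i] show ?thesis by (simp add: b_def \<beta>_def mat_vec_def mat_mul_def)
  qed
  have lfB: "linear_form J (\<lambda>k. B (i, k)) =
      (\<Sum>j\<in>J. mconst (A (i, j)) * linear_form J (\<lambda>k. b (j, k))) + mconst (u i) * linear_form J \<beta>" for i
  proof (rule mpoly_eqI)
    fix y
    have "(\<Sum>k\<in>J. B (i, k) * y k) = (\<Sum>k\<in>J. (\<Sum>j\<in>J. A (i, j) * b (j, k)) * y k) + u i * (\<Sum>k\<in>J. \<beta> k * y k)"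
      by (simp add: Bdec algebra_simps sum.distrib sum_distrib_left)
    then show "meval y (linear_form J (\<lambda>k. B (i, k))) = meval y
        ((\<Sum>j\<in>J. mconst (A (i, j)) * linear_form J (\<lambda>k. b (j, k))) + mconst (u i) * linear_form J \<beta>)"
      unfolding sum_mult_swap by simp
  qed
  have dg: "partial j g = mconst c * (\<Sum>i\<in>I. mconst (A (i, j)) * lin_subst J A (partial i f))" if "j \<in> J" for j
    unfolding g partial_mconst_mult partial_lin_subst[OF I J that fr] ..
  have "(\<Sum>i\<in>I. linear_form J (\<lambda>j. B (i, j)) * lin_subst J A (partial i f)) =
      (\<Sum>i\<in>I. (\<Sum>j\<in>J. linear_form J (\<lambda>k. b (j, k)) * mconst (A (i, j))) * lin_subst J A (partial i f)) +
      linear_form J \<beta> * (\<Sum>i\<in>I. mconst (u i) * lin_subst J A (partial i f))"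
    by (simp add: lfB algebra_simps sum.distrib sum_distrib_left)
  also have "(\<Sum>i\<in>I. (\<Sum>j\<in>J. linear_form J (\<lambda>k. b (j, k)) * mconst (A (i, j))) * lin_subst J A (partial i f)) =
      (\<Sum>j\<in>J. linear_form J (\<lambda>k. b (j, k)) * (\<Sum>i\<in>I. mconst (A (i, j)) * lin_subst J A (partial i f)))"
    by (rule sum_mult_swap)
  finally have "mconst c * (\<Sum>i\<in>I. linear_form J (\<lambda>j. B (i, j)) * lin_subst J A (partial i f)) =
      (\<Sum>j\<in>J. linear_form J (\<lambda>k. b (j, k)) * (mconst c * (\<Sum>i\<in>I. mconst (A (i, j)) * lin_subst J A (partial i f)))) + linear_form J \<beta> * F"
    unfolding F_def by (simp add: distrib_left sum_distrib_left mult_ac)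
  \<comment> \<open>Tangent derivatives of \<open>f\<close> are the partial derivatives of
    \<open>g\<close>, so \<open>zero\<close> becomes a relation with linear coefficients between
    these and \<open>F\<close>.\<close>
  then have syz: "(\<Sum>j\<in>J. linear_form J (\<lambda>k. b (j, k)) * partial j g) + linear_form J \<beta> * F = 0"
    unfolding zero by (simp add: dg)
  have gform: "g \<in> forms J d" unfolding g by (intro forms_mconst_mult lin_subst_forms[OF f])
  have dgform: "partial j g \<in> forms J (d - 1)" for j by (rule partial_forms[OF gform])
  have Fform: "F \<in> forms J (d - 1)" unfolding F_def
    by (intro forms_mconst_mult forms_sum lin_subst_forms[OF partial_forms[OF f]])
  let ?Jac = "jacobian_ideal J g" and ?\<rho> = "msubst (\<lambda>i. if i \<in> J then mvar i else 0)"
  \<comment> \<open>The ideal quotient of the Jacobian ideal by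
    \<open>linear_form J \<beta>\<close>, pulled back along the substitution that kills the
    variables outside \<open>J\<close>.\<close>
  define M where "M = {p. ?\<rho> p * linear_form J \<beta> \<in> ?Jac}"
  have \<rho>: "?\<rho> p \<in> poly_ring J" for p by (rule msubst_poly_ring[OF poly_ring_UNIV]) auto
  have M: "mideal M" unfolding mideal_def M_def jacobian_ideal_def
    by (auto simp: ideal_gen_0 ideal_gen_add distrib_right mult.assoc intro: ideal_gen_mult \<rho>)
  have Jac: "r * partial j g \<in> ?Jac" if "j \<in> J" "r \<in> poly_ring J" for r j
    unfolding jacobian_ideal_def by (intro ideal_gen_mult ideal_gen_base) (use that in auto)
  have lf: "linear_form J x \<in> poly_ring J" for x by (rule forms_poly_ring[OF forms_linear_form])
  have M_dg: "partial j g \<in> M" if "j \<in> J" for j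
    using Jac[OF that lf[of \<beta>]] forms_poly_ring[OF dgform[of j]] by (simp add: M_def partial_poly_ring_id mult.commute)
  have M_F: "F \<in> M"
  proof -
    have "F * linear_form J \<beta> = (\<Sum>j\<in>J. (mconst (-1) * linear_form J (\<lambda>k. b (j, k))) * partial j g)"
    proof -
      have "mconst (-1) = (-1 :: 'v mpoly)" by (metis mconst_def single_one single_uminus)
      moreover have "F * linear_form J \<beta> = - (\<Sum>j\<in>J. linear_form J (\<lambda>k. b (j, k)) * partial j g)"
        using syz by (simp add: eq_neg_iff_add_eq_0 add.commute mult.commute)
      ultimately show ?thesis by (simp add: sum_negf)
    qed
    also have "\<dots> \<in> ?Jac" unfolding jacobian_ideal_def
      by (rule ideal_gen_sum) (intro Jac[unfolded jacobian_ideal_def] poly_ring_closed lf)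
    finally show ?thesis using forms_poly_ring[OF Fform] by (simp add: M_def partial_poly_ring_id)
  qed
  \<comment> \<open>Otherwise the forms \<open>partial j g\<close> and \<open>F\<close> in
    \<open>M\<close> have a common zero whose coordinate \<open>i\<close> is 1. There all
    derivatives of \<open>f\<close> vanish, in tangent directions by the former and in direction
    \<open>u\<close> by the latter, so the hyperplane meets the singular locus.\<close>
  have "\<exists>k. mvar i ^ k \<in> M" if i: "i \<in> J" for i
  proof (rule ccontr)
    assume "\<not> ?thesis"
    then obtain v where v: "v i = 1" "\<And>p e. p \<in> M \<Longrightarrow> p \<in> forms UNIV e \<Longrightarrow> meval v p = 0"
      using homogeneous_nullstellensatz[OF M, of i] by blast
    have UN: "p \<in> forms UNIV e" if "p \<in> forms J e" for p :: "'v mpoly" and e using that by (auto simp: forms_def monomials_def)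
    have "v j = 0" if "j \<notin> J" for j
    proof -
      have "mvar j \<in> M" using that by (simp add: M_def jacobian_ideal_def ideal_gen_0)
      then show ?thesis using v(2)[of "mvar j" 1] forms_closed(2)[of j UNIV] by simp
    qed
    then have vJ: "v \<in> vecs J" by (auto simp: vecs_def)
    define w where "w = mat_vec J A v"
    have w: "w \<in> vecs I" "(\<Sum>i\<in>I. a i * w i) = 0" using bij_betwE[OF bij] vJ by (auto simp: w_def)
    have "(\<lambda>_. 0) \<in> vecs J" "mat_vec J A (\<lambda>_. 0) = (\<lambda>_. 0)" by (auto simp: vecs_def mat_vec_def)
    then have "w \<noteq> (\<lambda>_. 0)" using bij_betw_imp_inj_on[OF bij] vJ v(1) unfolding w_def inj_on_def by (metis zero_neq_one)
    then have wnz: "w \<in> nonzero_vecs I" using w(1) by (simp add: nonzero_vecs_def)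
    let ?G = "\<lambda>i. meval w (partial i f)"
    have GA: "(\<Sum>i\<in>I. A (i, j) * ?G i) = 0" if "j \<in> J" for j
      using v(2)[OF M_dg[OF that] UN[OF dgform]] c by (simp add: dg[OF that] meval_lin_subst w_def)
    have Gu: "(\<Sum>i\<in>I. u i * ?G i) = 0"
      using v(2)[OF M_F UN[OF Fform]] c by (simp add: F_def meval_lin_subst w_def)
    have G: "(\<Sum>i\<in>I. x i * ?G i) = 0" if x: "x \<in> vecs I" for x
    proof -
      have "(\<Sum>i\<in>I. x i * ?G i) = (\<Sum>i\<in>I. (mat_vec J A (mat_vec I L x) i + (\<Sum>i\<in>I. a i * x i) * u i) * ?G i)"
        by (simp add: dec[OF x, symmetric])
      also have "\<dots> = (\<Sum>j\<in>J. mat_vec I L x j * (\<Sum>i\<in>I. A (i, j) * ?G i)) + (\<Sum>i\<in>I. a i * x i) * (\<Sum>i\<in>I. u i * ?G i)"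
      proof -
        have e: "(\<Sum>i\<in>I. (P i + t * u i) * ?G i) = (\<Sum>i\<in>I. P i * ?G i) + t * (\<Sum>i\<in>I. u i * ?G i)" for P t
          by (simp add: algebra_simps sum.distrib sum_distrib_left)
        show ?thesis unfolding e sum_mult_swap[symmetric] by (simp add: mat_vec_def[of J A] mult.commute)
      qed
      finally show ?thesis by (simp add: GA Gu)
    qed
    have G0: "?G i = 0" if "i \<in> I" for i
      using G[OF unit_vec_vecs[OF that]] by (simp add: sum_mult_unit_vec[OF I that])
    have "of_nat d * meval w f = (\<Sum>i\<in>I. w i * ?G i)"
      using arg_cong[OF euler_identity[OF I f], of "meval w"] by simp
    then have "meval w f = 0" using G[OF w(1)] d by simp
    then have "proj_point w \<in> sing_locus I f" using wnz G0 by (auto simp: sing_locus_def)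
    moreover have "proj_point w \<in> vanishing_locus I (linear_form I a)" using wnz w(2) by (auto simp: vanishing_locus_def)
    ultimately show False using disj by blast
  qed
  then obtain k where "\<And>i. i \<in> J \<Longrightarrow> mvar i ^ k i \<in> M" by metis
  from irrelevant_power_subset_mideal[OF J M this]
  have "\<forall>q\<in>irrelevant_power J (Suc (\<Sum>i\<in>J. k i)). q * linear_form J \<beta> \<in> ?Jac"
    using irrelevant_power_poly_ring by (fastforce simp: M_def partial_poly_ring_id)
  then have "linear_form J \<beta> \<in> saturation J ?Jac \<inter> forms J 1"
    using lf forms_linear_form[of J \<beta>] unfolding saturation_def by blast
  then have lf\<beta>: "linear_form J \<beta> = 0" by (rule indeg_gt_1[OF s[unfolded s_inv_def]])
  \<comment> \<open>The transversal part being zero, \<open>syz\<close> is now a syzygy of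
    \<open>g\<close> with linear coefficients.\<close>
  define z where "z = (\<Sum>j\<in>J. single j (linear_form J (\<lambda>k. b (j, k))))"
  have z: "lookup z j = (if j \<in> J then linear_form J (\<lambda>k. b (j, k)) else 0)" for j
    using J by (simp add: z_def lookup_sum lookup_single when_def sum.delta)
  have "z \<in> syz_graded J g 1"
    using syz forms_linear_form[of J] by (auto simp: syz_graded_def z lf\<beta> in_keys_iff split: if_splits)
  then have "z = 0" by (rule indeg_gt_1[OF r[unfolded r_inv_def]])
  then have "linear_form J (\<lambda>k. b (j, k)) = 0" if "j \<in> J" for j using z[of j] that by simp
  then have b0: "b (j, k) = 0" if "j \<in> J" "k \<in> J" for j k using linear_form_eq_0[OF J _ that(2)] that(1) by blast
  have "\<beta> k = 0" if "k \<in> J" for k by (rule linear_form_eq_0[OF J lf\<beta> that])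
  then have "B (i, k) = 0" for i k using B b0 Bdec[of i k] by (cases "k \<in> J") (auto simp: vecs_def)
  then show ?thesis by auto
qed

section \<open>Generic finiteness of the fibers\<close>

text \<open>Induction on the rows: a vector \<open>x\<close> that works without the new row
  \<open>m\<close> is killed by this row as well, or else a multiple of the row can be subtracted
  from \<open>b\<close> so that \<open>x\<close> no longer detects the difference.\<close>

lemma fredholm_alternative:
  fixes T :: "'m \<Rightarrow> 'k \<Rightarrow> complex"
  assumes "finite M" "finite K"
  shows "(\<exists>p. \<forall>k\<in>K. (\<Sum>m\<in>M. p m * T m k) = b k) \<or>
    (\<exists>x\<in>vecs K. (\<forall>m\<in>M. (\<Sum>k\<in>K. T m k * x k) = 0) \<and> (\<Sum>k\<in>K. b k * x k) \<noteq> 0)"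
  using assms(1)
proof (induction M arbitrary: b rule: finite_induct)
  case empty
  show ?case
  proof (cases "\<forall>k\<in>K. b k = 0")
    case False
    then obtain k where k: "k \<in> K" "b k \<noteq> 0" by blast
    have "(\<Sum>i\<in>K. b i * unit_vec k i) \<noteq> 0" using k assms(2) by (simp add: sum_mult_unit_vec)
    then show ?thesis using unit_vec_vecs[OF k(1)] by auto
  qed simp
next
  case (insert m M)
  have ext: "\<exists>p. \<forall>k\<in>K. (\<Sum>m\<in>insert m M. p m * T m k) = b k"
    if "\<forall>k\<in>K. (\<Sum>m\<in>M. p m * T m k) = b k - t * T m k" for p t
  proof -
    have "(\<Sum>i\<in>M. (p(m := t)) i * T i k) = (\<Sum>i\<in>M. p i * T i k)" for k
      using insert.hyps by (intro sum.cong) auto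
    then show ?thesis using that insert.hyps by (intro exI[of _ "p(m := t)"]) simp
  qed
  show ?case
  proof (cases "\<exists>p. \<forall>k\<in>K. (\<Sum>m\<in>M. p m * T m k) = b k")
    case True then show ?thesis using ext[of _ 0] by auto
  next
    case False
    then obtain x where x: "x \<in> vecs K" "\<And>i. i \<in> M \<Longrightarrow> (\<Sum>k\<in>K. T i k * x k) = 0" "(\<Sum>k\<in>K. b k * x k) \<noteq> 0"
      using insert.IH[of b] by blast
    define s where "s = (\<Sum>k\<in>K. T m k * x k)"
    show ?thesis
    proof (cases "s = 0")
      case True then show ?thesis using x unfolding s_def by blast
    next
      case s: False
      define t where "t = (\<Sum>k\<in>K. b k * x k) / s"
      show ?thesis
      proof (cases "\<exists>p. \<forall>k\<in>K. (\<Sum>m\<in>M. p m * T m k) = b k - t * T m k")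
        case True then show ?thesis using ext by blast
      next
        case False
        then obtain z where z: "z \<in> vecs K" "\<And>i. i \<in> M \<Longrightarrow> (\<Sum>k\<in>K. T i k * z k) = 0"
          "(\<Sum>k\<in>K. (b k - t * T m k) * z k) \<noteq> 0"
          using insert.IH[of "\<lambda>k. b k - t * T m k"] by blast
        \<comment> \<open>Correction of \<open>z\<close> by a multiple of \<open>x\<close>, so that
          row \<open>m\<close> kills it too; by the choice of \<open>t\<close> the pairing with
          \<open>b\<close> stays nonzero.\<close>
        define c where "c = (\<Sum>k\<in>K. T m k * z k) / s"
        define y where "y k = z k - c * x k" for k
        have dot: "(\<Sum>k\<in>K. g k * y k) = (\<Sum>k\<in>K. g k * z k) - c * (\<Sum>k\<in>K. g k * x k)" for g
          by (simp add: y_def algebra_simps sum_subtractf sum_distrib_left)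
        have "(\<Sum>k\<in>K. (b k - t * T m k) * z k) = (\<Sum>k\<in>K. b k * z k) - t * (\<Sum>k\<in>K. T m k * z k)"
          by (simp add: algebra_simps sum_subtractf sum_distrib_left)
        also have "\<dots> = (\<Sum>k\<in>K. b k * y k)" unfolding dot by (simp add: t_def c_def)
        finally have "(\<Sum>k\<in>K. b k * y k) \<noteq> 0" using z(3) by simp
        moreover have "(\<Sum>k\<in>K. T i k * y k) = 0" if "i \<in> insert m M" for i
          using that x(2) z(2) s by (auto simp: dot) (simp add: c_def s_def[symmetric])
        moreover have "y \<in> vecs K" using x(1) z(1) by (auto simp: vecs_def y_def)
        ultimately show ?thesis by blast
      qed
    qed
  qed
qed

text \<open>Row \<open>k\<close> of the left inverse comes from \<open>fredholm_alternative\<close>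
  for \<open>unit_vec k\<close>; the other alternative would be a nonzero kernel vector.\<close>

lemma injective_left_inverse:
  fixes T :: "'m \<Rightarrow> 'k \<Rightarrow> complex"
  assumes "finite M" "finite K"
    and "\<And>x. x \<in> vecs K \<Longrightarrow> (\<And>m. m \<in> M \<Longrightarrow> (\<Sum>k\<in>K. T m k * x k) = 0) \<Longrightarrow> x = (\<lambda>_. 0)"
  shows "\<exists>P. \<forall>k. \<forall>x\<in>vecs K. k \<in> K \<longrightarrow> (\<Sum>m\<in>M. P k m * (\<Sum>k\<in>K. T m k * x k)) = x k"
proof -
  have "\<exists>p. \<forall>l\<in>K. (\<Sum>m\<in>M. p m * T m l) = unit_vec k l" for k
  proof (rule ccontr)
    assume "\<not> ?thesis"
    then obtain x where x: "x \<in> vecs K" "\<And>m. m \<in> M \<Longrightarrow> (\<Sum>k\<in>K. T m k * x k) = 0" "(\<Sum>l\<in>K. unit_vec k l * x l) \<noteq> 0"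
      using fredholm_alternative[OF assms(1,2), of T "unit_vec k"] by blast
    have "x = (\<lambda>_. 0)" using x(1,2) by (rule assms(3))
    then show False using x(3) by simp
  qed
  then obtain P where P: "\<And>k l. l \<in> K \<Longrightarrow> (\<Sum>m\<in>M. P k m * T m l) = unit_vec k l" by metis
  have "(\<Sum>m\<in>M. P k m * (\<Sum>k\<in>K. T m k * x k)) = x k" if "k \<in> K" for k x
  proof -
    have "(\<Sum>m\<in>M. P k m * (\<Sum>l\<in>K. T m l * x l)) = (\<Sum>l\<in>K. unit_vec k l * x l)"
      unfolding sum_mult_swap[symmetric] using P by simp
    also have "\<dots> = x k" by (rule sum_mult_unit_vec(2)[OF assms(2) that])
    finally show ?thesis .
  qed
  then show ?thesis by blast
qed

text \<open>The lowest homogeneous part of a relation between polynomials \<open>p k\<close> whose differential at \<open>A\<close> is the identity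
  would be a relation between the coordinates themselves.\<close>

lemma no_relation_if_differential_identity:
  fixes p :: "'k \<Rightarrow> 'k mpoly" and Q :: "'k mpoly"
  assumes K: "finite K" and Q: "Q \<in> poly_ring K" "Q \<noteq> 0" and A: "A \<in> vecs K"
    and der: "\<And>B k. B \<in> vecs K \<Longrightarrow> k \<in> K \<Longrightarrow>
      \<exists>\<sigma>. \<forall>t. meval (\<lambda>i. A i + t * B i) (p k) = meval A (p k) + t * (B k + t * poly \<sigma> t)"
  shows "\<exists>A'\<in>vecs K. meval (\<lambda>k. meval A' (p k)) Q \<noteq> 0"
proof (rule ccontr)
  assume "\<not> ?thesis"
  then have zero: "\<And>A'. A' \<in> vecs K \<Longrightarrow> meval (\<lambda>k. meval A' (p k)) Q = 0" by blast
  \<comment> \<open>Recentering at the image of \<open>A\<close>, so that the lowest homogeneous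
    part concerns first-order displacements.\<close>
  define Q' where "Q' = msubst (\<lambda>k. mvar k + mconst (meval A (p k))) Q"
  have mQ': "meval w Q' = meval (\<lambda>k. w k + meval A (p k)) Q" for w
    by (simp add: Q'_def meval_msubst)
  have Q'K: "Q' \<in> poly_ring K" unfolding Q'_def by (rule msubst_poly_ring[OF Q(1)]) auto
  have "Q' \<noteq> 0"
  proof
    assume "Q' = 0"
    then have "meval w Q = 0" for w using mQ'[of "\<lambda>k. w k - meval A (p k)"] by simp
    then show False using Q(2) mpoly_eq_0I by blast
  qed
  obtain N where N: "Q' = (\<Sum>k\<le>N. hom_part k Q')" using hom_part_sum by blast
  then have "\<exists>e. hom_part e Q' \<noteq> 0" using \<open>Q' \<noteq> 0\<close> by (metis sum.neutral)
  define e0 where "e0 = (LEAST e. hom_part e Q' \<noteq> 0)"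
  have e0: "hom_part e0 Q' \<noteq> 0" unfolding e0_def using \<open>\<exists>e. hom_part e Q' \<noteq> 0\<close> by (rule LeastI_ex)
  have lt: "hom_part e Q' = 0" if "e < e0" for e using not_less_Least[of e "\<lambda>e. hom_part e Q' \<noteq> 0"] that by (auto simp: e0_def)
  have e0N: "e0 \<le> N"
  proof (rule ccontr)
    assume "\<not> e0 \<le> N"
    then have "Q' = 0" using N lt by (metis (no_types, lifting) sum.neutral atMost_iff not_le le_less_trans)
    then show False using \<open>Q' \<noteq> 0\<close> by simp
  qed
  have hK: "hom_part e Q' \<in> poly_ring K" for e by (rule forms_poly_ring[OF hom_part_forms[OF Q'K]])
  obtain B where B: "B \<in> vecs K" "meval B (hom_part e0 Q') \<noteq> 0"
    using nonzero_value[OF K hK e0] by blast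
  obtain \<sigma> where \<sigma>: "\<And>k t. k \<in> K \<Longrightarrow> meval (\<lambda>i. A i + t * B i) (p k) = meval A (p k) + t * (B k + t * poly (\<sigma> k) t)"
    using der[OF B(1)] by metis
  \<comment> \<open>Along \<open>A + t * B\<close> the displacement of \<open>p k\<close> is
    \<open>t * poly (\<tau> k) t\<close>, and \<open>\<tau> k\<close> takes the value
    \<open>B k\<close> at zero.\<close>
  define \<tau> where "\<tau> k = pCons (B k) (\<sigma> k)" for k
  define r where "r e = mpoly_map (\<lambda>c. [:c:]) \<tau> (hom_part e Q')" for e
  have r: "meval (\<lambda>k. poly (\<tau> k) t) (hom_part e Q') = poly (r e) t" for e t
    unfolding r_def by (rule meval_curve)
  have "poly (\<Sum>e\<le>N. monom 1 e * r e) t = 0" for t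
  proof -
    have "poly (\<Sum>e\<le>N. monom 1 e * r e) t = meval (\<lambda>k. t * poly (\<tau> k) t) Q'"
      by (simp add: meval_scale_sum[OF N] poly_sum poly_monom r)
    also have "\<dots> = meval (\<lambda>k. t * poly (\<tau> k) t + meval A (p k)) Q" by (rule mQ')
    also have "\<dots> = meval (\<lambda>k. meval (\<lambda>i. A i + t * B i) (p k)) Q"
      by (rule meval_cong[OF Q(1)]) (simp add: \<sigma> \<tau>_def algebra_simps)
    also have "\<dots> = 0" using A B(1) by (intro zero) (auto simp: vecs_def)
    finally show ?thesis .
  qed
  then have "(\<Sum>e\<le>N. monom 1 e * r e) = 0" using poly_all_0_iff_0 by blast
  \<comment> \<open>In degree \<open>e0\<close> the parts below \<open>e0\<close> are zero and those
    above carry too high a power of \<open>t\<close>. What remains is the value of the lowest part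
    at \<open>B\<close>.\<close>
  then have "0 = coeff (\<Sum>e\<le>N. monom 1 e * r e) e0" by simp
  also have "\<dots> = (\<Sum>e\<le>N. if e = e0 then coeff (r e0) 0 else 0)"
    unfolding coeff_sum
  proof (rule sum.cong[OF refl])
    fix e
    have "r e = 0" if "e < e0" using lt[OF that] by (simp add: r_def mpoly_map_def)
    then show "coeff (monom 1 e * r e) e0 = (if e = e0 then coeff (r e0) 0 else 0)"
      by (cases e e0 rule: linorder_cases) (auto simp: coeff_monom_mult)
  qed
  also have "\<dots> = poly (r e0) 0" using e0N by (simp add: poly_0_coeff_0)
  also have "\<dots> = meval B (hom_part e0 Q')" by (simp add: r[symmetric] \<tau>_def)
  finally show False using B(2) by simp
qed

lemma prod_nonzero_value:
  assumes "finite X" "\<And>x. x \<in> X \<Longrightarrow> \<exists>v\<in>vecs I. meval v (p x) \<noteq> 0"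
  shows "\<exists>v\<in>vecs I. meval v (\<Prod>x\<in>X. p x) \<noteq> 0"
  using assms
proof (induction X rule: finite_induct)
  case empty
  have "(\<lambda>_. 0) \<in> vecs I" by (simp add: vecs_def)
  then show ?case by (intro bexI[of _ "\<lambda>_. 0"]) auto
next
  case (insert x X)
  obtain v where "v \<in> vecs I" "meval v (p x) \<noteq> 0" using insert.prems by blast
  moreover obtain w where "w \<in> vecs I" "meval w (\<Prod>x\<in>X. p x) \<noteq> 0" using insert by blast
  ultimately obtain z where "z \<in> vecs I" "meval z (p x) \<noteq> 0" "meval z (\<Prod>x\<in>X. p x) \<noteq> 0"
    using common_nonzero[of v "p x" w "\<Prod>x\<in>X. p x" I] by blast
  then show ?case using insert.hyps by (intro bexI[of _ z]) auto
qed

text \<open>Relations are indexed by an option type with \<open>None\<close> for a distinguished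
  polynomial. Their coefficients with respect to \<open>None\<close> involve only the indices
  \<open>Some k\<close>, which are renamed back to \<open>k\<close> here.\<close>

lemma poly_ring_Some:
  assumes "D \<in> poly_ring (Some ` K)"
  shows "\<exists>D'\<in>poly_ring K. \<forall>w. meval (\<lambda>k. w (Some k)) D' = meval w D"
proof (intro bexI allI)
  show "msubst (\<lambda>x. mvar (the x)) D \<in> poly_ring K" by (rule msubst_poly_ring[OF assms]) auto
  show "meval (\<lambda>k. w (Some k)) (msubst (\<lambda>x. mvar (the x)) D) = meval w D" for w
    unfolding meval_msubst by (rule meval_cong[OF assms]) auto
qed

text \<open>The polynomial \<open>c\<close> is the product, over the matrix entries
  \<open>k\<close>, of one coefficient of a relation between this entry and the combinations
  \<open>p\<close>. Where it is nonzero, the relation specialized to the image point is a nonzero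
  univariate polynomial with the entry as a root.\<close>

lemma generically_finite_fibers:
  fixes f :: "'v mpoly" and A :: "'v \<times> 'w \<Rightarrow> complex"
  assumes I: "finite I" and J: "finite J" and f: "f \<in> poly_ring I" and M: "finite M"
    and fM: "\<And>A. keys (lin_subst J A f) \<subseteq> M"
    and A: "A \<in> vecs (I \<times> J)"
    and inj: "\<And>B. B \<in> vecs (I \<times> J) \<Longrightarrow>
      (\<Sum>i\<in>I. linear_form J (\<lambda>j. B (i, j)) * lin_subst J A (partial i f)) = 0 \<Longrightarrow> B = (\<lambda>_. 0)"
  shows "\<exists>c\<in>poly_ring M. (\<exists>A'\<in>vecs (I \<times> J). meval (lookup (lin_subst J A' f)) c \<noteq> 0) \<and>
    (\<forall>w. meval w c \<noteq> 0 \<longrightarrow> finite {A' \<in> vecs (I \<times> J). lookup (lin_subst J A' f) = w})"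
proof -
  let ?K = "I \<times> J"
  have K: "finite ?K" using I J by simp
  obtain C where C: "\<And>m. C m \<in> poly_ring ?K" "\<And>m A. meval A (C m) = lookup (lin_subst J A f) m"
    using coeff_lin_subst_polynomial[OF J f] by blast
  define dB where "dB B = (\<Sum>i\<in>I. linear_form J (\<lambda>j. B (i, j)) * lin_subst J A (partial i f))" for B
  define T where "T m = (\<lambda>(i, j). lookup (mvar j * lin_subst J A (partial i f)) m)" for m
  have T: "(\<Sum>k\<in>?K. T m k * B k) = lookup (dB B) m" for m B
  proof -
    have "lookup (dB B) m = (\<Sum>i\<in>I. \<Sum>j\<in>J. B (i, j) * lookup (mvar j * lin_subst J A (partial i f)) m)"
      by (simp add: dB_def lookup_sum linear_form_def sum_distrib_right mult.assoc)
    then show ?thesis by (simp add: T_def sum.cartesian_product' mult.commute)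
  qed
  have lk: "lookup (lin_subst J (\<lambda>k. A k + t * B k) f) m =
      (\<Sum>e\<le>degree (pencil J A B f). lookup (coeff (pencil J A B f) e) m * t ^ e)" for t m B
    unfolding poly_pencil[symmetric] poly_altdef
    by (simp add: lookup_sum mult.commute flip: mconst_power)
  \<comment> \<open>A coefficient outside \<open>M\<close> is zero all along the line, hence so is
    its derivative. Therefore the finitely many rows in \<open>M\<close> decide injectivity.\<close>
  have dM: "lookup (dB B) m = 0" if "m \<notin> M" for m B
  proof -
    let ?P = "pencil J A B f"
    define r where "r = (\<Sum>e\<le>degree ?P. monom (lookup (coeff ?P e) m) e)"
    have "poly r t = 0" for t
    proof -
      have "lookup (lin_subst J (\<lambda>k. A k + t * B k) f) m = poly r t"
        unfolding lk r_def by (simp add: poly_sum poly_monom)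
      then show ?thesis using fM that by (metis in_keys_iff subsetD)
    qed
    then have "r = 0" using poly_all_0_iff_0 by blast
    then have "coeff r 1 = 0" by simp
    moreover have "coeff r 1 = lookup (coeff ?P 1) m"
      by (auto simp: r_def coeff_sum coeff_eq_0 not_le)
    ultimately show ?thesis unfolding coeff_1_pencil[OF I f] dB_def by simp
  qed
  have "\<exists>P. \<forall>k. \<forall>x\<in>vecs ?K. k \<in> ?K \<longrightarrow> (\<Sum>m\<in>M. P k m * (\<Sum>k\<in>?K. T m k * x k)) = x k"
  proof (rule injective_left_inverse[OF M K])
    fix x assume x: "x \<in> vecs ?K" "\<And>m. m \<in> M \<Longrightarrow> (\<Sum>k\<in>?K. T m k * x k) = 0"
    have "lookup (dB x) m = 0" for m using x(2)[of m] dM[of m x] by (cases "m \<in> M") (auto simp: T)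
    then have "dB x = 0" by (intro poly_mapping_eqI) simp
    then show "x = (\<lambda>_. 0)" using inj[OF x(1)] by (simp add: dB_def)
  qed
  then obtain P where P: "\<And>k x. k \<in> ?K \<Longrightarrow> x \<in> vecs ?K \<Longrightarrow> (\<Sum>m\<in>M. P k m * lookup (dB x) m) = x k"
    unfolding T by blast
  \<comment> \<open>The left inverse applied to the coefficients, so that the differential of
    \<open>p\<close> at \<open>A\<close> is the identity.\<close>
  define p where "p k = (\<Sum>m\<in>M. mconst (P k m) * C m)" for k
  have pK: "p k \<in> poly_ring ?K" for k unfolding p_def by (intro poly_ring_sum poly_ring_closed C)
  have mp: "meval A' (p k) = (\<Sum>m\<in>M. P k m * lookup (lin_subst J A' f) m)" for A' k
    by (simp add: p_def C)
  have der: "\<exists>\<sigma>. \<forall>t. meval (\<lambda>i. A i + t * B i) (p k) = meval A (p k) + t * (B k + t * poly \<sigma> t)"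
    if B: "B \<in> vecs ?K" "k \<in> ?K" for B k
  proof -
    let ?P = "pencil J A B f"
    define c where "c e = (\<Sum>m\<in>M. P k m * lookup (coeff ?P e) m)" for e
    define \<rho> where "\<rho> = (\<Sum>e\<le>degree ?P. monom (c e) e)"
    have co: "coeff \<rho> e = c e" for e
      by (auto simp: \<rho>_def coeff_sum c_def coeff_eq_0 not_le)
    have val: "meval (\<lambda>i. A i + t * B i) (p k) = poly \<rho> t" for t
    proof -
      have "meval (\<lambda>i. A i + t * B i) (p k) = (\<Sum>m\<in>M. P k m * (\<Sum>e\<le>degree ?P. lookup (coeff ?P e) m * t ^ e))"
        unfolding mp lk ..
      also have "\<dots> = (\<Sum>e\<le>degree ?P. c e * t ^ e)" unfolding c_def by (rule sum_mult_swap[symmetric])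
      also have "\<dots> = poly \<rho> t" by (simp add: \<rho>_def poly_sum poly_monom)
      finally show ?thesis .
    qed
    obtain c0 c1 \<sigma> where \<rho>: "\<rho> = pCons c0 (pCons c1 \<sigma>)" by (metis pCons_cases)
    have "c0 = meval A (p k)" using co[of 0] by (simp add: \<rho> c_def coeff_0_pencil mp)
    moreover have "c1 = B k" using co[of 1] P[OF B(2,1)] by (simp add: \<rho> c_def coeff_1_pencil[OF I f, simplified] dB_def)
    ultimately have "meval (\<lambda>i. A i + t * B i) (p k) = meval A (p k) + t * (B k + t * poly \<sigma> t)" for t
      unfolding val by (simp add: \<rho>)
    then show ?thesis by blast
  qed
  define R where "R k c \<longleftrightarrow> c \<in> poly_ring M \<and> (\<exists>A'\<in>vecs ?K. meval A' (msubst C c) \<noteq> 0) \<and>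
    (\<forall>w. meval w c \<noteq> 0 \<longrightarrow> finite {A' k | A'. A' \<in> vecs ?K \<and> lookup (lin_subst J A' f) = w})" for k c
  have "\<exists>c. R k c" if k: "k \<in> ?K" for k
  proof -
    \<comment> \<open>One polynomial more than there are matrix entries: the combinations
      \<open>p\<close> and, at \<open>None\<close>, the entry \<open>k\<close> itself.\<close>
    let ?T = "insert None (Some ` ?K)"
    define q where "q = case_option (mvar k) p"
    have "card ?T = Suc (card ?K)" using K by (simp add: card_image)
    then have cT: "card ?K < card ?T" by simp
    have "q t \<in> poly_ring ?K" if "t \<in> ?T" for t using that pK k by (auto simp: q_def)
    with cT have "\<exists>Q\<in>poly_ring ?T. Q \<noteq> 0 \<and> msubst q Q = 0" by (intro algebraic_dependence[OF K]) (use K in auto)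
    then obtain Q where Q: "Q \<in> poly_ring ?T" "Q \<noteq> 0" "msubst q Q = 0" by blast
    \<comment> \<open>Any nonzero coefficient will do: it is a polynomial in the \<open>p\<close>,
      so \<open>no_relation_if_differential_identity\<close> gives a matrix at which it is
      nonzero.\<close>
    obtain e where e: "coeff (as_univariate None Q) e \<noteq> 0" using as_univariate_nonzero[OF Q(2)] by blast
    let ?D = "coeff (as_univariate None Q) e"
    have D: "?D \<in> poly_ring (Some ` ?K)" by (rule poly_ring_mono[OF coeff_as_univariate[OF Q(1)]]) auto
    obtain D' where D'K: "D' \<in> poly_ring ?K" and mD': "\<And>w. meval (\<lambda>k. w (Some k)) D' = meval w ?D"
      using poly_ring_Some[OF D] by blast
    obtain v where "meval v ?D \<noteq> 0" using e mpoly_eq_0I by blast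
    then have "D' \<noteq> 0" using mD'[of v] by auto
    from no_relation_if_differential_identity[OF K D'K this A der]
    obtain A' where A': "A' \<in> vecs ?K" "meval (\<lambda>k. meval A' (p k)) D' \<noteq> 0" by blast
    define \<pi> where "\<pi> w k' = (\<Sum>m\<in>M. P k' m * w m)" for w k'
    define c where "c = msubst (\<lambda>k'. \<Sum>m\<in>M. mconst (P k' m) * mvar m) D'"
    have mc: "meval w c = meval (\<pi> w) D'" for w
      by (simp add: c_def meval_msubst \<pi>_def[abs_def])
    have "c \<in> poly_ring M" unfolding c_def by (rule msubst_poly_ring[OF D'K]) (intro poly_ring_sum poly_ring_closed)
    moreover have "meval A' (msubst C c) \<noteq> 0"
      using A'(2) by (simp add: meval_msubst mc C mp \<pi>_def[abs_def])
    moreover have "finite {A' k | A'. A' \<in> vecs ?K \<and> lookup (lin_subst J A' f) = w}" if w: "meval w c \<noteq> 0" for w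
    proof -
      have "finite {t. meval ((case_option 0 (\<pi> w))(None := t)) Q = 0}"
        by (rule finite_roots_as_univariate[OF Q(1), of _ _ e]) (use w mD'[of "case_option 0 (\<pi> w)"] in \<open>simp add: mc\<close>)
      moreover have "{A' k | A'. A' \<in> vecs ?K \<and> lookup (lin_subst J A' f) = w} \<subseteq> {t. meval ((case_option 0 (\<pi> w))(None := t)) Q = 0}"
      proof clarify
        fix A' assume "A' \<in> vecs ?K" and w: "w = lookup (lin_subst J A' f)"
        have "meval ((case_option 0 (\<pi> w))(None := A' k)) Q = meval A' (msubst q Q)"
          unfolding meval_msubst by (rule meval_cong[OF Q(1)]) (auto simp: q_def mp \<pi>_def w)
        then show "meval ((case_option 0 (\<pi> (lookup (lin_subst J A' f))))(None := A' k)) Q = 0" using Q(3) w by simp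
      qed
      ultimately show ?thesis by (rule finite_subset[rotated])
    qed
    ultimately show ?thesis using A'(1) unfolding R_def by blast
  qed
  then obtain c where "\<And>k. k \<in> ?K \<Longrightarrow> R k (c k)" by metis
  then have c: "\<And>k. k \<in> ?K \<Longrightarrow> c k \<in> poly_ring M" "\<And>k. k \<in> ?K \<Longrightarrow> \<exists>A'\<in>vecs ?K. meval A' (msubst C (c k)) \<noteq> 0"
    "\<And>k w. k \<in> ?K \<Longrightarrow> meval w (c k) \<noteq> 0 \<Longrightarrow> finite {A' k | A'. A' \<in> vecs ?K \<and> lookup (lin_subst J A' f) = w}"
    unfolding R_def by blast+
  show ?thesis
  proof (intro bexI[of _ "\<Prod>k\<in>?K. c k"] conjI allI impI)
    show "(\<Prod>k\<in>?K. c k) \<in> poly_ring M" by (rule poly_ring_prod) (rule c(1))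
    have "\<exists>A'\<in>vecs ?K. meval A' (\<Prod>k\<in>?K. msubst C (c k)) \<noteq> 0"
      by (rule prod_nonzero_value[OF K c(2)])
    then obtain A' where "A' \<in> vecs ?K" "meval A' (\<Prod>k\<in>?K. msubst C (c k)) \<noteq> 0" by blast
    then show "\<exists>A'\<in>vecs ?K. meval (lookup (lin_subst J A' f)) (\<Prod>k\<in>?K. c k) \<noteq> 0"
      by (intro bexI[of _ A']) (simp_all add: meval_msubst C)
    fix w assume "meval w (\<Prod>k\<in>?K. c k) \<noteq> 0"
    then have nz: "meval w (c k) \<noteq> 0" if "k \<in> ?K" for k using that K by (auto simp: prod_zero_iff)
    define S where "S = (\<Union>k\<in>?K. {A' k | A'. A' \<in> vecs ?K \<and> lookup (lin_subst J A' f) = w})"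
    have "finite S" unfolding S_def using K c(3) nz by blast
    then have "finite {A'. \<forall>k. (k \<in> ?K \<longrightarrow> A' k \<in> S) \<and> (k \<notin> ?K \<longrightarrow> A' k = 0)}"
      by (intro finite_set_of_finite_funs K)
    moreover have "{A' \<in> vecs ?K. lookup (lin_subst J A' f) = w} \<subseteq> {A'. \<forall>k. (k \<in> ?K \<longrightarrow> A' k \<in> S) \<and> (k \<notin> ?K \<longrightarrow> A' k = 0)}"
      unfolding S_def by (auto simp: vecs_def)
    ultimately show "finite {A' \<in> vecs ?K. lookup (lin_subst J A' f) = w}" by (rule finite_subset[rotated])
  qed
qed

text \<open>With the left inverse \<open>L\<close> of \<open>A\<close>, a kernel vector
  \<open>z\<close> of \<open>A + t * B\<close> equals \<open>- t\<close> times its image under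
  \<open>L\<close> after \<open>B\<close>. In the sum norm this forces \<open>z\<close> to vanish
  once \<open>cmod t * S < 1\<close>, where \<open>S\<close> sums the absolute values of the
  entries.\<close>

lemma injective_perturbation:
  fixes A :: "'v \<times> 'v \<Rightarrow> complex"
  assumes J: "finite J" and inv: "\<And>y. y \<in> vecs J \<Longrightarrow> mat_vec I L (mat_vec J A y) = y" and L: "L \<in> vecs (J \<times> I)"
  shows "\<exists>\<epsilon>>0. \<forall>t. cmod t < \<epsilon> \<longrightarrow> inj_on (mat_vec J (\<lambda>k. A k + t * B k)) (vecs J)"
proof -
  let ?N = "mat_mul I L B"
  define S where "S = (\<Sum>j\<in>J. \<Sum>k\<in>J. cmod (?N (j, k)))"
  have S0: "S \<ge> 0" unfolding S_def by (intro sum_nonneg) auto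
  have "inj_on (mat_vec J (\<lambda>k. A k + t * B k)) (vecs J)" if t: "cmod t < 1 / (S + 1)" for t
  proof (rule inj_onI)
    fix y y' assume y: "y \<in> vecs J" "y' \<in> vecs J" "mat_vec J (\<lambda>k. A k + t * B k) y = mat_vec J (\<lambda>k. A k + t * B k) y'"
    define z where "z = (\<lambda>i. y i - y' i)"
    have z: "z \<in> vecs J" using y by (auto simp: z_def vecs_def)
    have "mat_vec J A z i + t * mat_vec J B z i = 0" for i
      using fun_cong[OF y(3), of i]
      by (simp add: z_def mat_vec_def algebra_simps sum.distrib sum_subtractf sum_distrib_left)
    then have "mat_vec J A z = (\<lambda>i. - t * mat_vec J B z i)" by (auto simp: fun_eq_iff eq_neg_iff_add_eq_0)
    then have "mat_vec I L (mat_vec J A z) = (\<lambda>i. - t * mat_vec J ?N z i)"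
      by (simp only: mat_vec_scale mat_vec_mat_mul)
    then have zeq: "z = (\<lambda>i. - t * mat_vec J ?N z i)" unfolding inv[OF z] .
    have zN: "z j = - t * (\<Sum>k\<in>J. ?N (j, k) * z k)" for j by (rule fun_cong[OF zeq, of j, unfolded mat_vec_def])
    define s where "s = (\<Sum>j\<in>J. cmod (z j))"
    have s0: "s \<ge> 0" unfolding s_def by (intro sum_nonneg) auto
    have zs: "cmod (z k) \<le> s" if "k \<in> J" for k unfolding s_def using J that by (intro member_le_sum) auto
    have "cmod (z j) \<le> cmod t * (\<Sum>k\<in>J. cmod (?N (j, k)) * s)" if "j \<in> J" for j
    proof -
      have "cmod (z j) = cmod t * cmod (\<Sum>k\<in>J. ?N (j, k) * z k)" using arg_cong[OF zN[of j], of cmod] by (simp only: norm_mult norm_minus_cancel)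
      also have "cmod (\<Sum>k\<in>J. ?N (j, k) * z k) \<le> (\<Sum>k\<in>J. cmod (?N (j, k)) * s)"
        by (rule order_trans[OF norm_sum]) (auto simp: norm_mult intro!: sum_mono mult_left_mono zs)
      finally show ?thesis by (simp add: mult_left_mono)
    qed
    then have "s \<le> (\<Sum>j\<in>J. cmod t * (\<Sum>k\<in>J. cmod (?N (j, k)) * s))" unfolding s_def by (intro sum_mono) auto
    also have "\<dots> = cmod t * S * s" by (simp add: S_def sum_distrib_left sum_distrib_right mult_ac)
    finally have le: "s * (1 - cmod t * S) \<le> 0" by (simp add: algebra_simps)
    have "cmod t * S \<le> cmod t * (S + 1)" by (simp add: mult_left_mono)
    also have "\<dots> < 1" using t S0 by (simp add: field_simps)
    finally have "s = 0" using le s0 by (smt (verit) mult_pos_pos)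
    then have "z j = 0" for j using zs z s0 by (cases "j \<in> J") (force simp: vecs_def)+
    then show "y = y'" by (auto simp: z_def fun_eq_iff)
  qed
  then show ?thesis using S0 by (intro exI[of _ "1 / (S + 1)"]) auto
qed

text \<open>The columns of \<open>A\<close>, a vector \<open>v\<close> of the hyperplane and a basis
  vector off it are \<open>card I + 1\<close> vectors, hence dependent. Pairing with
  \<open>a\<close> removes the basis vector, and injectivity forbids a relation between the columns
  alone.\<close>

lemma injective_image_hyperplane:
  fixes A :: "'v \<times> 'v \<Rightarrow> complex"
  assumes I: "finite I" and J: "finite J" and card: "card I = Suc (card J)" and A: "A \<in> vecs (I \<times> J)"
    and inj: "inj_on (mat_vec J A) (vecs J)"
  shows "\<exists>a\<in>nonzero_vecs I. bij_betw (mat_vec J A) (vecs J) (hyperplane I a)"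
proof -
  obtain a where a: "a \<in> nonzero_vecs I" "\<And>j. j \<in> J \<Longrightarrow> (\<Sum>i\<in>I. A (i, j) * a i) = 0"
    using underdetermined_system[OF J I, of "\<lambda>j i. A (i, j)"] card by auto
  have aA: "(\<Sum>i\<in>I. a i * mat_vec J A y i) = 0" for y
  proof -
    have "(\<Sum>i\<in>I. a i * mat_vec J A y i) = (\<Sum>j\<in>J. (\<Sum>i\<in>I. a i * A (i, j)) * y j)"
      unfolding mat_vec_def by (rule sum_mult_swap[symmetric])
    then show ?thesis using a(2) by (simp add: mult.commute)
  qed
  obtain k where k: "k \<in> I" "a k \<noteq> 0" using a(1) by (auto simp: nonzero_vecs_def vecs_def fun_eq_iff)
  have "v \<in> mat_vec J A ` vecs J" if v: "v \<in> vecs I" "(\<Sum>i\<in>I. a i * v i) = 0" for v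
  proof -
    \<comment> \<open>Indices: \<open>None\<close> for the basis vector, \<open>Some None\<close>
      for \<open>v\<close>, \<open>Some (Some j)\<close> for the columns.\<close>
    let ?X = "insert None (insert (Some None) (Some ` Some ` J))"
    define col where "col = case_option (unit_vec k) (case_option v (\<lambda>j i. A (i, j)))"
    have "card ?X = Suc (Suc (card J))" using J by (simp add: card_image card_insert_if image_iff)
    then obtain x where x: "x \<in> nonzero_vecs ?X" "\<And>i. i \<in> I \<Longrightarrow> (\<Sum>m\<in>?X. col m i * x m) = 0"
      using underdetermined_system[OF I, of ?X "\<lambda>i m. col m i"] card J by auto
    define y where "y j = x (Some (Some j))" for j
    have yJ: "y \<in> vecs J" using x(1) by (auto simp: y_def vecs_def nonzero_vecs_def)
    have eq: "unit_vec k i * x None + v i * x (Some None) + mat_vec J A y i = 0" for i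
    proof (cases "i \<in> I")
      case True
      have "(\<Sum>m\<in>Some ` Some ` J. col m i * x m) = mat_vec J A y i"
        by (simp add: sum.reindex col_def mat_vec_def y_def)
      then show ?thesis using x(2)[OF True] J by (simp add: col_def image_iff add.assoc)
    next
      case False
      then show ?thesis using v(1) k mat_vec_vecs[OF A, of y] by (auto simp: vecs_def unit_vec_def)
    qed
    have uk: "(\<Sum>i\<in>I. a i * unit_vec k i) = a k" by (rule sum_mult_unit_vec(1)[OF I k(1)])
    have "0 = (\<Sum>i\<in>I. a i * (unit_vec k i * x None + v i * x (Some None) + mat_vec J A y i))" by (simp add: eq)
    also have "\<dots> = (\<Sum>i\<in>I. a i * unit_vec k i) * x None + (\<Sum>i\<in>I. a i * v i) * x (Some None) + (\<Sum>i\<in>I. a i * mat_vec J A y i)"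
      by (simp add: distrib_left sum.distrib sum_distrib_right mult.assoc)
    finally have x0: "x None = 0" using k(2) by (simp add: uk v(2) aA)
    have eq': "mat_vec J A y i = - (x (Some None)) * v i" for i
      using eq[of i] by (simp add: x0 eq_neg_iff_add_eq_0 add.commute mult.commute)
    have "x (Some None) \<noteq> 0"
    proof
      assume x1: "x (Some None) = 0"
      then have "mat_vec J A y = mat_vec J A (\<lambda>_. 0)" using eq' by (auto simp: mat_vec_def)
      then have "y = (\<lambda>_. 0)" by (rule inj_onD[OF inj]) (use yJ in \<open>auto simp: vecs_def\<close>)
      then have "x m = 0" for m
        using x0 x1 by (cases m; cases "the m") (auto simp: y_def fun_eq_iff)
      then show False using x(1) by (auto simp: nonzero_vecs_def)
    qed
    then have "mat_vec J A (\<lambda>i. (- 1 / x (Some None)) * y i) = v" unfolding mat_vec_scale by (auto simp: eq')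
    moreover have "(\<lambda>i. (- 1 / x (Some None)) * y i) \<in> vecs J" using yJ by (auto simp: vecs_def)
    ultimately show ?thesis by blast
  qed
  then have "mat_vec J A ` vecs J = hyperplane I a"
    using aA mat_vec_vecs[OF A] by auto
  then show ?thesis using a(1) inj by (auto simp: bij_betw_def)
qed

section \<open>Smoothness of the general section\<close>

lemma proj_point_eqD:
  assumes "proj_point v = proj_point w"
  shows "\<exists>c. c \<noteq> 0 \<and> v = (\<lambda>i. c * w i)"
proof -
  have "v \<in> proj_point v" unfolding proj_point_def by (auto intro!: exI[of _ 1])
  then show ?thesis unfolding assms by (auto simp: proj_point_def)
qed

lemma proj_point_scale: "c \<noteq> 0 \<Longrightarrow> proj_point (\<lambda>i. c * v i) = proj_point v"
proof -
  assume c: "c \<noteq> 0"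
  have "\<exists>e. (\<lambda>i. e' * v i) = (\<lambda>i. e * (c * v i)) \<and> e \<noteq> 0" if "e' \<noteq> 0" for e'
    using c that by (intro exI[of _ "e' / c"]) auto
  moreover have "\<exists>e. (\<lambda>i. e' * (c * v i)) = (\<lambda>i. e * v i) \<and> e \<noteq> 0" if "e' \<noteq> 0" for e'
    using c that by (intro exI[of _ "e' * c"]) (auto simp: mult.assoc)
  ultimately show ?thesis unfolding proj_point_def by blast
qed

lemma vanishing_locus_iff:
  assumes "p \<in> forms I k" "v \<in> nonzero_vecs I"
  shows "proj_point v \<in> vanishing_locus I p \<longleftrightarrow> meval v p = 0"
proof
  assume "proj_point v \<in> vanishing_locus I p"
  then obtain w where w: "proj_point v = proj_point w" "meval w p = 0" by (auto simp: vanishing_locus_def)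
  from proj_point_eqD[OF w(1)] show "meval v p = 0" using w(2) by (auto simp: meval_scale[OF assms(1)])
next
  assume "meval v p = 0"
  then show "proj_point v \<in> vanishing_locus I p" using assms(2) by (auto simp: vanishing_locus_def)
qed

text \<open>Intersections of basic open sets correspond to products of forms, so inside a generated
  open set each point has a neighborhood given by a single form.\<close>

lemma zariski_base:
  assumes "openin (zariski I) W" "proj_point v \<in> W" "v \<in> nonzero_vecs I"
  shows "\<exists>p k. p \<in> forms I k \<and> meval v p \<noteq> 0 \<and>
    (\<forall>w\<in>nonzero_vecs I. meval w p \<noteq> 0 \<longrightarrow> proj_point w \<in> W)"
proof -
  have "generate_topology_on {proj_space I - vanishing_locus I p | p k. p \<in> forms I k} W"
    using assms(1) unfolding zariski_def by (rule openin_topology_generated_by)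
  then show ?thesis using assms(2)
  proof induction
    case (Int a b)
    then obtain p k q l where p: "p \<in> forms I k" "meval v p \<noteq> 0" "\<forall>w\<in>nonzero_vecs I. meval w p \<noteq> 0 \<longrightarrow> proj_point w \<in> a"
      and q: "q \<in> forms I l" "meval v q \<noteq> 0" "\<forall>w\<in>nonzero_vecs I. meval w q \<noteq> 0 \<longrightarrow> proj_point w \<in> b" by blast
    show ?case by (intro exI[of _ "p * q"] exI[of _ "k + l"]) (use p q in auto)
  next
    case (UN K)
    then obtain k where k: "k \<in> K" "proj_point v \<in> k" by blast
    from UN.IH[OF this] k(1) show ?case by blast
  next
    case (Basis s)
    then obtain p k where s: "s = proj_space I - vanishing_locus I p" "p \<in> forms I k" by blast
    show ?case
      by (intro exI[of _ p] exI[of _ k]) (use s Basis(2) vanishing_locus_iff[OF s(2)] assms(3) in \<open>auto simp: proj_space_def\<close>)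
  qed simp
qed

lemma continuous_meval: "continuous_on UNIV (\<lambda>v. meval v p)"
  by (induction p rule: mpoly_induct) (auto intro!: continuous_intros)

lemma open_nonzero: "open {v. meval v p \<noteq> 0}"
proof -
  have "closed {v. meval v p = 0}" by (rule closed_Collect_eq) (auto intro: continuous_meval)
  then show ?thesis unfolding closed_def by (simp add: Collect_neg_eq)
qed

lemma closed_zero: "closed {v. meval v p = 0}"
  by (rule closed_Collect_eq) (auto intro: continuous_meval)

definition sing_cone :: "'v set \<Rightarrow> 'v mpoly \<Rightarrow> ('v \<Rightarrow> complex) set" where
  "sing_cone I p = {v \<in> nonzero_vecs I. meval v p = 0 \<and> (\<forall>i\<in>I. meval v (partial i p) = 0)}"

lemma sing_locus_cone: "sing_locus I p = proj_point ` sing_cone I p"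
  by (simp add: sing_locus_def sing_cone_def)

lemma sing_cone_scale:
  assumes "p \<in> forms I d" "v \<in> sing_cone I p" "c \<noteq> 0"
  shows "(\<lambda>i. c * v i) \<in> sing_cone I p"
  using assms(2,3) by (auto simp: sing_cone_def meval_scale[OF assms(1)] meval_scale[OF partial_forms[OF assms(1)]]
      nonzero_vecs_def vecs_def fun_eq_iff)

text \<open>Zariski open sets are open in the classical topology, in which projective space is compact.\<close>

lemma finite_isolated_singularities:
  assumes I: "finite I" and f: "f \<in> forms I d" and iso: "isolated_singularities I f"
  shows "finite (sing_locus I f)"
proof -
  \<comment> \<open>Isolatedness makes a single form \<open>q\<close> separate the singular point
    \<open>x\<close> from all others.\<close>
  have "\<exists>q k. q \<in> forms I k \<and> (\<exists>v\<in>sing_cone I f. x = proj_point v \<and> meval v q \<noteq> 0) \<and>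
      (\<forall>w\<in>sing_cone I f. meval w q \<noteq> 0 \<longrightarrow> proj_point w = x)" if x: "x \<in> sing_locus I f" for x
  proof -
    obtain v where v: "v \<in> sing_cone I f" "x = proj_point v" using x by (auto simp: sing_locus_cone)
    obtain U where U: "openin (zariski I) U" "U \<inter> sing_locus I f = {x}"
      using iso x by (auto simp: isolated_singularities_def)
    have "v \<in> nonzero_vecs I" using v(1) by (simp add: sing_cone_def)
    moreover have "proj_point v \<in> U" using U(2) v(2) by blast
    ultimately obtain q k where "q \<in> forms I k \<and> meval v q \<noteq> 0 \<and> (\<forall>w\<in>nonzero_vecs I. meval w q \<noteq> 0 \<longrightarrow> proj_point w \<in> U)"
      using zariski_base[OF U(1), of v] by (elim exE meta_impE) assumption+
    then have q: "q \<in> forms I k" "meval v q \<noteq> 0" "\<And>w. w \<in> nonzero_vecs I \<Longrightarrow> meval w q \<noteq> 0 \<Longrightarrow> proj_point w \<in> U" by auto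
    have uniq: "proj_point w = x" if "w \<in> sing_cone I f" "meval w q \<noteq> 0" for w
    proof -
      have "proj_point w \<in> U \<inter> sing_locus I f" using q(3)[of w] that by (auto simp: sing_locus_cone sing_cone_def)
      then show ?thesis using U(2) by blast
    qed
    show ?thesis by (intro exI[of _ q] exI[of _ k] conjI bexI[of _ v] ballI impI q(1,2) v uniq)
  qed
  then have "\<forall>x\<in>sing_locus I f. \<exists>q. (\<exists>k. q \<in> forms I k) \<and> (\<exists>v\<in>sing_cone I f. x = proj_point v \<and> meval v q \<noteq> 0) \<and>
      (\<forall>w\<in>sing_cone I f. meval w q \<noteq> 0 \<longrightarrow> proj_point w = x)" by blast
  then obtain q where "\<forall>x\<in>sing_locus I f. (\<exists>k. q x \<in> forms I k) \<and> (\<exists>v\<in>sing_cone I f. x = proj_point v \<and> meval v (q x) \<noteq> 0) \<and>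
      (\<forall>w\<in>sing_cone I f. meval w (q x) \<noteq> 0 \<longrightarrow> proj_point w = x)"
    unfolding bchoice_iff by blast
  then have q: "\<And>x. x \<in> sing_locus I f \<Longrightarrow> \<exists>k. q x \<in> forms I k"
    "\<And>x. x \<in> sing_locus I f \<Longrightarrow> \<exists>v\<in>sing_cone I f. x = proj_point v \<and> meval v (q x) \<noteq> 0"
    "\<And>x w. x \<in> sing_locus I f \<Longrightarrow> w \<in> sing_cone I f \<Longrightarrow> meval w (q x) \<noteq> 0 \<Longrightarrow> proj_point w = x"
    by blast+
  define B where "B = PiE UNIV (\<lambda>i. if i \<in> I then cball (0::complex) 1 else {0})"
  have "compactin (product_topology (\<lambda>i. euclidean) UNIV) B" unfolding B_def compactin_PiE by (auto simp: compactin_euclidean_iff)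
  then have "compact B" by (simp add: euclidean_product_topology compactin_euclidean_iff)
  \<comment> \<open>Singular vectors in the polydisc with some coordinate equal to 1: a compact set
    that avoids zero. Dividing by the coordinate of largest modulus shows that every singular point
    is represented in it.\<close>
  define C where "C = (\<Union>i\<in>I. B \<inter> {v. meval v (mvar i - 1) = 0}) \<inter>
      ({v. meval v f = 0} \<inter> (\<Inter>i\<in>I. {v. meval v (partial i f) = 0}))"
  have "compact C" unfolding C_def
    by (intro compact_Int_closed compact_UN I \<open>compact B\<close> closed_Int closed_INT closed_zero ballI)
  have CS: "v \<in> sing_cone I f" if "v \<in> C" for v
    using that by (auto simp: C_def B_def sing_cone_def nonzero_vecs_def vecs_def PiE_def Pi_def split: if_splits)
  have norm: "\<exists>v\<in>C. x = proj_point v" if x: "x \<in> sing_locus I f" for x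
  proof -
    obtain v where v: "v \<in> sing_cone I f" "x = proj_point v" using x by (auto simp: sing_locus_cone)
    then have vI: "v \<in> vecs I" "v \<noteq> (\<lambda>_. 0)" by (auto simp: sing_cone_def nonzero_vecs_def)
    then have "I \<noteq> {}" by (auto simp: vecs_def)
    define m where "m = Max ((\<lambda>i. cmod (v i)) ` I)"
    have "m \<in> (\<lambda>i. cmod (v i)) ` I" unfolding m_def by (rule Max_in) (use I \<open>I \<noteq> {}\<close> in auto)
    then obtain i where i: "i \<in> I" "m = cmod (v i)" by auto
    have le: "cmod (v j) \<le> cmod (v i)" if "j \<in> I" for j
      unfolding i(2)[symmetric] m_def using I that by (intro Max_ge) auto
    have vi: "v i \<noteq> 0"
    proof
      assume "v i = 0"
      then have "v j = 0" for j using le[of j] vI(1) by (cases "j \<in> I") (auto simp: vecs_def)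
      then show False using vI(2) by auto
    qed
    let ?w = "\<lambda>j. (1 / v i) * v j"
    have w: "?w \<in> sing_cone I f" using sing_cone_scale[OF f v(1), of "1 / v i"] vi by simp
    have "?w \<in> B" unfolding B_def using vI(1) le vi by (auto simp: norm_divide vecs_def)
    moreover have "meval ?w (mvar i - 1) = 0" using vi by simp
    ultimately have "?w \<in> C" using w i(1) unfolding C_def sing_cone_def by auto
    moreover have "proj_point ?w = x" using proj_point_scale[of "1 / v i" v] vi v(2) by simp
    ultimately show ?thesis by blast
  qed
  have "C \<subseteq> (\<Union>x\<in>sing_locus I f. {v. meval v (q x) \<noteq> 0})"
  proof
    fix v assume "v \<in> C"
    then have v: "v \<in> sing_cone I f" by (rule CS)
    then have x: "proj_point v \<in> sing_locus I f" by (auto simp: sing_locus_cone)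
    obtain w where w: "proj_point v = proj_point w" "meval w (q (proj_point v)) \<noteq> 0" using q(2)[OF x] by blast
    obtain c where "c \<noteq> 0" "v = (\<lambda>i. c * w i)" using proj_point_eqD[OF w(1)] by blast
    then have "meval v (q (proj_point v)) \<noteq> 0" using q(1)[OF x] w(2) meval_scale by fastforce
    then show "v \<in> (\<Union>x\<in>sing_locus I f. {v. meval v (q x) \<noteq> 0})" using x by blast
  qed
  then obtain F where F: "F \<subseteq> sing_locus I f" "finite F" "C \<subseteq> (\<Union>x\<in>F. {v. meval v (q x) \<noteq> 0})"
    using compactE_image[OF \<open>compact C\<close>, of "sing_locus I f" "\<lambda>x. {v. meval v (q x) \<noteq> 0}"] open_nonzero by metis
  have "sing_locus I f \<subseteq> F"
  proof
    fix y assume "y \<in> sing_locus I f"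
    then obtain v where v: "v \<in> C" "y = proj_point v" using norm by blast
    then obtain x where "x \<in> F" "meval v (q x) \<noteq> 0" using F(3) by blast
    then show "y \<in> F" using q(3)[of x v] F(1) CS[OF v(1)] v(2) by auto
  qed
  then show ?thesis using F(2) finite_subset by blast
qed

text \<open>There are finitely many singular points, and \<open>E\<close> is the product of the
  linear conditions that they impose on the hyperplane; one representative per point suffices, by
  scaling.\<close>

lemma avoid_singularities:
  assumes I: "finite I" and f: "f \<in> forms I d" and iso: "isolated_singularities I f"
    and l: "l \<in> nonzero_vecs I" and disj: "vanishing_locus I (linear_form I l) \<inter> sing_locus I f = {}"
  shows "\<exists>E. meval l E \<noteq> 0 \<and> (\<forall>a. meval a E \<noteq> 0 \<longrightarrow> (\<forall>v\<in>sing_cone I f. (\<Sum>i\<in>I. a i * v i) \<noteq> 0))"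
proof -
  have fin: "finite (sing_locus I f)" using I f iso by (rule finite_isolated_singularities)
  have "\<forall>x\<in>sing_locus I f. \<exists>v\<in>sing_cone I f. x = proj_point v" by (auto simp: sing_locus_cone)
  then obtain r where r: "\<And>x. x \<in> sing_locus I f \<Longrightarrow> r x \<in> sing_cone I f" "\<And>x. x \<in> sing_locus I f \<Longrightarrow> x = proj_point (r x)" by metis
  define E where "E = (\<Prod>x\<in>sing_locus I f. linear_form I (r x))"
  have "(\<Sum>i\<in>I. r x i * l i) \<noteq> 0" if x: "x \<in> sing_locus I f" for x
  proof
    assume "(\<Sum>i\<in>I. r x i * l i) = 0"
    then have "x \<in> vanishing_locus I (linear_form I l)"
      using r[OF x] by (auto simp: vanishing_locus_def sing_cone_def mult.commute)
    then show False using x disj by blast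
  qed
  then have "meval l E \<noteq> 0" using fin by (simp add: E_def prod_zero_iff)
  moreover have "(\<Sum>i\<in>I. a i * v i) \<noteq> 0" if a: "meval a E \<noteq> 0" and v: "v \<in> sing_cone I f" for a v
  proof -
    have x: "proj_point v \<in> sing_locus I f" using v by (auto simp: sing_locus_cone)
    let ?w = "r (proj_point v)"
    obtain c where c: "c \<noteq> 0" "v = (\<lambda>i. c * ?w i)" using proj_point_eqD[OF r(2)[OF x]] by blast
    have "(\<Sum>i\<in>I. ?w i * a i) \<noteq> 0" using a fin x by (auto simp: E_def prod_zero_iff)
    moreover have "(\<Sum>i\<in>I. a i * v i) = c * (\<Sum>i\<in>I. ?w i * a i)"
      by (subst c(2)) (simp add: sum_distrib_left mult_ac)
    ultimately show ?thesis using c(1) by simp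
  qed
  ultimately show ?thesis by blast
qed

text \<open>\<open>D\<close> vanishes on the dual variety: divide a relation between \<open>f\<close> and its partial derivatives by the
  largest possible power of \<open>f\<close>.\<close>

lemma gradient_relation:
  assumes I: "finite I" and f: "f \<in> poly_ring I" "f \<noteq> 0"
  shows "\<exists>D\<in>poly_ring I. D \<noteq> 0 \<and> (\<forall>v. meval v f = 0 \<longrightarrow> meval (\<lambda>i. meval v (partial i f)) D = 0)"
proof -
  \<comment> \<open>\<open>None\<close> stands for \<open>f\<close> and \<open>Some i\<close> for
    its partial derivatives: one polynomial more than there are variables.\<close>
  let ?T = "insert None (Some ` I)"
  define q where "q = case_option f (\<lambda>i. partial i f)"
  have "card ?T = Suc (card I)" using I by (simp add: card_image)
  moreover have "q t \<in> poly_ring I" if "t \<in> ?T" for t using that f by (auto simp: q_def partial_poly_ring)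
  ultimately have "\<exists>Q\<in>poly_ring ?T. Q \<noteq> 0 \<and> msubst q Q = 0" by (intro algebraic_dependence[OF I]) (use I in auto)
  then obtain Q where Q: "Q \<in> poly_ring ?T" "Q \<noteq> 0" "msubst q Q = 0" by blast
  let ?c = "coeff (as_univariate None Q)" and ?N = "degree (as_univariate None Q)"
  have ex: "\<exists>e. ?c e \<noteq> 0" by (rule as_univariate_nonzero[OF Q(2)])
  define e0 where "e0 = (LEAST e. ?c e \<noteq> 0)"
  have e0: "?c e0 \<noteq> 0" unfolding e0_def using ex by (rule LeastI_ex)
  have lt: "?c e = 0" if "e < e0" for e using not_less_Least[of e "\<lambda>e. ?c e \<noteq> 0"] that by (auto simp: e0_def)
  define G where "G e = msubst q (?c e)" for e
  have "meval v (\<Sum>e\<le>?N. G e * f ^ e) = meval v (msubst q Q)" for v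
  proof -
    have "meval v (msubst q Q) = (\<Sum>e\<le>?N. meval (\<lambda>i. meval v (q i)) (?c e) * meval v (q None) ^ e)"
      unfolding meval_msubst by (rule meval_as_univariate)
    then show ?thesis by (simp add: G_def meval_msubst q_def)
  qed
  then have rel: "meval v (\<Sum>e\<le>?N. G e * f ^ e) = 0" for v by (simp add: Q(3))
  define H where "H = (\<Sum>e\<in>{e0<..?N}. G e * f ^ (e - e0 - 1))"
  have "e0 \<le> ?N" using e0 by (rule le_degree)
  then have "{..?N} = {..<e0} \<union> insert e0 {e0<..?N}" by auto
  then have "(\<Sum>e\<le>?N. G e * f ^ e) = (\<Sum>e\<in>{..<e0}. G e * f ^ e) + (\<Sum>e\<in>insert e0 {e0<..?N}. G e * f ^ e)"
    by (simp only:) (rule sum.union_disjoint, auto)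
  also have "(\<Sum>e\<in>{..<e0}. G e * f ^ e) = 0" by (intro sum.neutral) (auto simp: G_def lt)
  also have "(\<Sum>e\<in>insert e0 {e0<..?N}. G e * f ^ e) = f ^ e0 * (G e0 + f * H)"
  proof -
    have "(\<Sum>e\<in>{e0<..?N}. G e * f ^ e) = (\<Sum>e\<in>{e0<..?N}. f ^ e0 * (f * (G e * f ^ (e - e0 - 1))))"
    proof (rule sum.cong[OF refl])
      fix e assume "e \<in> {e0<..?N}"
      then have "f ^ e = f ^ e0 * (f * f ^ (e - e0 - 1))" by (simp flip: power_Suc power_add)
      then show "G e * f ^ e = f ^ e0 * (f * (G e * f ^ (e - e0 - 1)))" by (simp add: mult_ac)
    qed
    then show ?thesis by (simp add: H_def sum_distrib_left distrib_left mult_ac)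
  qed
  finally have rel': "meval v f ^ e0 * meval v (G e0 + f * H) = 0" for v using rel[of v] by simp
  obtain v0 where v0: "meval v0 f \<noteq> 0" using f(2) mpoly_eq_0I by blast
  \<comment> \<open>Cancellation of \<open>f ^ e0\<close>: if the other factor were nonzero
    somewhere, it would be nonzero together with \<open>f\<close> at some point.\<close>
  have GH: "meval v (G e0 + f * H) = 0" for v
  proof (rule ccontr)
    assume "meval v (G e0 + f * H) \<noteq> 0"
    from common_nonzero[OF v0 this, of UNIV] obtain z where "meval z f \<noteq> 0" "meval z (G e0 + f * H) \<noteq> 0"
      by (auto simp: vecs_def)
    then show False using rel'[of z] by simp
  qed
  have "?c e0 \<in> poly_ring (Some ` I)" by (rule poly_ring_mono[OF coeff_as_univariate[OF Q(1)]]) auto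
  then obtain D where D: "D \<in> poly_ring I" "\<And>w. meval (\<lambda>k. w (Some k)) D = meval w (?c e0)"
    using poly_ring_Some by blast
  obtain w where "meval w (?c e0) \<noteq> 0" using e0 mpoly_eq_0I by blast
  then have "D \<noteq> 0" using D(2)[of w] by auto
  moreover have "meval (\<lambda>i. meval v (partial i f)) D = 0" if "meval v f = 0" for v
    using GH[of v] that D(2)[of "\<lambda>x. meval v (q x)"] by (simp add: G_def meval_msubst q_def)
  ultimately show ?thesis using D(1) by blast
qed

lemma complex_root_exists:
  assumes "k > 0" shows "\<exists>t::complex. t ^ k = c"
proof -
  have "degree (monom 1 k - [:c:]) = degree (monom (1::complex) k)"
    unfolding diff_conv_add_uminus by (rule degree_add_eq_left) (use assms in \<open>simp add: degree_monom_eq\<close>)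
  then have "degree (monom 1 k - [:c:]) = k" by (simp add: degree_monom_eq)
  then have "\<not> constant (poly (monom 1 k - [:c:]))" using assms by (simp add: constant_degree)
  then obtain t where "poly (monom 1 k - [:c:]) t = 0" using fundamental_theorem_of_algebra by blast
  then show ?thesis by (auto simp: poly_monom)
qed

text \<open>At a singular point of the section the gradient of \<open>f\<close> kills the
  hyperplane, hence is a multiple of \<open>a\<close>. If the multiple is zero, \<open>f\<close> is
  singular on the hyperplane; otherwise a rescaled point has gradient exactly \<open>a\<close>, and
  \<open>D\<close> vanishes at \<open>a\<close>.\<close>

lemma smooth_section:
  fixes A :: "'v \<times> 'v \<Rightarrow> complex"
  assumes I: "finite I" and J: "finite J" and a: "a \<in> nonzero_vecs I" and A: "A \<in> vecs (I \<times> J)"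
    and bij: "bij_betw (mat_vec J A) (vecs J) (hyperplane I a)"
    and f: "f \<in> forms I d" and d: "d \<ge> 2"
    and D: "D \<in> poly_ring I" "\<And>v. meval v f = 0 \<Longrightarrow> meval (\<lambda>i. meval v (partial i f)) D = 0" and aD: "meval a D \<noteq> 0"
    and sing: "\<And>v. v \<in> sing_cone I f \<Longrightarrow> (\<Sum>i\<in>I. a i * v i) \<noteq> 0"
  shows "smooth_hypersurface J (lin_subst J A f)"
proof (rule ccontr)
  assume "\<not> ?thesis"
  then obtain y where y: "y \<in> nonzero_vecs J" "meval y (lin_subst J A f) = 0"
    "\<And>j. j \<in> J \<Longrightarrow> meval y (partial j (lin_subst J A f)) = 0"
    by (auto simp: smooth_hypersurface_def sing_locus_def)
  have yJ: "y \<in> vecs J" "y \<noteq> (\<lambda>_. 0)" using y(1) by (auto simp: nonzero_vecs_def)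
  obtain L u where dec: "\<And>v i. v \<in> vecs I \<Longrightarrow> v i = mat_vec J A (mat_vec I L v) i + (\<Sum>i\<in>I. a i * v i) * u i"
    using hyperplane_frame[OF I J a A bij] by blast
  define v where "v = mat_vec J A y"
  have v: "v \<in> vecs I" "(\<Sum>i\<in>I. a i * v i) = 0" using bij_betwE[OF bij] yJ by (auto simp: v_def)
  have "(\<lambda>_. 0) \<in> vecs J" "mat_vec J A (\<lambda>_. 0) = (\<lambda>_. 0)" by (auto simp: vecs_def mat_vec_def)
  then have "v \<noteq> (\<lambda>_. 0)" using bij_betw_imp_inj_on[OF bij] yJ unfolding v_def inj_on_def by metis
  then have vnz: "v \<in> nonzero_vecs I" using v(1) by (simp add: nonzero_vecs_def)
  have fv: "meval v f = 0" using y(2) by (simp add: meval_lin_subst v_def)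
  let ?G = "\<lambda>i. meval v (partial i f)"
  have GA: "(\<Sum>i\<in>I. ?G i * A (i, j)) = 0" if "j \<in> J" for j
    using y(3)[OF that] meval_partial_lin_subst[OF I J that forms_poly_ring[OF f], of y A] by (simp add: v_def mult.commute)
  define c where "c = (\<Sum>i\<in>I. ?G i * u i)"
  have Gc: "?G i = c * a i" if i: "i \<in> I" for i
  proof -
    have lin: "(\<Sum>k\<in>I. ?G k * (P k + t * u k)) = (\<Sum>k\<in>I. ?G k * P k) + t * c" for P t
      by (simp add: c_def algebra_simps sum.distrib sum_distrib_left)
    note del = sum_mult_unit_vec(1)[OF I i]
    have "?G i = (\<Sum>k\<in>I. ?G k * unit_vec i k)" by (simp add: del)
    also have "\<dots> = (\<Sum>k\<in>I. ?G k * (mat_vec J A (mat_vec I L (unit_vec i)) k + (\<Sum>k\<in>I. a k * unit_vec i k) * u k))"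
      by (simp add: dec[OF unit_vec_vecs[OF i], symmetric])
    also have "\<dots> = (\<Sum>k\<in>I. ?G k * mat_vec J A (mat_vec I L (unit_vec i)) k) + a i * c"
      unfolding lin del ..
    also have "(\<Sum>k\<in>I. ?G k * mat_vec J A (mat_vec I L (unit_vec i)) k) = (\<Sum>j\<in>J. (\<Sum>k\<in>I. ?G k * A (k, j)) * mat_vec I L (unit_vec i) j)"
      unfolding mat_vec_def[of J A] by (rule sum_mult_swap[symmetric])
    finally show ?thesis by (simp add: GA)
  qed
  show False
  proof (cases "c = 0")
    case True
    then have "v \<in> sing_cone I f" using vnz fv Gc by (simp add: sing_cone_def)
    then show False using sing v(2) by blast
  next
    case False
    \<comment> \<open>The gradient is homogeneous of degree \<open>d - 1\<close>, so scaling the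
      point by this root cancels \<open>c\<close>; a root exists since
      \<open>d \<ge> 2\<close>.\<close>
    obtain t where t: "t ^ (d - 1) = 1 / c" using complex_root_exists[of "d - 1"] d by auto
    have "meval (\<lambda>i. t * v i) f = 0" using fv by (simp add: meval_scale[OF f])
    then have "meval (\<lambda>i. meval (\<lambda>i. t * v i) (partial i f)) D = 0" by (rule D(2))
    moreover have "meval (\<lambda>i. meval (\<lambda>i. t * v i) (partial i f)) D = meval a D"
      using False by (intro meval_cong[OF D(1)]) (simp add: meval_scale[OF partial_forms[OF f]] t[simplified] Gc)
    ultimately show False using aD by simp
  qed
qed

section \<open>Orbits and the moduli space\<close>

lemma mat_one_vecs: "mat_one J \<in> vecs (J \<times> J)"
  by (auto simp: mat_one_def vecs_def)

lemma mat_vec_mat_one: "finite J \<Longrightarrow> y \<in> vecs J \<Longrightarrow> mat_vec J (mat_one J) y = y"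
proof
  fix i assume J: "finite J" and y: "y \<in> vecs J"
  have "(\<Sum>j\<in>J. mat_one J (i, j) * y j) = (\<Sum>j\<in>J. if j = i then y j else 0)"
    by (rule sum.cong) (auto simp: mat_one_def)
  then show "mat_vec J (mat_one J) y i = y i" using J y by (auto simp: mat_vec_def vecs_def)
qed

lemma GL_vecs: "B \<in> GL J \<Longrightarrow> B \<in> vecs (J \<times> J)" by (simp add: GL_def)

lemma mat_mul_one: "finite J \<Longrightarrow> B \<in> vecs (J \<times> J) \<Longrightarrow> mat_mul J (mat_one J) B = B"
  by (rule matrix_eqI[of J _ J])
     (auto intro!: mat_mul_vecs mat_one_vecs mat_vec_mat_one mat_vec_vecs[of B J J] simp: mat_vec_mat_mul)

lemma mat_mul_assoc: "mat_mul J (mat_mul J A B) C = mat_mul J A (mat_mul J B C)"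
  by (auto simp: mat_mul_def sum_distrib_left sum_distrib_right mult_ac fun_eq_iff intro: sum.swap)

lemma GL_inverse:
  assumes "B \<in> GL J" obtains B' where "B' \<in> GL J" "mat_mul J B B' = mat_one J" "mat_mul J B' B = mat_one J"
  using assms unfolding GL_def by blast

lemma GL_mult:
  assumes J: "finite J" and "A \<in> GL J" "B \<in> GL J" shows "mat_mul J A B \<in> GL J"
proof -
  obtain A' where A': "A' \<in> GL J" "mat_mul J A A' = mat_one J" "mat_mul J A' A = mat_one J" using assms(2) by (rule GL_inverse)
  obtain B' where B': "B' \<in> GL J" "mat_mul J B B' = mat_one J" "mat_mul J B' B = mat_one J" using assms(3) by (rule GL_inverse)
  have "mat_mul J (mat_mul J A B) (mat_mul J B' A') = mat_mul J A (mat_mul J (mat_mul J B B') A')" by (simp only: mat_mul_assoc)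
  moreover have "mat_mul J (mat_mul J B' A') (mat_mul J A B) = mat_mul J B' (mat_mul J (mat_mul J A' A) B)" by (simp only: mat_mul_assoc)
  ultimately have "mat_mul J (mat_mul J A B) (mat_mul J B' A') = mat_one J" "mat_mul J (mat_mul J B' A') (mat_mul J A B) = mat_one J"
    by (simp_all add: A' B' mat_mul_one[OF J] GL_vecs assms)
  moreover have "mat_mul J A B \<in> vecs (J \<times> J)" "mat_mul J B' A' \<in> vecs (J \<times> J)"
    by (rule mat_mul_vecs; rule GL_vecs; fact)+
  ultimately show ?thesis unfolding GL_def by blast
qed

lemma GL_bij:
  assumes J: "finite J" and "B \<in> GL J" shows "bij_betw (mat_vec J B) (vecs J) (vecs J)"
proof -
  obtain B' where B': "B' \<in> GL J" "mat_mul J B B' = mat_one J" "mat_mul J B' B = mat_one J" using assms(2) by (rule GL_inverse)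
  show ?thesis
    by (rule bij_betw_byWitness[where f' = "mat_vec J B'"])
       (auto simp: mat_vec_mat_mul[symmetric] B' mat_vec_mat_one[OF J] intro!: mat_vec_vecs GL_vecs assms)
qed

lemma bij_mat_mul_GL:
  assumes "finite J" "B \<in> GL J" "bij_betw (mat_vec J A) (vecs J) S"
  shows "bij_betw (mat_vec J (mat_mul J A B)) (vecs J) S"
proof -
  have "mat_vec J (mat_mul J A B) = mat_vec J A \<circ> mat_vec J B" by (auto simp: mat_vec_mat_mul)
  then show ?thesis using bij_betw_trans[OF GL_bij[OF assms(1,2)] assms(3)] by simp
qed

text \<open>The coordinate change is \<open>L\<close> after \<open>A'\<close>, with the retraction
  \<open>L\<close> of \<open>hyperplane_frame\<close>. It is invertible because the roles of the two
  matrices can be exchanged.\<close>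

lemma parametrizations_equivalent:
  fixes A A' :: "'v \<times> 'v \<Rightarrow> complex"
  assumes I: "finite I" and J: "finite J" and a: "a \<in> nonzero_vecs I"
    and A: "A \<in> vecs (I \<times> J)" "bij_betw (mat_vec J A) (vecs J) (hyperplane I a)"
    and A': "A' \<in> vecs (I \<times> J)" "bij_betw (mat_vec J A') (vecs J) (hyperplane I a)"
  shows "\<exists>B\<in>GL J. A' = mat_mul J A B"
proof -
  have step: "\<exists>B\<in>vecs (J \<times> J). A' = mat_mul J A B"
    if A: "A \<in> vecs (I \<times> J)" "bij_betw (mat_vec J A) (vecs J) (hyperplane I a)"
      and A': "A' \<in> vecs (I \<times> J)" "bij_betw (mat_vec J A') (vecs J) (hyperplane I a)"
    for A A' :: "'v \<times> 'v \<Rightarrow> complex"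
  proof -
    obtain L u where L: "L \<in> vecs (J \<times> I)"
      and dec: "\<And>v i. v \<in> vecs I \<Longrightarrow> v i = mat_vec J A (mat_vec I L v) i + (\<Sum>i\<in>I. a i * v i) * u i"
      using hyperplane_frame[OF I J a A] by blast
    let ?B = "mat_mul I L A'"
    have B: "?B \<in> vecs (J \<times> J)" by (rule mat_mul_vecs[OF L A'(1)])
    have "A' = mat_mul J A ?B"
    proof (rule matrix_eqI[OF J A'(1) mat_mul_vecs[OF A(1) B]])
      fix y :: "'v \<Rightarrow> complex" assume "y \<in> vecs J"
      then have v: "mat_vec J A' y \<in> vecs I" "(\<Sum>i\<in>I. a i * mat_vec J A' y i) = 0" using bij_betwE[OF A'(2)] by auto
      have "mat_vec J A' y i = mat_vec J A (mat_vec I L (mat_vec J A' y)) i" for i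
        using dec[OF v(1), of i] unfolding v(2) by simp
      then show "mat_vec J A' y = mat_vec J (mat_mul J A ?B) y" by (simp add: mat_vec_mat_mul fun_eq_iff)
    qed
    then show ?thesis using B by blast
  qed
  obtain B where B: "B \<in> vecs (J \<times> J)" "A' = mat_mul J A B" using step[OF A A'] by blast
  obtain B' where B': "B' \<in> vecs (J \<times> J)" "A = mat_mul J A' B'" using step[OF A' A] by blast
  have inv: "mat_mul J C C' = mat_one J"
    if C: "C \<in> vecs (J \<times> J)" "C' \<in> vecs (J \<times> J)" "A = mat_mul J (mat_mul J A C) C'" and inj: "inj_on (mat_vec J A) (vecs J)"
    for A C C' :: "'v \<times> 'v \<Rightarrow> complex"
  proof (rule matrix_eqI[OF J mat_mul_vecs[OF C(1,2)] mat_one_vecs])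
    fix y :: "'v \<Rightarrow> complex" assume y: "y \<in> vecs J"
    have "mat_vec J A y = mat_vec J (mat_mul J (mat_mul J A C) C') y" using C(3) by (rule arg_cong)
    also have "\<dots> = mat_vec J A (mat_vec J (mat_mul J C C') y)" by (simp only: mat_vec_mat_mul)
    finally have "y = mat_vec J (mat_mul J C C') y"
      by (rule inj_onD[OF inj]) (use y in \<open>auto intro!: mat_vec_vecs mat_mul_vecs C\<close>)
    then show "mat_vec J (mat_mul J C C') y = mat_vec J (mat_one J) y" by (simp add: mat_vec_mat_one[OF J y])
  qed
  have "mat_mul J B B' = mat_one J"
    by (rule inv[OF B(1) B'(1) _ bij_betw_imp_inj_on[OF A(2)]]) (use B(2) B'(2) in simp)
  moreover have "mat_mul J B' B = mat_one J"
    by (rule inv[OF B'(1) B(1) _ bij_betw_imp_inj_on[OF A'(2)]]) (use B(2) B'(2) in simp)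
  ultimately show ?thesis using B B'(1) unfolding GL_def by blast
qed

text \<open>Testing \<open>b'\<close> on the vectors
  \<open>unit_vec i - (b i / b k) * unit_vec k\<close> of the common hyperplane shows that it is
  proportional to \<open>b\<close>.\<close>

lemma hyperplane_unique:
  assumes I: "finite I" and b: "b \<in> nonzero_vecs I" and b': "b' \<in> nonzero_vecs I"
    and eq: "hyperplane I b = hyperplane I b'"
  shows "proj_point b = proj_point b'"
proof -
  obtain k where k: "k \<in> I" "b k \<noteq> 0" using b by (auto simp: nonzero_vecs_def vecs_def fun_eq_iff)
  have *: "b' i = (b' k / b k) * b i" for i
  proof (cases "i \<in> I")
    case True
    let ?v = "\<lambda>j. unit_vec i j - b i / b k * unit_vec k j"
    have val: "(\<Sum>j\<in>I. g j * ?v j) = g i - b i / b k * g k" for g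
    proof -
      have "(\<Sum>j\<in>I. g j * ?v j) = (\<Sum>j\<in>I. g j * unit_vec i j) - b i / b k * (\<Sum>j\<in>I. g j * unit_vec k j)"
        unfolding sum_distrib_left sum_subtractf[symmetric] by (rule sum.cong) (auto simp: algebra_simps)
      then show ?thesis by (simp add: sum_mult_unit_vec I True k(1))
    qed
    have "?v \<in> vecs I" using unit_vec_vecs[OF True] unit_vec_vecs[OF k(1)] by (auto simp: vecs_def)
    then have "?v \<in> hyperplane I b" using k(2) by (simp only: mem_Collect_eq val) simp
    then have "(\<Sum>j\<in>I. b' j * ?v j) = 0" unfolding eq by simp
    then have "b' i - b i / b k * b' k = 0" unfolding val .
    then show ?thesis using k(2) by (simp add: field_simps)
  next
    case False then show ?thesis using b b' by (simp add: nonzero_vecs_def vecs_def)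
  qed
  have "b' k / b k \<noteq> 0"
  proof
    assume "b' k / b k = 0"
    then have "b' i = 0" for i using *[of i] by (simp only: mult_zero_left)
    then show False using b' by (auto simp: nonzero_vecs_def)
  qed
  then have "proj_point (\<lambda>i. (b' k / b k) * b i) = proj_point b" by (rule proj_point_scale)
  moreover have "b' = (\<lambda>i. (b' k / b k) * b i)" using * by (rule ext)
  ultimately show ?thesis by simp
qed

section \<open>Orbits of forms under invertible substitutions\<close>

lemma lookup_in_form_point: "lookup h \<in> form_point g \<longleftrightarrow> (\<exists>c. c \<noteq> 0 \<and> h = mconst c * g)"
proof -
  have "lookup h = (\<lambda>i. c * lookup g i) \<longleftrightarrow> h = mconst c * g" for c
    by (auto simp: poly_mapping_eq_iff fun_eq_iff)
  then show ?thesis by (auto simp: form_point_def proj_point_def)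
qed

lemma form_point_mconst: "c \<noteq> 0 \<Longrightarrow> form_point (mconst c * g) = form_point g"
proof -
  assume c: "c \<noteq> 0"
  have "lookup (mconst c * g) = (\<lambda>m. c * lookup g m)" by auto
  then show ?thesis by (simp add: form_point_def proj_point_scale[OF c])
qed

lemma PGL_orbit_form_point: "PGL_orbit J (form_point h) = {form_point (lin_subst J B h) | B. B \<in> GL J}"
proof -
  have "form_point (lin_subst J B (mconst c * h)) = form_point (lin_subst J B h)" if "c \<noteq> 0" for c B
    using form_point_mconst[OF that] by simp
  then have "PGL_orbit J (form_point h) \<subseteq> {form_point (lin_subst J B h) | B. B \<in> GL J}"
    unfolding PGL_orbit_def lookup_in_form_point by blast
  moreover have "lookup h \<in> form_point h" unfolding lookup_in_form_point by (intro exI[of _ 1]) simp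
  then have "{form_point (lin_subst J B h) | B. B \<in> GL J} \<subseteq> PGL_orbit J (form_point h)" unfolding PGL_orbit_def by blast
  ultimately show ?thesis by blast
qed

lemma PGL_orbit_lin_subst:
  assumes J: "finite J" and B: "B \<in> GL J"
  shows "PGL_orbit J (form_point (lin_subst J B h)) = PGL_orbit J (form_point h)"
proof -
  obtain B' where B': "B' \<in> GL J" "mat_mul J B B' = mat_one J" "mat_mul J B' B = mat_one J" using B by (rule GL_inverse)
  have 1: "lin_subst J C (lin_subst J B h) = lin_subst J (mat_mul J B C) h" for C by (simp add: lin_subst_mat_mul)
  have "\<exists>C'\<in>GL J. C = mat_mul J B C'" if C: "C \<in> GL J" for C
  proof (rule bexI)
    show "mat_mul J B' C \<in> GL J" by (rule GL_mult[OF J B'(1) C])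
    show "C = mat_mul J B (mat_mul J B' C)"
      unfolding mat_mul_assoc[symmetric] B'(2) using mat_mul_one[OF J GL_vecs[OF C]] by simp
  qed
  then show ?thesis unfolding PGL_orbit_form_point 1 using GL_mult[OF J B] by blast
qed

section \<open>Open sets of the orbit space\<close>

lemma topspace_zariski: "topspace (zariski I) = proj_space I"
proof -
  have "vanishing_locus I 1 = {}" by (simp add: vanishing_locus_def)
  moreover have "(1 :: 'a mpoly) \<in> forms I 0" by (rule forms_1)
  ultimately have "proj_space I \<in> {proj_space I - vanishing_locus I p | p k. p \<in> forms I k}"
    by (intro CollectI exI[of _ 1] exI[of _ 0]) simp
  then show ?thesis unfolding zariski_def topology_generated_by_topspace by auto
qed

lemma lookup_form_nonzero_vecs: "g \<in> forms J d \<Longrightarrow> g \<noteq> 0 \<Longrightarrow> lookup g \<in> nonzero_vecs (monomials J d)"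
  by (auto simp: nonzero_vecs_def vecs_def forms_def subset_iff in_keys_iff poly_mapping_eq_iff fun_eq_iff)

lemma smooth_forms_locus_subset: "smooth_forms_locus J d \<subseteq> proj_space (monomials J d)"
  using lookup_form_nonzero_vecs by (auto simp: smooth_forms_locus_def proj_space_def form_point_def)

lemma topspace_smooth_forms: "topspace (subtopology (zariski (monomials J d)) (smooth_forms_locus J d)) = smooth_forms_locus J d"
  using smooth_forms_locus_subset[of J d] by (auto simp: topspace_zariski)

lemma topspace_moduli_space: "topspace (moduli_space J d) = PGL_orbit J ` smooth_forms_locus J d"
proof
  show "topspace (moduli_space J d) \<subseteq> PGL_orbit J ` smooth_forms_locus J d"
    using openin_topspace[of "moduli_space J d"] unfolding moduli_space_def openin_quotient_topology topspace_smooth_forms by blast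
  have "{x \<in> smooth_forms_locus J d. PGL_orbit J x \<in> PGL_orbit J ` smooth_forms_locus J d} = smooth_forms_locus J d" by blast
  then have "openin (moduli_space J d) (PGL_orbit J ` smooth_forms_locus J d)"
    using openin_topspace[of "subtopology (zariski (monomials J d)) (smooth_forms_locus J d)"]
    unfolding moduli_space_def openin_quotient_topology topspace_smooth_forms by auto
  then show "PGL_orbit J ` smooth_forms_locus J d \<subseteq> topspace (moduli_space J d)" by (rule openin_subset)
qed

text \<open>In \<open>t\<close> the value is a polynomial whose coefficients are the values of the
  homogeneous parts. This translates nonvanishing of an inhomogeneous polynomial somewhere on a
  punctured line into conditions given by forms.\<close>

lemma scaled_value_nonzero_iff:
  "(\<exists>t. t \<noteq> 0 \<and> meval (\<lambda>i. t * v i) p \<noteq> 0) \<longleftrightarrow> (\<exists>k. meval v (hom_part k p) \<noteq> 0)"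
proof
  obtain N where N: "p = (\<Sum>k\<le>N. hom_part k p)" using hom_part_sum by blast
  show "\<exists>k. meval v (hom_part k p) \<noteq> 0" if "\<exists>t. t \<noteq> 0 \<and> meval (\<lambda>i. t * v i) p \<noteq> 0"
  proof (rule ccontr)
    assume "\<not> ?thesis"
    then show False using that by (simp add: meval_scale_sum[OF N])
  qed
  assume "\<exists>k. meval v (hom_part k p) \<noteq> 0"
  then obtain k where k: "meval v (hom_part k p) \<noteq> 0" by blast
  define r where "r = (\<Sum>k\<le>N. monom (meval v (hom_part k p)) k)"
  have r: "meval (\<lambda>i. t * v i) p = poly r t" for t
    by (simp add: r_def meval_scale_sum[OF N] poly_sum poly_monom mult.commute)
  \<comment> \<open>\<open>hom_part_sum\<close> does not state that the parts beyond its bound are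
    zero.\<close>
  have "k \<le> N"
  proof (rule ccontr)
    assume kN: "\<not> k \<le> N"
    have "hom_part k p = 0"
    proof (rule poly_mapping_eqI)
      fix m
      show "lookup (hom_part k p) m = lookup 0 m"
      proof (rule ccontr)
        assume nz: "lookup (hom_part k p) m \<noteq> lookup 0 m"
        have "keys (hom_part k p) \<subseteq> keys p"
          unfolding hom_part_def by (rule order_trans[OF keys_sum]) auto
        moreover have "m \<in> keys (hom_part k p)" using nz by (simp add: in_keys_iff)
        moreover have "keys p = keys (\<Sum>k\<le>N. hom_part k p)" using N by (rule arg_cong)
        ultimately have "m \<in> keys (\<Sum>k\<le>N. hom_part k p)" by blast
        from subsetD[OF keys_sum this] obtain j where "j \<le> N" "m \<in> keys (hom_part j p)" by auto
        moreover have "hom_part j p \<in> forms UNIV j" "hom_part k p \<in> forms UNIV k" by (auto intro: hom_part_forms)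
        ultimately show False using nz kN by (auto simp: forms_def monomials_def in_keys_iff subset_iff)
      qed
    qed
    then show False using k by simp
  qed
  then have "coeff r k = meval v (hom_part k p)" by (simp add: r_def coeff_sum)
  then have "r \<noteq> 0" using k by auto
  then have "finite ({t. poly r t = 0} \<union> {0})" using poly_roots_finite by simp
  from ex_new_if_finite[OF infinite_UNIV_char_0 this] obtain t where "t \<noteq> 0" "poly r t \<noteq> 0" by auto
  then show "\<exists>t. t \<noteq> 0 \<and> meval (\<lambda>i. t * v i) p \<noteq> 0" using r by auto
qed

text \<open>For fixed \<open>B\<close> the action on coefficient vectors is linear, so its
  composition with a polynomial condition is again a polynomial condition on
  \<open>h\<close>.\<close>

lemma lookup_lin_subst_linear:
  assumes J: "finite J" and h: "h \<in> forms J d"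
  shows "lookup (lin_subst J B h) m = (\<Sum>m'\<in>monomials J d. lookup (lin_subst J B (single m' 1)) m * lookup h m')"
proof -
  have ls: "lin_subst J B (\<Sum>x\<in>X. p x) = (\<Sum>x\<in>X. lin_subst J B (p x))" for X and p :: "('a \<Rightarrow>\<^sub>0 nat) \<Rightarrow> 'a mpoly"
    by (simp add: lin_subst_def)
  have "h = (\<Sum>m'\<in>monomials J d. single m' (lookup h m'))"
    by (rule sum_singles_superset[symmetric]) (use h finite_monomials[OF J] in \<open>auto simp: forms_def\<close>)
  also have "\<dots> = (\<Sum>m'\<in>monomials J d. mconst (lookup h m') * single m' 1)"
    by (simp add: mconst_def mult_single)
  finally have "lookup (lin_subst J B h) m = lookup (lin_subst J B (\<Sum>m'\<in>monomials J d. mconst (lookup h m') * single m' 1)) m" by simp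
  then show ?thesis by (simp add: ls lookup_sum mult.commute)
qed

definition orbit_open :: "'v set \<Rightarrow> nat \<Rightarrow> ('v \<Rightarrow>\<^sub>0 nat) mpoly \<Rightarrow> (('v \<Rightarrow>\<^sub>0 nat) \<Rightarrow> complex) set set set" where
  "orbit_open J d c = {z \<in> PGL_orbit J ` smooth_forms_locus J d. \<exists>y\<in>z. \<exists>w\<in>y. meval w c \<noteq> 0}"

text \<open>The preimage among the smooth forms is a union over all substitutions \<open>B\<close>
  and degrees \<open>k\<close>: the sets where the part of degree \<open>k\<close> of
  \<open>c\<close> composed with \<open>B\<close> is nonzero.\<close>

lemma openin_orbit_open:
  fixes c :: "('v \<Rightarrow>\<^sub>0 nat) mpoly"
  assumes J: "finite J" and c: "c \<in> poly_ring (monomials J d)"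
  shows "openin (moduli_space J d) (orbit_open J d c)"
proof -
  let ?M = "monomials J d" and ?S = "smooth_forms_locus J d"
  define cB where "cB B = msubst (\<lambda>m. \<Sum>m'\<in>?M. mconst (lookup (lin_subst J B (single m' 1)) m) * mvar m') c" for B :: "'v \<times> 'v \<Rightarrow> complex"
  have cBM: "cB B \<in> poly_ring ?M" for B
    unfolding cB_def by (rule msubst_poly_ring[OF c]) (intro poly_ring_sum poly_ring_closed)
  have mcB: "meval (\<lambda>m. t * lookup h m) (cB B) = meval (\<lambda>m. t * lookup (lin_subst J B h) m) c" if h: "h \<in> forms J d" for h B t
    unfolding cB_def meval_msubst
    by (rule arg_cong[where f = "\<lambda>v. meval v c"])
       (simp add: lookup_lin_subst_linear[OF J h, of B] sum_distrib_left mult_ac)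
  define W where "W = (\<Union>(B, k)\<in>GL J \<times> UNIV. proj_space ?M - vanishing_locus ?M (hom_part k (cB B)))"
  have "openin (zariski ?M) (proj_space ?M - vanishing_locus ?M (hom_part k (cB B)))" for k B
    unfolding zariski_def
    by (rule topology_generated_by_Basis) (use hom_part_forms[OF cBM] in blast)
  then have W: "openin (zariski ?M) W" unfolding W_def by (intro openin_Union) auto
  have "(\<exists>y\<in>PGL_orbit J (form_point h). \<exists>w\<in>y. meval w c \<noteq> 0) \<longleftrightarrow> form_point h \<in> W"
    if h: "h \<in> forms J d" "h \<noteq> 0" for h
  proof -
    have hv: "lookup h \<in> nonzero_vecs ?M" using h by (rule lookup_form_nonzero_vecs)
    have "(\<exists>y\<in>PGL_orbit J (form_point h). \<exists>w\<in>y. meval w c \<noteq> 0) \<longleftrightarrow>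
        (\<exists>B\<in>GL J. \<exists>t. t \<noteq> 0 \<and> meval (\<lambda>m. t * lookup (lin_subst J B h) m) c \<noteq> 0)"
    proof -
      have pp: "(\<exists>w\<in>proj_point v. P w) \<longleftrightarrow> (\<exists>t. t \<noteq> 0 \<and> P (\<lambda>i. t * v i))" for v :: "('v \<Rightarrow>\<^sub>0 nat) \<Rightarrow> complex" and P
        by (auto simp: proj_point_def)
      have "(\<exists>y\<in>PGL_orbit J (form_point h). \<exists>w\<in>y. meval w c \<noteq> 0) \<longleftrightarrow>
          (\<exists>B\<in>GL J. \<exists>w\<in>form_point (lin_subst J B h). meval w c \<noteq> 0)"
        unfolding PGL_orbit_form_point by blast
      then show ?thesis unfolding form_point_def pp .
    qed
    also have "\<dots> \<longleftrightarrow> (\<exists>B\<in>GL J. \<exists>t. t \<noteq> 0 \<and> meval (\<lambda>m. t * lookup h m) (cB B) \<noteq> 0)"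
      by (simp add: mcB[OF h(1)])
    also have "\<dots> \<longleftrightarrow> (\<exists>B\<in>GL J. \<exists>k. meval (lookup h) (hom_part k (cB B)) \<noteq> 0)"
      by (simp only: scaled_value_nonzero_iff)
    also have "\<dots> \<longleftrightarrow> form_point h \<in> W"
      using hv vanishing_locus_iff[OF hom_part_forms[OF cBM] hv] by (auto simp: W_def form_point_def proj_space_def)
    finally show ?thesis .
  qed
  then have "{x \<in> ?S. PGL_orbit J x \<in> orbit_open J d c} = W \<inter> ?S"
    by (auto simp: orbit_open_def smooth_forms_locus_def)
  then have "openin (subtopology (zariski ?M) ?S) {x \<in> ?S. PGL_orbit J x \<in> orbit_open J d c}"
    using W by (auto simp: openin_subtopology)
  then show ?thesis unfolding moduli_space_def openin_quotient_topology topspace_smooth_forms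
    by (auto simp: orbit_open_def)
qed

text \<open>The preimage of an open set in the space of forms is shrunk to one basic set. Density of
  the finiteness locus then only has to be tested against a single polynomial
  \<open>q\<close>.\<close>

lemma moduli_space_base:
  assumes O: "openin (moduli_space J d) U" and g: "g \<in> forms J d" "g \<noteq> 0" "smooth_hypersurface J g" "PGL_orbit J (form_point g) \<in> U"
  shows "\<exists>q k. q \<in> forms (monomials J d) k \<and> meval (lookup g) q \<noteq> 0 \<and>
    (\<forall>h\<in>forms J d. h \<noteq> 0 \<longrightarrow> smooth_hypersurface J h \<longrightarrow> meval (lookup h) q \<noteq> 0 \<longrightarrow> PGL_orbit J (form_point h) \<in> U)"
proof -
  let ?M = "monomials J d" and ?S = "smooth_forms_locus J d"
  have "openin (subtopology (zariski ?M) ?S) {x \<in> ?S. PGL_orbit J x \<in> U}"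
    using O unfolding moduli_space_def openin_quotient_topology topspace_smooth_forms by blast
  then obtain W where W: "openin (zariski ?M) W" "{x \<in> ?S. PGL_orbit J x \<in> U} = W \<inter> ?S"
    by (auto simp: openin_subtopology)
  have S: "form_point h \<in> ?S" if "h \<in> forms J d" "h \<noteq> 0" "smooth_hypersurface J h" for h
    using that by (auto simp: smooth_forms_locus_def)
  have "form_point g \<in> W" using S[OF g(1,2,3)] g(4) W(2) by blast
  then obtain q k where q: "q \<in> forms ?M k \<and> meval (lookup g) q \<noteq> 0 \<and> (\<forall>w\<in>nonzero_vecs ?M. meval w q \<noteq> 0 \<longrightarrow> proj_point w \<in> W)"
    using zariski_base[OF W(1), of "lookup g"] lookup_form_nonzero_vecs[OF g(1,2)] by (auto simp: form_point_def)
  have "PGL_orbit J (form_point h) \<in> U"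
    if h: "h \<in> forms J d" "h \<noteq> 0" "smooth_hypersurface J h" "meval (lookup h) q \<noteq> 0" for h
  proof -
    have "form_point h \<in> W" using q lookup_form_nonzero_vecs[OF h(1,2)] h(4) by (simp add: form_point_def)
    then show ?thesis using S[OF h(1,2,3)] W(2) by blast
  qed
  then show ?thesis using q by blast
qed

section \<open>Generic hyperplanes\<close>

definition hyperplane_param :: "'v set \<Rightarrow> 'v set \<Rightarrow> ('v \<Rightarrow> complex) \<Rightarrow> ('v \<times> 'v \<Rightarrow> complex) \<Rightarrow> bool" where
  "hyperplane_param I J a A \<longleftrightarrow> A \<in> vecs (I \<times> J) \<and>
     bij_betw (mat_vec J A) (vecs J) (hyperplane I a)"

lemma section_equation_iff:
  "section_equation n f a g \<longleftrightarrow>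
    (\<exists>A c. hyperplane_param {0..n} {1..n} a A \<and> c \<noteq> 0 \<and> g = mconst c * lin_subst {1..n} A f)"
  by (auto simp: section_equation_def hyperplane_param_def)

lemma hyperplane_param_scale:
  assumes "t \<noteq> 0" shows "hyperplane_param I J (\<lambda>i. t * a i) A \<longleftrightarrow> hyperplane_param I J a A"
proof -
  have "(\<Sum>i\<in>I. t * a i * v i) = t * (\<Sum>i\<in>I. a i * v i)" for v by (simp add: sum_distrib_left mult.assoc)
  then show ?thesis using assms by (simp add: hyperplane_param_def)
qed

lemma hyperplane_param_GL:
  assumes "finite J" "hyperplane_param I J a A" "B \<in> GL J"
  shows "hyperplane_param I J a (mat_mul J A B)"
  using assms bij_mat_mul_GL[OF assms(1,3)] mat_mul_vecs[OF _ GL_vecs[OF assms(3)]] by (auto simp: hyperplane_param_def)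

text \<open>On \<open>y\<close> it is \<open>(a u) y - (a y) u\<close>, where \<open>a u\<close> and
  \<open>a y\<close> denote pairings: the projection to the hyperplane along \<open>u\<close>,
  multiplied by \<open>a u\<close> to clear the denominator.\<close>

definition chart_matrix :: "'v set \<Rightarrow> 'v set \<Rightarrow> ('v \<Rightarrow> complex) \<Rightarrow> ('v \<Rightarrow> complex) \<Rightarrow> 'v \<times> 'v \<Rightarrow> complex" where
  "chart_matrix I J u a = (\<lambda>(i, j). if i \<in> I \<and> j \<in> J then (if i = j then \<Sum>k\<in>I. a k * u k else 0) - a j * u i else 0)"

text \<open>The hyperplane \<open>a\<close> is parametrized by projecting the coordinate hyperplane \<open>x\<^sub>e = 0\<close> from the point \<open>u\<close>; the
  matrix depends polynomially on \<open>a\<close>.\<close>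

lemma chart_matrix_param:
  assumes J: "finite J" and e: "e \<notin> J" and u: "u \<in> vecs (insert e J)" "u e \<noteq> 0"
    and a: "a \<in> vecs (insert e J)" and au: "(\<Sum>k\<in>insert e J. a k * u k) \<noteq> 0"
  shows "hyperplane_param (insert e J) J a (chart_matrix (insert e J) J u a)"
proof -
  let ?I = "insert e J"
  let ?A = "chart_matrix ?I J u a"
  define t where "t = (\<Sum>k\<in>?I. a k * u k)"
  define s where "s y = (\<Sum>j\<in>J. a j * y j)" for y
  have A: "?A \<in> vecs (?I \<times> J)" by (auto simp: chart_matrix_def vecs_def)
  have Ay: "mat_vec J ?A y i = t * y i - s y * u i" if y: "y \<in> vecs J" for y i
  proof (cases "i \<in> ?I")
    case True
    have "mat_vec J ?A y i = (\<Sum>j\<in>J. (if j = i then t * y j else 0) - a j * y j * u i)"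
      unfolding mat_vec_def chart_matrix_def t_def[symmetric] by (rule sum.cong) (use True in \<open>auto simp: algebra_simps\<close>)
    also have "\<dots> = (\<Sum>j\<in>J. if j = i then t * y j else 0) - s y * u i"
      by (simp add: sum_subtractf s_def sum_distrib_right)
    finally show ?thesis using J y by (auto simp: vecs_def)
  next
    case False
    then show ?thesis using y u(1) mat_vec_vecs[OF A, of y] by (auto simp: vecs_def)
  qed
  have sI: "s y = (\<Sum>i\<in>?I. a i * y i)" if "y e = 0" for y
    using J e that by (simp add: s_def)
  have "inj_on (mat_vec J ?A) (vecs J)"
  proof (rule inj_onI)
    fix y y' assume y: "y \<in> vecs J" "y' \<in> vecs J" and eq: "mat_vec J ?A y = mat_vec J ?A y'"
    have eqi: "t * y i - s y * u i = t * y' i - s y' * u i" for i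
      using fun_cong[OF eq, of i] by (simp add: Ay y)
    have "s y = s y'" using eqi[of e] y e u(2) by (simp add: vecs_def)
    then show "y = y'" using eqi au by (auto simp: t_def)
  qed
  moreover have "mat_vec J ?A ` vecs J = hyperplane ?I a"
  proof (intro equalityI subsetI)
    fix v assume "v \<in> mat_vec J ?A ` vecs J"
    then obtain y where y: "y \<in> vecs J" "v = mat_vec J ?A y" by blast
    have "(\<Sum>i\<in>?I. a i * v i) = t * (\<Sum>i\<in>?I. a i * y i) - s y * (\<Sum>i\<in>?I. a i * u i)"
    proof -
      have "(\<Sum>i\<in>?I. a i * v i) = (\<Sum>i\<in>?I. t * (a i * y i) - s y * (a i * u i))"
        by (rule sum.cong) (auto simp: y(2) Ay[OF y(1)] algebra_simps)
      then show ?thesis by (simp only: sum_subtractf sum_distrib_left)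
    qed
    also have "\<dots> = 0" using sI[of y] y(1) e by (simp add: t_def vecs_def)
    finally show "v \<in> hyperplane ?I a" using mat_vec_vecs[OF A] y(2) by blast
  next
    fix v assume v: "v \<in> hyperplane ?I a"
    \<comment> \<open>The multiple of \<open>u\<close> that moves \<open>v\<close> into the
      coordinate hyperplane.\<close>
    define r where "r = - v e / u e"
    define y where "y = (\<lambda>i. (v i + r * u i) / t)"
    have ye: "y e = 0" using u(2) by (simp add: y_def r_def)
    have yJ: "y \<in> vecs J"
    proof -
      have "y i = 0" if "i \<notin> J" for i
        using that v u(1) ye by (cases "i = e") (auto simp: vecs_def y_def)
      then show ?thesis by (simp add: vecs_def)
    qed
    have "(\<Sum>i\<in>?I. a i * y i) = ((\<Sum>i\<in>?I. a i * v i) + r * (\<Sum>i\<in>?I. a i * u i)) / t"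
    proof -
      have "(\<Sum>i\<in>?I. a i * y i) = (\<Sum>i\<in>?I. (a i * v i + r * (a i * u i)) / t)"
        by (rule sum.cong) (auto simp: y_def algebra_simps)
      then show ?thesis by (simp only: sum_divide_distrib[symmetric] sum.distrib sum_distrib_left)
    qed
    then have "s y = r" using sI[of y, OF ye] v au unfolding t_def by simp
    then have "mat_vec J ?A y i = v i" for i
      unfolding Ay[OF yJ] using au by (simp add: y_def t_def)
    then have "mat_vec J ?A y = v" by (rule ext)
    then show "v \<in> mat_vec J ?A ` vecs J" using yJ by blast
  qed
  ultimately show ?thesis using A by (simp add: hyperplane_param_def bij_betw_def)
qed

text \<open>With the center \<open>u\<close> and the coordinate change \<open>B\<close> fixed, the
  matrix entries are polynomials in \<open>a\<close>, so a condition on the section becomes one on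
  the hyperplane.\<close>

lemma chart_polynomial:
  assumes J: "finite J" and f: "f \<in> poly_ring I"
  shows "\<exists>Q. \<forall>a. meval a Q = meval (lookup (lin_subst J (mat_mul J (chart_matrix I J u a) B) f)) q"
proof -
  obtain C where C: "\<And>m A. meval A (C m) = lookup (lin_subst J A f) m"
    using coeff_lin_subst_polynomial[OF J f] by blast
  define P where "P = (\<lambda>(i, j). if i \<in> I \<and> j \<in> J then (if i = j then linear_form I u else 0) - mconst (u i) * mvar j else 0)"
  have P: "meval a (P k) = chart_matrix I J u a k" for a k
    by (auto simp: P_def chart_matrix_def mult.commute split: prod.splits)
  define R where "R = (\<lambda>(i, k). \<Sum>j\<in>J. P (i, j) * mconst (B (j, k)))"
  have "meval a (R k) = mat_mul J (chart_matrix I J u a) B k" for a k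
    by (auto simp: R_def mat_mul_def P split: prod.splits)
  then have R: "(\<lambda>k. meval a (R k)) = mat_mul J (chart_matrix I J u a) B" for a by (rule ext)
  show ?thesis
    by (intro exI[of _ "msubst (\<lambda>m. msubst R (C m)) q"] allI) (simp add: meval_msubst C R)
qed

lemma proj_space_rep:
  assumes "H \<in> proj_space I" "a \<in> H" shows "a \<in> nonzero_vecs I" "H = proj_point a"
proof -
  obtain b where b: "b \<in> nonzero_vecs I" "H = proj_point b" using assms(1) by (auto simp: proj_space_def)
  obtain t where t: "t \<noteq> 0" "a = (\<lambda>i. t * b i)" using assms(2) b(2) by (auto simp: proj_point_def)
  show "a \<in> nonzero_vecs I" using b(1) t by (auto simp: nonzero_vecs_def vecs_def fun_eq_iff)
  show "H = proj_point a" using proj_point_scale[OF t(1), of b] b(2) t(2) by simp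
qed

lemma proj_point_self: "a \<in> proj_point a"
  unfolding proj_point_def by (auto intro!: exI[of _ 1])

text \<open>The equation selected by \<open>SOME\<close> may come from another coefficient vector of
  \<open>H\<close> and another parametrization. These differ by scalars and, by
  \<open>parametrizations_equivalent\<close>, an element of \<open>GL\<close>, which the orbit
  absorbs.\<close>

lemma hyperplane_section_map_eq:
  assumes H: "H \<in> proj_space {0..n}" and a: "a \<in> H" and A: "hyperplane_param {0..n} {1..n} a A" and c: "c \<noteq> 0"
  shows "hyperplane_section_map n f H = PGL_orbit {1..n} (form_point (mconst c * lin_subst {1..n} A f))"
proof -
  let ?I = "{0..n}" and ?J = "{1..n}"
  have "\<exists>g. \<exists>a\<in>H. section_equation n f a g" using a A c unfolding section_equation_iff by blast
  then have "\<exists>a'\<in>H. section_equation n f a' (SOME g. \<exists>a\<in>H. section_equation n f a g)" by (rule someI_ex)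
  then obtain a' A' c' where a': "a' \<in> H" "hyperplane_param ?I ?J a' A'" "c' \<noteq> 0"
    and g: "(SOME g. \<exists>a\<in>H. section_equation n f a g) = mconst c' * lin_subst ?J A' f"
    unfolding section_equation_iff by blast
  have anz: "a \<in> nonzero_vecs ?I" by (rule proj_space_rep[OF H a])
  have "a' \<in> proj_point a" using proj_space_rep(2)[OF H a] a'(1) by simp
  then obtain t where t: "t \<noteq> 0" "a' = (\<lambda>i. t * a i)" by (auto simp: proj_point_def)
  have "hyperplane_param ?I ?J a A'" using a'(2) unfolding t(2) hyperplane_param_scale[OF t(1)] .
  then obtain B where B: "B \<in> GL ?J" "A' = mat_mul ?J A B"
    using parametrizations_equivalent[of ?I ?J a A A'] anz A unfolding hyperplane_param_def by auto
  show ?thesis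
    unfolding hyperplane_section_map_def g form_point_mconst[OF a'(3)] form_point_mconst[OF c] B(2) lin_subst_mat_mul
    by (rule PGL_orbit_lin_subst) (use B(1) in auto)
qed

lemma smooth_mconst_mult: "c \<noteq> 0 \<Longrightarrow> smooth_hypersurface J (mconst c * g) \<longleftrightarrow> smooth_hypersurface J g"
  by (simp add: smooth_hypersurface_def sing_locus_def partial_mconst_mult)

lemma smooth_nonzero:
  assumes "j \<in> J" "smooth_hypersurface J g" shows "g \<noteq> 0"
proof
  assume "g = 0"
  moreover have "unit_vec j \<in> nonzero_vecs J"
    using unit_vec_vecs[OF assms(1)] by (auto simp: nonzero_vecs_def unit_vec_def fun_eq_iff)
  ultimately show False using assms(2) by (auto simp: smooth_hypersurface_def sing_locus_def)
qed

lemma mconst_power_lin_subst: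
  assumes "f \<in> forms I d"
  shows "mconst (t ^ d) * lin_subst J A f = lin_subst J (\<lambda>k. t * A k) f"
proof (rule mpoly_eqI)
  fix y
  have "mat_vec J (\<lambda>k. t * A k) y = (\<lambda>i. t * mat_vec J A y i)"
    by (auto simp: mat_vec_def sum_distrib_left mult.assoc)
  then show "meval y (mconst (t ^ d) * lin_subst J A f) = meval y (lin_subst J (\<lambda>k. t * A k) f)"
    by (simp add: meval_lin_subst meval_scale[OF assms])
qed

theorem theorem6p2:
  fixes n d :: nat and f g :: "nat mpoly" and l :: "nat \<Rightarrow> complex"
  assumes "n \<ge> 3" and "d \<ge> 3" and "(n, d) \<noteq> (3, 3)"
    and "f \<in> forms {0..n} d" and "f \<noteq> 0"
    and "isolated_singularities {0..n} f"
    and "l \<in> nonzero_vecs {0..n}"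
    and "vanishing_locus {0..n} (linear_form {0..n} l) \<inter> sing_locus {0..n} f = {}"
    and "section_equation n f l g"
    and "\<not> smooth_hypersurface {1..n} g"
    and "dim_Aut {0..n} (vanishing_locus {0..n} f) = 0"
    and "r_inv {1..n} g > 1"
    and "s_inv {1..n} g > 1"
  shows "generically_finite_onto_image (moduli_space {1..n} d) (smooth_sections n f)
           (hyperplane_section_map n f)"
proof -
  let ?I = "{0..n}" and ?J = "{1..n}"
  let ?M = "monomials ?J d" and ?T = "moduli_space ?J d" and ?U = "smooth_sections n f" and ?\<Phi> = "hyperplane_section_map n f"
  let ?param = "hyperplane_param ?I ?J"
  have I: "finite ?I" and J: "finite ?J" and IJ: "?I = insert 0 ?J" by auto
  have f: "f \<in> forms ?I d" by fact
  have fr: "f \<in> poly_ring ?I" using f by (rule forms_poly_ring)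
  have d: "d \<ge> 1" "d \<ge> 2" using assms(2) by auto
  have fJ: "lin_subst ?J A f \<in> forms ?J d" for A by (rule lin_subst_forms[OF f])
  obtain A0 c0 where A0: "A0 \<in> vecs (?I \<times> ?J)"
      "bij_betw (mat_vec ?J A0) (vecs ?J) (hyperplane ?I l)"
    and c0: "c0 \<noteq> 0" and g: "g = mconst c0 * lin_subst ?J A0 f"
    using assms(9) unfolding section_equation_iff hyperplane_param_def by blast
  have "\<exists>c\<in>poly_ring ?M. (\<exists>A'\<in>vecs (?I \<times> ?J). meval (lookup (lin_subst ?J A' f)) c \<noteq> 0) \<and>
    (\<forall>w. meval w c \<noteq> 0 \<longrightarrow> finite {A' \<in> vecs (?I \<times> ?J). lookup (lin_subst ?J A' f) = w})"
  proof (rule generically_finite_fibers[OF I J fr finite_monomials[OF J] _ A0(1)])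
    show "keys (lin_subst ?J A f) \<subseteq> ?M" for A using fJ[of A] by (simp add: forms_def)
    show "B = (\<lambda>_. 0)" if "B \<in> vecs (?I \<times> ?J)"
      "(\<Sum>i\<in>?I. linear_form ?J (\<lambda>j. B (i, j)) * lin_subst ?J A0 (partial i f)) = 0" for B
      by (rule differential_injective[OF I J assms(7) A0 f d(1) g c0 assms(8,12,13) that])
  qed
  then obtain c A' where c: "c \<in> poly_ring ?M" and A': "A' \<in> vecs (?I \<times> ?J)" "meval (lookup (lin_subst ?J A' f)) c \<noteq> 0"
    and fin: "\<And>w. meval w c \<noteq> 0 \<Longrightarrow> finite {A' \<in> vecs (?I \<times> ?J). lookup (lin_subst ?J A' f) = w}" by blast
  \<comment> \<open>The matrix \<open>A'\<close> with \<open>c \<noteq> 0\<close> need not be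
    injective. On the line from \<open>A0\<close> to \<open>A'\<close> all but finitely many points
    satisfy \<open>c \<noteq> 0\<close>, and all points near \<open>A0\<close> are injective, so
    some point does both.\<close>
  obtain a1 A1 where a1: "a1 \<in> nonzero_vecs ?I" and A1: "?param a1 A1" "meval (lookup (lin_subst ?J A1 f)) c \<noteq> 0"
  proof -
    obtain C where C: "\<And>m A. meval A (C m) = lookup (lin_subst ?J A f) m"
      using coeff_lin_subst_polynomial[OF J fr] by blast
    let ?A = "\<lambda>t k. A0 k + t * (A' k - A0 k)"
    have shift: "?A t = (\<lambda>k. A' k + (t - 1) * (A' k - A0 k))" for t by (auto simp: algebra_simps)
    have Cc: "meval A (msubst C c) = meval (lookup (lin_subst ?J A f)) c" for A by (simp add: meval_msubst C)
    have "finite {t. meval (\<lambda>k. A' k + t * (A' k - A0 k)) (msubst C c) = 0}"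
      by (rule meval_line_finite) (use A'(2) in \<open>simp add: Cc\<close>)
    then have "finite ((\<lambda>t. t + 1) ` {t. meval (\<lambda>k. A' k + t * (A' k - A0 k)) (msubst C c) = 0})" by (rule finite_imageI)
    moreover have "{t. meval (?A t) (msubst C c) = 0} \<subseteq> (\<lambda>t. t + 1) ` {t. meval (\<lambda>k. A' k + t * (A' k - A0 k)) (msubst C c) = 0}"
    proof
      fix t assume "t \<in> {t. meval (?A t) (msubst C c) = 0}"
      then have "t - 1 \<in> {t. meval (\<lambda>k. A' k + t * (A' k - A0 k)) (msubst C c) = 0}" unfolding shift by simp
      then show "t \<in> (\<lambda>t. t + 1) ` {t. meval (\<lambda>k. A' k + t * (A' k - A0 k)) (msubst C c) = 0}"
        by (rule rev_image_eqI) simp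
    qed
    ultimately have bad: "finite {t. meval (?A t) (msubst C c) = 0}" by (rule finite_subset[rotated])
    obtain L where L: "L \<in> vecs (?J \<times> ?I)" "\<And>y. y \<in> vecs ?J \<Longrightarrow> mat_vec ?I L (mat_vec ?J A0 y) = y"
      using hyperplane_frame[OF I J assms(7) A0] by blast
    obtain \<epsilon> where \<epsilon>: "\<epsilon> > 0" "\<And>t. cmod t < \<epsilon> \<Longrightarrow> inj_on (mat_vec ?J (?A t)) (vecs ?J)"
      using injective_perturbation[OF J L(2,1), of "\<lambda>k. A' k - A0 k"] by blast
    have "infinite (ball (0::complex) \<epsilon>)" using \<epsilon>(1) uncountable_ball countable_finite by blast
    then obtain t where t: "t \<in> ball 0 \<epsilon>" "meval (?A t) (msubst C c) \<noteq> 0"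
      using bad finite_subset by (metis (mono_tags, lifting) mem_Collect_eq subsetI)
    have AI: "?A t \<in> vecs (?I \<times> ?J)" using A0(1) A'(1) by (auto simp: vecs_def)
    have inj: "inj_on (mat_vec ?J (?A t)) (vecs ?J)" using \<epsilon>(2) t(1) by simp
    obtain a where "a \<in> nonzero_vecs ?I" "bij_betw (mat_vec ?J (?A t)) (vecs ?J) (hyperplane ?I a)"
      using injective_image_hyperplane[OF I J _ AI inj] by auto
    then show ?thesis using that[of a "?A t"] AI t(2) by (simp add: hyperplane_param_def Cc)
  qed
  obtain D where D: "D \<in> poly_ring ?I" "D \<noteq> 0" "\<And>v. meval v f = 0 \<Longrightarrow> meval (\<lambda>i. meval v (partial i f)) D = 0"
    using gradient_relation[OF I fr assms(5)] by blast
  obtain E where E: "meval l E \<noteq> 0" "\<And>a v. meval a E \<noteq> 0 \<Longrightarrow> v \<in> sing_cone ?I f \<Longrightarrow> (\<Sum>i\<in>?I. a i * v i) \<noteq> 0"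
    using avoid_singularities[OF I f assms(6-8)] by blast
  \<comment> \<open>\<open>q\<close> is an arbitrary further condition that holds for some section.
    It is combined on one hyperplane with the finiteness condition \<open>c\<close> and with
    smoothness, which is what density requires.\<close>
  have generic: "\<exists>a\<in>nonzero_vecs ?I. \<exists>A. ?param a A \<and> (\<forall>A'. ?param a A' \<longrightarrow> smooth_hypersurface ?J (lin_subst ?J A' f)) \<and>
      (\<exists>B\<in>GL ?J. meval (lookup (lin_subst ?J (mat_mul ?J A B) f)) c \<noteq> 0) \<and>
      (\<exists>B\<in>GL ?J. meval (lookup (lin_subst ?J (mat_mul ?J A B) f)) q \<noteq> 0)"
    if a2: "a2 \<in> nonzero_vecs ?I" and A2: "?param a2 A2" "meval (lookup (lin_subst ?J A2 f)) q \<noteq> 0" for a2 A2 q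
  proof -
    have lf: "\<exists>v\<in>vecs ?I. meval v (linear_form ?I a) \<noteq> 0" if a: "a \<in> nonzero_vecs ?I" for a
    proof -
      obtain k where k: "k \<in> ?I" "a k \<noteq> 0" using a by (auto simp: nonzero_vecs_def vecs_def fun_eq_iff)
      have "linear_form ?I a \<noteq> 0" using linear_form_eq_0[OF I _ k(1), of a] k(2) by blast
      then show ?thesis using nonzero_value[OF I forms_poly_ring[OF forms_linear_form]] by blast
    qed
    \<comment> \<open>\<open>u\<close> becomes a common center of the charts around
      \<open>a1\<close> and \<open>a2\<close>: it lies on neither hyperplane and off the coordinate
      hyperplane of index 0.\<close>
    have "\<exists>u\<in>vecs ?I. meval u (\<Prod>p\<in>{linear_form ?I a1, linear_form ?I a2, mvar 0}. p) \<noteq> 0"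
    proof (rule prod_nonzero_value)
      fix p assume p: "p \<in> {linear_form ?I a1, linear_form ?I a2, mvar 0}"
      have "\<exists>v\<in>vecs ?I. meval v (mvar 0) \<noteq> 0" by (intro bexI[of _ "unit_vec 0"]) (auto simp: unit_vec_def vecs_def)
      then show "\<exists>v\<in>vecs ?I. meval v p \<noteq> 0" using p lf[OF a1] lf[OF a2] by blast
    qed simp
    then obtain u where u: "u \<in> vecs ?I" and "meval u (\<Prod>p\<in>{linear_form ?I a1, linear_form ?I a2, mvar 0}. p) \<noteq> 0" by blast
    then have nz: "meval u p \<noteq> 0" if "p \<in> {linear_form ?I a1, linear_form ?I a2, mvar 0}" for p
      using that by (simp only: meval_simps prod_zero_iff finite.intros) blast
    have u0: "u 0 \<noteq> 0" and a1u: "(\<Sum>k\<in>?I. a1 k * u k) \<noteq> 0" and a2u: "(\<Sum>k\<in>?I. a2 k * u k) \<noteq> 0"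
      using nz[of "mvar 0"] nz[of "linear_form ?I a1"] nz[of "linear_form ?I a2"] by simp_all
    let ?C = "chart_matrix ?I ?J u"
    have chart: "?param a (?C a)" if "a \<in> vecs ?I" "(\<Sum>k\<in>?I. a k * u k) \<noteq> 0" for a
      using chart_matrix_param[of ?J 0 u a] u u0 that unfolding IJ by simp
    have equiv: "\<exists>B\<in>GL ?J. A = mat_mul ?J (?C a) B" if "a \<in> nonzero_vecs ?I" "?param a A" "(\<Sum>k\<in>?I. a k * u k) \<noteq> 0" for a A
      using parametrizations_equivalent[OF I J that(1), of "?C a" A] chart[of a] that
      unfolding hyperplane_param_def nonzero_vecs_def by blast
    obtain B1 where B1: "B1 \<in> GL ?J" "A1 = mat_mul ?J (?C a1) B1" using equiv[OF a1 A1(1) a1u] by blast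
    obtain B2 where B2: "B2 \<in> GL ?J" "A2 = mat_mul ?J (?C a2) B2" using equiv[OF a2 A2(1) a2u] by blast
    obtain Q1 where Q1: "\<And>a. meval a Q1 = meval (lookup (lin_subst ?J (mat_mul ?J (?C a) B1) f)) c"
      using chart_polynomial[OF J fr] by blast
    obtain Q2 where Q2: "\<And>a. meval a Q2 = meval (lookup (lin_subst ?J (mat_mul ?J (?C a) B2) f)) q"
      using chart_polynomial[OF J fr] by blast
    \<comment> \<open>Each factor is nonzero somewhere: \<open>Q1\<close> and
      \<open>linear_form ?I u\<close> at \<open>a1\<close>, \<open>Q2\<close> at \<open>a2\<close>,
      \<open>E\<close> at \<open>l\<close>, and \<open>D\<close> as a nonzero polynomial. The last
      factor keeps \<open>a\<close> inside the chart.\<close>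
    have "\<exists>a\<in>vecs ?I. meval a (\<Prod>p\<in>{Q1, Q2, D, E, linear_form ?I u}. p) \<noteq> 0"
    proof (rule prod_nonzero_value)
      fix p assume p: "p \<in> {Q1, Q2, D, E, linear_form ?I u}"
      have "meval a1 Q1 \<noteq> 0" "meval a2 Q2 \<noteq> 0" using A1(2) A2(2) by (simp_all add: Q1 Q2 B1(2) B2(2))
      moreover have "\<exists>v\<in>vecs ?I. meval v D \<noteq> 0" by (rule nonzero_value[OF I D(1,2)])
      moreover have "meval a1 (linear_form ?I u) \<noteq> 0" using a1u by (simp add: mult.commute)
      moreover have "a1 \<in> vecs ?I" "a2 \<in> vecs ?I" "l \<in> vecs ?I" using a1 a2 assms(7) by (auto simp: nonzero_vecs_def)
      ultimately show "\<exists>v\<in>vecs ?I. meval v p \<noteq> 0" using p E(1) by blast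
    qed simp
    then obtain a where a: "a \<in> vecs ?I" and "meval a (\<Prod>p\<in>{Q1, Q2, D, E, linear_form ?I u}. p) \<noteq> 0" by blast
    then have nz: "meval a p \<noteq> 0" if "p \<in> {Q1, Q2, D, E, linear_form ?I u}" for p
      using that by (simp only: meval_simps prod_zero_iff finite.intros) blast
    have au: "(\<Sum>k\<in>?I. a k * u k) \<noteq> 0" using nz[of "linear_form ?I u"] by (simp add: mult.commute)
    then have anz: "a \<in> nonzero_vecs ?I" using a by (auto simp: nonzero_vecs_def)
    have smooth: "smooth_hypersurface ?J (lin_subst ?J A' f)" if "?param a A'" for A'
      using that unfolding hyperplane_param_def
      by (intro smooth_section[OF I J anz _ _ f d(2) D(1,3)] nz E(2)) auto
    show ?thesis
    proof (intro bexI[OF _ anz] exI[of _ "?C a"] conjI allI impI)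
      show "\<exists>B\<in>GL ?J. meval (lookup (lin_subst ?J (mat_mul ?J (?C a) B) f)) c \<noteq> 0"
        using nz[of Q1] B1(1) unfolding Q1 by blast
      show "\<exists>B\<in>GL ?J. meval (lookup (lin_subst ?J (mat_mul ?J (?C a) B) f)) q \<noteq> 0"
        using nz[of Q2] B2(1) unfolding Q2 by blast
    qed (use smooth chart[OF a au] in auto)
  qed
  define O1 where "O1 = orbit_open ?J d c"
  have J1: "1 \<in> ?J" using assms(1) by simp
  have S: "form_point h \<in> smooth_forms_locus ?J d" if "h \<in> forms ?J d" "smooth_hypersurface ?J h" for h
    using that smooth_nonzero[OF J1 that(2)] by (auto simp: smooth_forms_locus_def)
  have U: "\<exists>a A. a \<in> nonzero_vecs ?I \<and> H = proj_point a \<and> ?param a A \<and> smooth_hypersurface ?J (lin_subst ?J A f) \<and>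
      ?\<Phi> H = PGL_orbit ?J (form_point (lin_subst ?J A f))" if H: "H \<in> ?U" for H
  proof -
    obtain a A c where a: "H \<in> proj_space ?I" "a \<in> H" "?param a A" "c \<noteq> 0" "smooth_hypersurface ?J (mconst c * lin_subst ?J A f)"
      using H unfolding smooth_sections_def section_equation_iff by blast
    show ?thesis
      using a proj_space_rep[OF a(1,2)] hyperplane_section_map_eq[OF a(1-4), of f]
      by (intro exI[of _ a] exI[of _ A]) (simp add: smooth_mconst_mult form_point_mconst)
  qed
  have inU: "proj_point a \<in> ?U" "?\<Phi> (proj_point a) = PGL_orbit ?J (form_point (lin_subst ?J A f))"
    if a: "a \<in> nonzero_vecs ?I" "?param a A" "smooth_hypersurface ?J (lin_subst ?J A f)" for a A
  proof -
    have H: "proj_point a \<in> proj_space ?I" using a(1) by (auto simp: proj_space_def)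
    have "section_equation n f a (lin_subst ?J A f)"
      unfolding section_equation_iff using a(2) by (intro exI[of _ A] exI[of _ 1]) simp
    then show "proj_point a \<in> ?U" unfolding smooth_sections_def using H a(3) proj_point_self[of a] by blast
    show "?\<Phi> (proj_point a) = PGL_orbit ?J (form_point (lin_subst ?J A f))"
      using hyperplane_section_map_eq[OF H proj_point_self a(2), of 1 f] by simp
  qed
  have image: "?\<Phi> ` ?U \<subseteq> topspace ?T"
  proof (rule image_subsetI)
    fix H assume "H \<in> ?U"
    from U[OF this] obtain A where "smooth_hypersurface ?J (lin_subst ?J A f)" "?\<Phi> H = PGL_orbit ?J (form_point (lin_subst ?J A f))" by blast
    then show "?\<Phi> H \<in> topspace ?T" using S[OF fJ] by (simp add: topspace_moduli_space)
  qed
  \<comment> \<open>\<open>c\<close> and \<open>q\<close> are tested on different forms of one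
    orbit, which is harmless because both are used to describe sets of orbits.\<close>
  have dense: "\<exists>H\<in>?U. ?\<Phi> H \<in> O1 \<and>
      (\<exists>h\<in>forms ?J d. smooth_hypersurface ?J h \<and> meval (lookup h) q \<noteq> 0 \<and> ?\<Phi> H = PGL_orbit ?J (form_point h))"
    if a2: "a2 \<in> nonzero_vecs ?I" "?param a2 A2" "meval (lookup (lin_subst ?J A2 f)) q \<noteq> 0" for a2 A2 q
  proof -
    obtain a A B1 B2 where a: "a \<in> nonzero_vecs ?I" "?param a A"
      and sm: "\<And>A'. ?param a A' \<Longrightarrow> smooth_hypersurface ?J (lin_subst ?J A' f)"
      and B1: "B1 \<in> GL ?J" "meval (lookup (lin_subst ?J (mat_mul ?J A B1) f)) c \<noteq> 0"
      and B2: "B2 \<in> GL ?J" "meval (lookup (lin_subst ?J (mat_mul ?J A B2) f)) q \<noteq> 0"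
      using generic[OF a2] by blast
    let ?H = "proj_point a"
    note H = inU[OF a sm[OF a(2)]]
    have "form_point (lin_subst ?J (mat_mul ?J A B1) f) \<in> ?\<Phi> ?H"
      unfolding H(2) PGL_orbit_form_point lin_subst_mat_mul using B1(1) by blast
    moreover have "lookup (lin_subst ?J (mat_mul ?J A B1) f) \<in> form_point (lin_subst ?J (mat_mul ?J A B1) f)"
      by (simp add: form_point_def proj_point_self)
    moreover have "?\<Phi> ?H \<in> PGL_orbit ?J ` smooth_forms_locus ?J d"
      unfolding H(2) using S[OF fJ sm[OF a(2)]] by blast
    ultimately have "?\<Phi> ?H \<in> O1" unfolding O1_def orbit_open_def using B1(2) by blast
    moreover have "?\<Phi> ?H = PGL_orbit ?J (form_point (lin_subst ?J (mat_mul ?J A B2) f))"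
      unfolding H(2) lin_subst_mat_mul PGL_orbit_lin_subst[OF J B2(1)] ..
    moreover have "smooth_hypersurface ?J (lin_subst ?J (mat_mul ?J A B2) f)"
      by (rule sm[OF hyperplane_param_GL[OF J a(2) B2(1)]])
    ultimately show ?thesis using H(1) fJ B2(2) by blast
  qed
  let ?V = "?\<Phi> ` ?U \<inter> O1"
  have O1: "openin ?T O1" unfolding O1_def by (rule openin_orbit_open[OF J c])
  have "openin (subtopology ?T (?\<Phi> ` ?U)) ?V"
    unfolding openin_subtopology using O1 by (intro exI[of _ O1]) (auto simp: Int_commute)
  \<comment> \<open>Here the additional condition is the constant 1.\<close>
  moreover have "?V \<noteq> {}"
    using dense[OF a1 A1(1), of 1] by auto
  moreover have "subtopology ?T (?\<Phi> ` ?U) closure_of ?V = ?\<Phi> ` ?U"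
  proof
    show "subtopology ?T (?\<Phi> ` ?U) closure_of ?V \<subseteq> ?\<Phi> ` ?U"
      using closure_of_subset_topspace[of "subtopology ?T (?\<Phi> ` ?U)"] by auto
    show "?\<Phi> ` ?U \<subseteq> subtopology ?T (?\<Phi> ` ?U) closure_of ?V"
    proof
      fix p assume p: "p \<in> ?\<Phi> ` ?U"
      have "\<exists>y. y \<in> ?V \<and> y \<in> W" if W: "p \<in> W" "openin (subtopology ?T (?\<Phi> ` ?U)) W" for W
      proof -
        obtain O2 where O2: "openin ?T O2" "W = O2 \<inter> ?\<Phi> ` ?U" using W(2) by (auto simp: openin_subtopology)
        obtain H where H: "H \<in> ?U" "p = ?\<Phi> H" using p by blast
        obtain a2 A2 where a2: "a2 \<in> nonzero_vecs ?I" "?param a2 A2" "smooth_hypersurface ?J (lin_subst ?J A2 f)"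
          "?\<Phi> H = PGL_orbit ?J (form_point (lin_subst ?J A2 f))" using U[OF H(1)] by blast
        have "PGL_orbit ?J (form_point (lin_subst ?J A2 f)) \<in> O2" using W(1) O2(2) H(2) a2(4) by simp
        from moduli_space_base[OF O2(1) fJ smooth_nonzero[OF J1 a2(3)] a2(3) this]
        obtain q k where q: "meval (lookup (lin_subst ?J A2 f)) q \<noteq> 0"
          "\<And>h. h \<in> forms ?J d \<Longrightarrow> h \<noteq> 0 \<Longrightarrow> smooth_hypersurface ?J h \<Longrightarrow> meval (lookup h) q \<noteq> 0 \<Longrightarrow> PGL_orbit ?J (form_point h) \<in> O2"
          by blast
        from dense[OF a2(1,2) q(1)] obtain H' h where H': "H' \<in> ?U" "?\<Phi> H' \<in> O1" "h \<in> forms ?J d"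
          "smooth_hypersurface ?J h" "meval (lookup h) q \<noteq> 0" "?\<Phi> H' = PGL_orbit ?J (form_point h)" by blast
        have "?\<Phi> H' \<in> O2" unfolding H'(6) by (rule q(2)[OF H'(3) smooth_nonzero[OF J1 H'(4)] H'(4,5)])
        then show ?thesis using H'(1,2) O2(2) by blast
      qed
      then show "p \<in> subtopology ?T (?\<Phi> ` ?U) closure_of ?V"
        unfolding in_closure_of using p image by auto
    qed
  qed
  moreover have "finite {H \<in> ?U. ?\<Phi> H = p}" if p: "p \<in> ?V" for p
  proof -
    \<comment> \<open>One coefficient vector \<open>w\<close> from the orbit is fixed; every
      hyperplane of the fiber is recovered from a matrix in the finite set \<open>?F\<close> over
      \<open>w\<close>.\<close>
    obtain y w where yw: "y \<in> p" "w \<in> y" "meval w c \<noteq> 0" using p unfolding O1_def orbit_open_def by blast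
    let ?F = "{A \<in> vecs (?I \<times> ?J). lookup (lin_subst ?J A f) = w}"
    let ?P = "\<lambda>A. {proj_point b | b. b \<in> nonzero_vecs ?I \<and> ?param b A}"
    \<comment> \<open>The image of \<open>A\<close> determines the hyperplane, so there is at most
      one element.\<close>
    have "finite (?P A)" for A
    proof (cases "?P A = {}")
      case True
      show ?thesis unfolding True by simp
    next
      case False
      then obtain b where b: "b \<in> nonzero_vecs ?I" "?param b A" by blast
      have "proj_point b' = proj_point b" if "b' \<in> nonzero_vecs ?I" "?param b' A" for b'
        using hyperplane_unique[OF I that(1) b(1)] b(2) that(2) unfolding hyperplane_param_def bij_betw_def by simp
      then have "?P A \<subseteq> {proj_point b}" by blast
      then show ?thesis using finite_subset by blast
    qed
    then have "finite (\<Union>A\<in>?F. ?P A)" using fin[OF yw(3)] by blast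
    moreover have "{H \<in> ?U. ?\<Phi> H = p} \<subseteq> (\<Union>A\<in>?F. ?P A)"
    proof
      fix H assume "H \<in> {H \<in> ?U. ?\<Phi> H = p}"
      then have H: "H \<in> ?U" "?\<Phi> H = p" by auto
      obtain a A where a: "a \<in> nonzero_vecs ?I" "H = proj_point a" "?param a A"
        "?\<Phi> H = PGL_orbit ?J (form_point (lin_subst ?J A f))" using U[OF H(1)] by blast
      obtain B where B: "B \<in> GL ?J" "y = form_point (lin_subst ?J (mat_mul ?J A B) f)"
        using yw(1) H(2) a(4) unfolding PGL_orbit_form_point lin_subst_mat_mul by blast
      obtain t where t: "t \<noteq> 0" "w = (\<lambda>m. t * lookup (lin_subst ?J (mat_mul ?J A B) f) m)"
        using yw(2) B(2) by (auto simp: form_point_def proj_point_def)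
      \<comment> \<open>The coordinate change \<open>B\<close> reaches \<open>w\<close> only up to
        the scalar \<open>t\<close>; as \<open>f\<close> has degree \<open>d\<close>, a
        \<open>d\<close>-th root of \<open>t\<close> can be absorbed into the matrix.\<close>
      obtain r where r: "r ^ d = t" using complex_root_exists[of d t] d(1) by auto
      have r0: "r \<noteq> 0" using r t(1) d(1) by auto
      let ?A = "\<lambda>k. r * mat_mul ?J A B k"
      have AB: "?param a (mat_mul ?J A B)" by (rule hyperplane_param_GL[OF J a(3) B(1)])
      have "lookup (lin_subst ?J ?A f) = w"
        unfolding mconst_power_lin_subst[OF f, symmetric] t(2) r by auto
      moreover have "?A \<in> vecs (?I \<times> ?J)" using AB by (auto simp: hyperplane_param_def vecs_def)
      moreover have "?param a ?A"
      proof -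
        have sc: "mat_vec ?J ?A y = (\<lambda>i. r * mat_vec ?J (mat_mul ?J A B) y i)" for y
          by (auto simp: mat_vec_def sum_distrib_left mult.assoc)
        let ?K = "hyperplane ?I a"
        have "bij_betw (\<lambda>v i. r * v i) ?K ?K"
        proof (rule bij_betw_byWitness[where f' = "\<lambda>v i. (1 / r) * v i"])
          have "(\<Sum>i\<in>?I. a i * (s * v i)) = s * (\<Sum>i\<in>?I. a i * v i)" for s v
            by (simp add: sum_distrib_left mult_ac)
          then show "(\<lambda>v i. r * v i) ` ?K \<subseteq> ?K" "(\<lambda>v i. (1 / r) * v i) ` ?K \<subseteq> ?K"
            by (auto simp: vecs_def simp del: times_divide_eq_left)
        qed (use r0 in auto)
        then have "bij_betw ((\<lambda>v i. r * v i) \<circ> mat_vec ?J (mat_mul ?J A B)) (vecs ?J) ?K"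
          using AB bij_betw_trans unfolding hyperplane_param_def by blast
        moreover have "(\<lambda>v i. r * v i) \<circ> mat_vec ?J (mat_mul ?J A B) = mat_vec ?J ?A" by (rule ext) (simp only: sc comp_apply)
        ultimately show ?thesis using \<open>?A \<in> vecs (?I \<times> ?J)\<close> by (simp add: hyperplane_param_def)
      qed
      ultimately show "H \<in> (\<Union>A\<in>?F. ?P A)" using a(1,2) by blast
    qed
    ultimately show ?thesis by (rule finite_subset[rotated])
  qed
  ultimately show ?thesis unfolding generically_finite_onto_image_def by blast
qed

end
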